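(* Let $K\ge1$ and $K'\ge0$ be constants, let $p\in(0,1)$ and put $q=p/(1-p)$. Let $f=u+iv$ be a harmonic $(K,K')$-quasiregular mapping in $\mathbb{D}$ with $v(0)=0$. If $|\nabla u|\in\mathbf{H}^p_g$, then $v\in\mathbf{h}^q$ and $f\in\mathbf{h}^q$. For each value of $p\in(0,1)$ the index $q=p/(1-p)$ is best possible, i.e. it cannot be replaced by any larger index: for every $q'>p/(1-p)$ there is a harmonic $(K,K')$-quasiregular mapping $f=u+iv$ in $\mathbb{D}$ with $v(0)=0$ and $|\nabla u|\in\mathbf{H}^p_g$ such that the conclusion "$v\in\mathbf{h}^{q'}$ and $f\in\mathbf{h}^{q'}$" fails.
   Context: $\mathbb{D}$ is the open unit disk in $\mathbb{C}$. For a complex-valued $f$ write $f_z=\frac12(f_x-if_y)$, $f_{\overline z}=\frac12(f_x+if_y)$, $\Lambda_f=|f_z|+|f_{\overline z}|$, and $J_f=|f_z|^2-|f_{\overline z}|^2$ (the Jacobian). For constants $K\ge1$, $K'\ge0$, a mapping $f:\mathbb{D}\to\mathbb{C}$ is $(K,K')$-quasiregular if (1) $f$ is absolutely continuous on lines with locally $L^2$-integrable partial derivatives ($ACL^2$) and $J_f\ge0$ a.e. in $\mathbb{D}$; and (2) $\Lambda_f^2\le KJ_f+K'$ a.e. in $\mathbb{D}$. A harmonic $(K,K')$-quasiregular mapping is a complex-valued harmonic function on $\mathbb{D}$ that is $(K,K')$-quasiregular. Here $u=\mathrm{Re}\,f$, $v=\mathrm{Im}\,f$, and $|\nabla u|=\sqrt{u_x^2+u_y^2}$.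 For $p\in(0,\infty)$ and $r\in[0,1)$, $M_p(r,f)=\left(\frac1{2\pi}\int_0^{2\pi}|f(re^{i\theta})|^p\,d\theta\right)^{1/p}$. $\mathbf{H}^p_g$ is the set of all measurable functions $f:\mathbb{D}\to\mathbb{C}$ such that $M_p(r,f)$ exists for all $r\in[0,1)$ and $\sup_{r\in[0,1)}M_p(r,f)<\infty$; $\mathbf{h}^p$ is the set of harmonic functions in $\mathbf{H}^p_g$. *)

theory Defs
  imports "HOL-Analysis.Analysis"
begin

abbreviation unit_disc :: "complex set" where
  "unit_disc \<equiv> ball 0 1"

text \<open>
  Functions on a domain of the complex plane are total functions of type
  \<^typ>\<open>complex \<Rightarrow> 'a\<close>. Every notion below, taken on an open set, depends only on the values of the
  function on that set.
\<close>

subsection \<open>Partial derivatives\<close>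

text \<open>
  The values of \<open>pdx\<close> and \<open>pdy\<close> are meaningful only at points where \<open>has_partials_at\<close> holds.
\<close>

definition pdx :: "(complex \<Rightarrow> 'a::real_normed_vector) \<Rightarrow> complex \<Rightarrow> 'a" where
  "pdx f z = vector_derivative (\<lambda>t. f (z + complex_of_real t)) (at 0)"

definition pdy :: "(complex \<Rightarrow> 'a::real_normed_vector) \<Rightarrow> complex \<Rightarrow> 'a" where
  "pdy f z = vector_derivative (\<lambda>t. f (z + \<i> * complex_of_real t)) (at 0)"

definition has_partials_at :: "(complex \<Rightarrow> 'a::real_normed_vector) \<Rightarrow> complex \<Rightarrow> bool" where
  "has_partials_at f z \<longleftrightarrow>
     (\<lambda>t. f (z + complex_of_real t)) differentiable (at 0) \<and>
     (\<lambda>t. f (z + \<i> * complex_of_real t)) differentiable (at 0)"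

definition wirtinger_z :: "(complex \<Rightarrow> complex) \<Rightarrow> complex \<Rightarrow> complex" where
  "wirtinger_z f z = (pdx f z - \<i> * pdy f z) / 2"

definition wirtinger_zbar :: "(complex \<Rightarrow> complex) \<Rightarrow> complex \<Rightarrow> complex" where
  "wirtinger_zbar f z = (pdx f z + \<i> * pdy f z) / 2"

definition Lambda :: "(complex \<Rightarrow> complex) \<Rightarrow> complex \<Rightarrow> real" where
  "Lambda f z = cmod (wirtinger_z f z) + cmod (wirtinger_zbar f z)"

definition Jacobian :: "(complex \<Rightarrow> complex) \<Rightarrow> complex \<Rightarrow> real" where
  "Jacobian f z = (cmod (wirtinger_z f z))\<^sup>2 - (cmod (wirtinger_zbar f z))\<^sup>2"

definition grad_norm :: "(complex \<Rightarrow> real) \<Rightarrow> complex \<Rightarrow> real" where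
  "grad_norm u z = sqrt ((pdx u z)\<^sup>2 + (pdy u z)\<^sup>2)"

subsection \<open>Harmonic functions\<close>

definition C1_on :: "complex set \<Rightarrow> (complex \<Rightarrow> complex) \<Rightarrow> bool" where
  "C1_on S f \<longleftrightarrow> (\<forall>z\<in>S. has_partials_at f z) \<and>
     continuous_on S f \<and> continuous_on S (pdx f) \<and> continuous_on S (pdy f)"

definition C2_on :: "complex set \<Rightarrow> (complex \<Rightarrow> complex) \<Rightarrow> bool" where
  "C2_on S f \<longleftrightarrow> C1_on S f \<and> C1_on S (pdx f) \<and> C1_on S (pdy f)"

definition harmonic_on :: "complex set \<Rightarrow> (complex \<Rightarrow> complex) \<Rightarrow> bool" where
  "harmonic_on S f \<longleftrightarrow> C2_on S f \<and> (\<forall>z\<in>S. pdx (pdx f) z + pdy (pdy f) z = 0)"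

subsection \<open>Absolute continuity on lines\<close>

text \<open>
  The usual \<open>\<epsilon>\<close>-\<open>\<delta>\<close> definition on \<open>[a, b]\<close>, with finitely many non-overlapping
  intervals \<open>[s i, t i]\<close>, \<open>i < n\<close>.
\<close>

definition abs_continuous_Icc :: "real \<Rightarrow> real \<Rightarrow> (real \<Rightarrow> complex) \<Rightarrow> bool" where
  "abs_continuous_Icc a b g \<longleftrightarrow>
     (\<forall>\<epsilon>>0. \<exists>\<delta>>0. \<forall>(n::nat) s t.
        (\<forall>i<n. a \<le> s i \<and> s i \<le> t i \<and> t i \<le> b) \<and>
        disjoint_family_on (\<lambda>i. {s i<..<t i}) {..<n} \<and>
        (\<Sum>i<n. t i - s i) < \<delta>
        \<longrightarrow> (\<Sum>i<n. cmod (g (t i) - g (s i))) < \<epsilon>)"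

text \<open>
  As usual, continuity is part of being absolutely continuous on lines; the partial derivatives
  then exist almost everywhere.
\<close>

definition ACL_on :: "complex set \<Rightarrow> (complex \<Rightarrow> complex) \<Rightarrow> bool" where
  "ACL_on S f \<longleftrightarrow> continuous_on S f \<and>
     (\<forall>a b c d. a < b \<and> c < d \<and> cbox (Complex a c) (Complex b d) \<subseteq> S \<longrightarrow>
        (AE y in lebesgue_on {c..d}. abs_continuous_Icc a b (\<lambda>x. f (Complex x y))) \<and>
        (AE x in lebesgue_on {a..b}. abs_continuous_Icc c d (\<lambda>y. f (Complex x y))))"

definition locally_L2_on :: "complex set \<Rightarrow> (complex \<Rightarrow> complex) \<Rightarrow> bool" where
  "locally_L2_on S g \<longleftrightarrow>
     (\<forall>C. compact C \<and> C \<subseteq> S \<longrightarrow>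
        g \<in> borel_measurable (lebesgue_on C) \<and>
        integrable (lebesgue_on C) (\<lambda>z. (cmod (g z))\<^sup>2))"

definition ACL2_on :: "complex set \<Rightarrow> (complex \<Rightarrow> complex) \<Rightarrow> bool" where
  "ACL2_on S f \<longleftrightarrow> ACL_on S f \<and> locally_L2_on S (pdx f) \<and> locally_L2_on S (pdy f)"

subsection \<open>Quasiregular mappings of the disc\<close>

definition quasiregular :: "real \<Rightarrow> real \<Rightarrow> (complex \<Rightarrow> complex) \<Rightarrow> bool" where
  "quasiregular K K' f \<longleftrightarrow>
     ACL2_on unit_disc f \<and>
     (AE z in lebesgue_on unit_disc. Jacobian f z \<ge> 0) \<and>
     (AE z in lebesgue_on unit_disc. (Lambda f z)\<^sup>2 \<le> K * Jacobian f z + K')"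

definition harmonic_quasiregular :: "real \<Rightarrow> real \<Rightarrow> (complex \<Rightarrow> complex) \<Rightarrow> bool" where
  "harmonic_quasiregular K K' f \<longleftrightarrow> harmonic_on unit_disc f \<and> quasiregular K K' f"

subsection \<open>Hardy type spaces\<close>

definition M_exists :: "real \<Rightarrow> real \<Rightarrow> (complex \<Rightarrow> complex) \<Rightarrow> bool" where
  "M_exists p r f \<longleftrightarrow>
     integrable (lebesgue_on {0..2*pi}) (\<lambda>\<theta>. cmod (f (rcis r \<theta>)) powr p)"

definition M :: "real \<Rightarrow> real \<Rightarrow> (complex \<Rightarrow> complex) \<Rightarrow> real" where
  "M p r f =
     (1 / (2*pi) * (LINT \<theta>|lebesgue_on {0..2*pi}. cmod (f (rcis r \<theta>)) powr p)) powr (1/p)"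

definition Hg :: "real \<Rightarrow> (complex \<Rightarrow> complex) set" where
  "Hg p = {f. f \<in> borel_measurable (lebesgue_on unit_disc) \<and>
              (\<forall>r\<in>{0..<1}. M_exists p r f) \<and>
              bdd_above ((\<lambda>r. M p r f) ` {0..<1})}"

definition h_space :: "real \<Rightarrow> (complex \<Rightarrow> complex) set" where
  "h_space p = {f \<in> Hg p. harmonic_on unit_disc f}"

end

theory Submission
  imports Defs "HOL-Complex_Analysis.Complex_Analysis"
begin

text \<open>
  Quasiregularity gives \<open>\<Lambda>\<^sub>f \<le> K \<bar>\<nabla>u\<bar> + \<surd>K'\<close>, so the holomorphic functions \<open>f\<^sub>z\<close> and the conjugate of
  \<open>f\<^sub>z\<^sub>b\<^sub>a\<^sub>r\<close> have bounded \<open>p\<close>-means, and \<open>\<bar>f(r e\<^sup>i\<^sup>\<theta>) - f(0)\<bar>\<close> is at most the sum of their radial integrals.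
  By Hardy and Littlewood the radial integral of such a function \<open>G\<close> is bounded by a constant times
  \<open>S\<^sup>1\<^sup>-\<^sup>p\<close>, where \<open>S\<close> is the radial maximal function, and \<open>q (1 - p) = p\<close>. The maximal
  function is controlled in \<open>L\<^sup>p\<close> because \<open>\<bar>G\<bar>\<^sup>p\<^sup>/\<^sup>2\<close> lies below its Poisson integral, whose maximal
  function is bounded on \<open>L\<^sup>2\<close> by a \<open>TT\<^sup>*\<close> argument: linearised with a radius \<open>\<rho>(\<theta>)\<close>, the kernel of \<open>TT\<^sup>*\<close>
  is \<open>P\<^bsub>\<rho>(\<theta>)\<rho>(\<phi>)\<^esub>(\<theta> - \<phi>)\<close> by the semigroup law, and \<open>P\<^bsub>ab\<^esub> \<le> 8 (P\<^bsub>a\<^esub> + P\<^bsub>b\<^esub>)\<close>. For sharpness take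
  \<open>f(z) = (1 - z)\<^sup>-\<^sup>1\<^sup>/\<^sup>q\<close> with \<open>q > p / (1 - p)\<close>.
\<close>

subsection \<open>The Poisson kernel\<close>

text \<open>L^p maximal inequalities for Poisson integrals fail when \<open>p < 1\<close>. Halving
  the exponent puts \<open>|G|^(p/2)\<close> into L^2 on circles, where a single norm inequality is
  enough and no covering argument is needed. Two obstacles shape the details. \<open>G\<close> has
  no boundary values known in advance and may vanish, so its powers are majorised on circles of
  radius below 1 that miss the zeros, and every constant has to be independent of that radius. The
  maximal function is a supremum over uncountably many radii; only a measurable near-maximal choice
  of radius is used, which turns it into one linear operator. The L^2 argument is self-improving: it
  needs some finite bound to start from, which the restriction to radii at most \<open>r < 1\<close>
  supplies, but the final constant does not remember that bound.\<close>

definition poisson_kernel :: "real \<Rightarrow> real \<Rightarrow> real" where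
  "poisson_kernel r \<tau> = (1 - r\<^sup>2) / (cmod (1 - rcis r \<tau>))\<^sup>2"

lemma one_minus_rcis_nonzero:
  assumes "0 \<le> r" "r < 1"
  shows "1 - rcis r \<tau> \<noteq> 0"
proof
  assume "1 - rcis r \<tau> = 0"
  then have "cmod (rcis r \<tau>) = 1" by simp
  with assms show False by simp
qed

lemma poisson_kernel_nonneg: "0 \<le> r \<Longrightarrow> r < 1 \<Longrightarrow> 0 \<le> poisson_kernel r \<tau>"
  unfolding poisson_kernel_def
  by (intro divide_nonneg_nonneg) (auto simp: abs_square_le_1)

lemma cmod_one_minus_rcis_ge: "0 \<le> r \<Longrightarrow> 1 - r \<le> cmod (1 - rcis r \<tau>)"
  using norm_triangle_ineq2[of 1 "rcis r \<tau>"] by simp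

lemma poisson_kernel_le:
  assumes "0 \<le> r" "r < 1"
  shows "poisson_kernel r \<tau> \<le> 2 / (1 - r)"
proof -
  have "poisson_kernel r \<tau> \<le> (1 - r\<^sup>2) / (1 - r)\<^sup>2"
    unfolding poisson_kernel_def using assms cmod_one_minus_rcis_ge[of r \<tau>]
    by (intro divide_left_mono power_mono mult_pos_pos zero_less_power)
       (auto simp: abs_square_le_1 one_minus_rcis_nonzero)
  also have "\<dots> = (1 + r) / (1 - r)"
    using assms by (simp add: power2_eq_square divide_simps) (simp add: algebra_simps)
  also have "\<dots> \<le> 2 / (1 - r)"
    using assms by (intro divide_right_mono) auto
  finally show ?thesis .
qed

lemma cmod_one_minus_rcis_minus: "cmod (1 - rcis r (- \<tau>)) = cmod (1 - rcis r \<tau>)"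
proof -
  have "1 - rcis r (- \<tau>) = cnj (1 - rcis r \<tau>)"
    by (simp add: rcis_def cis_cnj)
  then show ?thesis by (simp only: complex_mod_cnj)
qed

lemma poisson_kernel_minus: "poisson_kernel r (- \<tau>) = poisson_kernel r \<tau>"
  by (simp add: poisson_kernel_def cmod_one_minus_rcis_minus)

text \<open>Cauchy's formula for \<open>W u / (1 - cnj w * u)\<close> at the point \<open>w\<close>
  of the disc: the extra denominator is \<open>1 - r^2\<close> at \<open>w\<close>, and on the unit
  circle \<open>(u - w) * (1 - cnj w * u) = u * |u - w|^2\<close>, which turns the Cauchy kernel
  into the Poisson kernel. The kernel carries no factor \<open>1 / (2 * pi)\<close>, hence the
  \<open>2 * pi\<close> in the value.\<close>

lemma poisson_formula:
  fixes W :: "complex \<Rightarrow> complex"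
  assumes W: "W holomorphic_on ball 0 R" and R: "1 < R" and r: "0 \<le> r" "r < 1"
  shows "((\<lambda>t. of_real (poisson_kernel r (\<theta> - t)) * W (cis t)) has_integral
            2 * pi * W (rcis r \<theta>)) {0..2*pi}"
proof -
  define w where "w = rcis r \<theta>"
  define f where "f u = W u / (1 - cnj w * u)" for u
  have wn: "cmod w = r" using r by (simp add: w_def)
  have nz: "1 - cnj w * u \<noteq> 0" if "cmod u \<le> 1" for u
  proof
    assume "1 - cnj w * u = 0"
    then have "cmod (cnj w * u) = 1" by simp
    then have "r * cmod u = 1" by (simp add: norm_mult wn)
    moreover have "r * cmod u \<le> r * 1" using that r by (intro mult_left_mono) auto
    ultimately show False using r by simp
  qed
  have "f holomorphic_on cball 0 1"
    unfolding f_def using R nz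
    by (intro holomorphic_intros holomorphic_on_subset[OF W]) auto
  then have "((\<lambda>u. f u / (u - w)) has_contour_integral (2 * of_real pi * \<i> * f w)) (circlepath 0 1)"
    by (rule Cauchy_integral_circlepath_simple) (use wn r in auto)
  then have "((\<lambda>t. f (cis t) / (cis t - w) * \<i> * cis t) has_integral (2 * of_real pi * \<i> * f w)) {0..2*pi}"
    unfolding circlepath_def by (subst (asm) has_contour_integral_part_circlepath_iff) auto
  then have I: "((\<lambda>t. ((1 - r\<^sup>2) / \<i>) * (f (cis t) / (cis t - w) * \<i> * cis t)) has_integral
      ((1 - r\<^sup>2) / \<i>) * (2 * of_real pi * \<i> * f w)) {0..2*pi}"
    by (rule has_integral_mult_right)
  have eq1: "((1 - r\<^sup>2) / \<i>) * (2 * of_real pi * \<i> * f w) = 2 * pi * W (rcis r \<theta>)"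
  proof -
    have "cnj w * w = of_real (r\<^sup>2)"
      using complex_norm_square[of w] by (simp add: wn mult.commute)
    moreover have "1 - r\<^sup>2 \<noteq> 0" using r by (simp add: power2_eq_1_iff)
    then have "1 - complex_of_real (r\<^sup>2) \<noteq> 0" by (metis of_real_1 of_real_diff of_real_eq_0_iff)
    ultimately show ?thesis by (simp add: f_def w_def field_simps)
  qed
  have eq2: "((1 - r\<^sup>2) / \<i>) * (f (cis t) / (cis t - w) * \<i> * cis t)
      = of_real (poisson_kernel r (\<theta> - t)) * W (cis t)" for t
  proof -
    define a where "a = 1 - rcis r (\<theta> - t)"
    have a0: "a \<noteq> 0" unfolding a_def by (rule one_minus_rcis_nonzero[OF r])
    have 1: "cis t - w = cis t * a"
      by (simp add: a_def w_def rcis_def algebra_simps cis_mult)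
    have 2: "1 - cnj w * cis t = cnj a"
      by (simp add: a_def w_def rcis_def cis_cnj algebra_simps cis_mult)
    have 3: "of_real (poisson_kernel r (\<theta> - t)) = (1 - r\<^sup>2) / (a * cnj a)"
      unfolding poisson_kernel_def a_def[symmetric] by (simp add: complex_norm_square[symmetric])
    have *: "(A / d) * (B / y / (c * x) * d * c) = A / (x * y) * B"
      if "c \<noteq> 0" "x \<noteq> 0" "y \<noteq> 0" "d \<noteq> 0" for A B c d x y :: complex
      using that by simp
    show ?thesis unfolding f_def 1 2 3 using a0 by (intro *) auto
  qed
  show ?thesis using I unfolding eq1 eq2 .
qed

lemma continuous_on_poisson_kernel [continuous_intros]:
  assumes "continuous_on S f" "continuous_on S g" "\<And>x. x \<in> S \<Longrightarrow> 0 \<le> f x \<and> f x < 1"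
  shows "continuous_on S (\<lambda>x. poisson_kernel (f x) (g x))"
  unfolding poisson_kernel_def rcis_def
  using one_minus_rcis_nonzero assms(3)
  by (intro continuous_intros assms(1,2)) (auto simp: rcis_def)

text \<open>
  Applying the Poisson formula to \<open>(1 + b e\<^sup>-\<^sup>i\<^sup>\<phi> z) / (1 - b e\<^sup>-\<^sup>i\<^sup>\<phi> z)\<close>, whose real part on the unit
  circle is a Poisson kernel.
\<close>

lemma poisson_kernel_semigroup:
  assumes a: "0 \<le> a" "a < 1" and b: "0 \<le> b" "b < 1"
  shows "((\<lambda>t. poisson_kernel a (\<theta> - t) * poisson_kernel b (\<phi> - t)) has_integral
            2 * pi * poisson_kernel (a * b) (\<theta> - \<phi>)) {0..2*pi}"
proof -
  define c where "c = rcis b (- \<phi>)"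
  define W where "W z = (1 + c * z) / (1 - c * z)" for z
  have key: "Re ((1 + rcis s \<tau>) / (1 - rcis s \<tau>)) = poisson_kernel s \<tau>" for s \<tau>
  proof -
    have "Re ((1 + w) / (1 - w)) = (1 - (cmod w)\<^sup>2) / (cmod (1 - w))\<^sup>2" for w
      by (simp add: Re_divide cmod_power2) (simp add: algebra_simps power2_eq_square)
    from this[of "rcis s \<tau>"] show ?thesis by (simp add: poisson_kernel_def)
  qed
  \<comment> \<open>A radius above 1 that keeps the pole of \<open>W\<close> outside:
    \<open>b * R = 2 * b / (1 + b)\<close> is still below 1.\<close>
  define R where "R = 2 / (1 + b)"
  have R: "1 < R" using b by (simp add: R_def)
  have nz: "1 - c * z \<noteq> 0" if "cmod z < R" for z
  proof
    assume "1 - c * z = 0"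
    then have "cmod (c * z) = 1" by simp
    then have "b * cmod z = 1" using b by (simp add: norm_mult c_def)
    moreover have "b * cmod z \<le> b * R" using that b by (intro mult_left_mono) auto
    moreover have "b * R < 1" using b by (simp add: R_def field_simps)
    ultimately show False by simp
  qed
  have W: "W holomorphic_on ball 0 R"
    unfolding W_def using nz by (intro holomorphic_intros) auto
  have "((\<lambda>t. Re (of_real (poisson_kernel a (\<theta> - t)) * W (cis t))) has_integral
            Re (2 * pi * W (rcis a \<theta>))) {0..2*pi}"
    by (intro has_integral_Re poisson_formula[OF W R a])
  moreover have "Re (W (cis t)) = poisson_kernel b (\<phi> - t)" for t
  proof -
    have "c * cis t = rcis b (- (\<phi> - t))" by (simp add: c_def rcis_def cis_mult)
    then show ?thesis unfolding W_def by (simp only: key poisson_kernel_minus)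
  qed
  moreover have "Re (W (rcis a \<theta>)) = poisson_kernel (a * b) (\<theta> - \<phi>)"
  proof -
    have "c * rcis a \<theta> = rcis (a * b) (\<theta> - \<phi>)" by (simp add: c_def rcis_mult mult.commute)
    then show ?thesis unfolding W_def by (simp only: key)
  qed
  ultimately show ?thesis by simp
qed

text \<open>Let \<open>a\<close> be the smaller radius and \<open>c = a * b\<close>. Then
  \<open>1 - c = (1 - a) + a * (1 - b)\<close> is at most \<open>2 * (1 - a)\<close>, and passing
  from radius \<open>a\<close> to \<open>c\<close> moves the point by
  \<open>a - c \<le> 1 - c\<close>, at most its distance from 1. So the numerators compare with a
  factor 2 and the squared denominators with a factor 4; the product is the 8. The sum on the right
  covers both orders of the radii.\<close>

lemma poisson_kernel_mult_le:
  assumes "0 \<le> a" "a < 1" "0 \<le> b" "b < 1"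
  shows "poisson_kernel (a * b) \<tau> \<le> 8 * (poisson_kernel a \<tau> + poisson_kernel b \<tau>)"
proof -
  have *: "poisson_kernel (a * b) \<tau> \<le> 8 * poisson_kernel a \<tau>"
    if a: "0 \<le> a" "a < 1" and b: "0 \<le> b" "b < 1" and ab: "a \<le> b" for a b
  proof -
    define c where "c = a * b"
    have c: "0 \<le> c" "c \<le> a" "c < 1"
      using a b mult_left_mono[of b 1 a] by (auto simp: c_def)
    have "a * (1 - b) \<le> 1 * (1 - a)" using a b ab by (intro mult_mono) auto
    then have 1: "1 - c \<le> 2 * (1 - a)" by (simp add: c_def algebra_simps)
    have "rcis a \<tau> - rcis c \<tau> = of_real (a - c) * cis \<tau>" by (simp add: rcis_def algebra_simps)
    then have "cmod (rcis a \<tau> - rcis c \<tau>) = a - c"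
      using c by (simp add: norm_mult del: of_real_diff)
    then have "cmod (1 - rcis a \<tau>) \<le> cmod (1 - rcis c \<tau>) + (a - c)"
      using norm_triangle_ineq4[of "1 - rcis c \<tau>" "rcis a \<tau> - rcis c \<tau>"] by simp
    also have "a - c \<le> cmod (1 - rcis c \<tau>)"
      using a cmod_one_minus_rcis_ge[OF c(1), of \<tau>] by simp
    finally have 2: "cmod (1 - rcis a \<tau>) \<le> 2 * cmod (1 - rcis c \<tau>)" by simp
    have "(1 - c) * (1 + c) \<le> (2 * (1 - a)) * (1 + a)"
      using 1 a c by (intro mult_mono) auto
    then have 3: "1 - c\<^sup>2 \<le> 2 * (1 - a\<^sup>2)" by (simp add: power2_eq_square algebra_simps)
    have 4: "(cmod (1 - rcis a \<tau>))\<^sup>2 \<le> 4 * (cmod (1 - rcis c \<tau>))\<^sup>2"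
      using power_mono[OF 2, of 2] by (simp add: power_mult_distrib)
    have pos: "0 < (cmod (1 - rcis a \<tau>))\<^sup>2" "0 < (cmod (1 - rcis c \<tau>))\<^sup>2"
      using one_minus_rcis_nonzero a c by auto
    have "(1 - c\<^sup>2) * (cmod (1 - rcis a \<tau>))\<^sup>2 \<le> (2 * (1 - a\<^sup>2)) * (4 * (cmod (1 - rcis c \<tau>))\<^sup>2)"
      using 3 4 a c by (intro mult_mono) (auto simp: abs_square_le_1)
    then show ?thesis unfolding poisson_kernel_def c_def[symmetric]
      using pos by (simp add: field_simps)
  qed
  show ?thesis
  proof (cases "a \<le> b")
    case True
    from *[OF assms this] poisson_kernel_nonneg[OF assms(3,4), of \<tau>] show ?thesis by (simp add: mult.commute)
  next
    case False
    then have "b \<le> a" by simp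
    from *[OF assms(3,4,1,2) this] poisson_kernel_nonneg[OF assms(1,2), of \<tau>] show ?thesis
      by (simp add: mult.commute)
  qed
qed

subsection \<open>Powers of holomorphic functions and their Poisson majorants\<close>

text \<open>Each zero \<open>a\<close> of \<open>G\<close> is traded for a zero at \<open>1 / cnj a\<close> by a Blaschke factor.\<close>

lemma zero_free_majorant:
  assumes "1 < R" "G holomorphic_on ball 0 R"
    and "\<And>z. z \<in> ball 0 R \<Longrightarrow> 1 \<le> cmod z \<Longrightarrow> G z \<noteq> 0"
    and "finite {z \<in> ball 0 R. G z = 0}"
  obtains H S where "1 < S" "S \<le> R" "H holomorphic_on ball 0 S" "\<And>z. z \<in> ball 0 S \<Longrightarrow> H z \<noteq> 0"
    "\<And>z. cmod z = 1 \<Longrightarrow> cmod (H z) = cmod (G z)" "\<And>z. cmod z < 1 \<Longrightarrow> cmod (G z) \<le> cmod (H z)"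
  using assms
proof (induction "card {z \<in> ball 0 R. G z = 0}" arbitrary: R G thesis rule: less_induct)
  case less
  show thesis
  proof (cases "{z \<in> ball 0 R. G z = 0} = {}")
    case True
    show thesis
      by (rule less.prems(1)[OF less.prems(2) order_refl less.prems(3)]) (use True in auto)
  next
    case False
    then obtain a where a: "a \<in> ball 0 R" "G a = 0" by blast
    then have a1: "cmod a < 1" using less.prems(4)[of a] not_less by blast
    \<comment> \<open>\<open>G\<close> does not vanish at 1, so it is not identically zero and its
      zero \<open>a\<close> has a finite order.\<close>
    have nc: "\<not> G constant_on ball 0 R"
    proof
      assume "G constant_on ball 0 R"
      then have "G 1 = 0" using a less.prems(2) unfolding constant_on_def by (auto simp: dist_norm)
      with less.prems(4)[of 1] less.prems(2) show False by auto
    qed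
    obtain g r n where g: "0 < n" "0 < r" "ball a r \<subseteq> ball 0 R" "g holomorphic_on ball a r"
      "\<And>w. w \<in> ball a r \<Longrightarrow> G w = (w - a) ^ n * g w" "\<And>w. w \<in> ball a r \<Longrightarrow> g w \<noteq> 0"
      by (rule holomorphic_factor_zero_nonconstant[OF less.prems(3) open_ball connected_ball a nc], rule that)
    define h where "h w = (if w = a then g a else G w / (w - a) ^ n)" for w
    have hg: "h w = g w" if "w \<in> ball a r" for w
      using that g(5)[OF that] by (auto simp: h_def)
    have Gh: "G w = (w - a) ^ n * h w" for w
      using a g(1) by (auto simp: h_def)
    have "h holomorphic_on ball a r"
      using g(4) hg by (metis holomorphic_transform)
    moreover have "h holomorphic_on ball 0 R - {a}"
    proof -
      have "(\<lambda>w. G w / (w - a) ^ n) holomorphic_on ball 0 R - {a}"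
        by (intro holomorphic_intros holomorphic_on_subset[OF less.prems(3)]) auto
      then show ?thesis by (rule holomorphic_transform) (auto simp: h_def)
    qed
    ultimately have "h holomorphic_on ball a r \<union> (ball 0 R - {a})"
      by (subst holomorphic_on_Un) (auto intro: open_delete)
    then have hh: "h holomorphic_on ball 0 R"
      by (rule holomorphic_on_subset) (use g(2) in auto)
    define b where "b z = 1 - cnj a * z" for z
    \<comment> \<open>For nonzero \<open>a\<close>, \<open>b\<close> vanishes only at
      \<open>1 / cnj a\<close>. The ball of radius \<open>S\<close> leaves this point outside, and
      \<open>S > 1\<close> because \<open>|a| < 1\<close>.\<close>
    define S where "S = (if a = 0 then R else min R (1 / cmod a))"
    have S: "1 < S" "S \<le> R" using less.prems(2) a1 by (auto simp: S_def)
    have b0: "b z \<noteq> 0" if "z \<in> ball 0 S" for z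
    proof
      assume "b z = 0"
      then have "cmod (cnj a * z) = 1" by (simp add: b_def)
      then have e: "cmod a * cmod z = 1" by (simp add: norm_mult)
      then have "a \<noteq> 0" by auto
      then have "cmod z < 1 / cmod a" using that by (auto simp: S_def)
      with e \<open>a \<noteq> 0\<close> show False by (simp add: field_simps)
    qed
    have id: "(cmod (b z))\<^sup>2 - (cmod (z - a))\<^sup>2 = (1 - (cmod z)\<^sup>2) * (1 - (cmod a)\<^sup>2)" for z
      by (simp add: b_def cmod_power2) (simp add: algebra_simps power2_eq_square)
    have bz: "cmod (z - a) \<le> cmod (b z)" if "cmod z \<le> 1" for z
    proof (rule power2_le_imp_le)
      have "0 \<le> (1 - (cmod z)\<^sup>2) * (1 - (cmod a)\<^sup>2)"
        using that a1 by (intro mult_nonneg_nonneg) (auto simp: abs_square_le_1)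
      then show "(cmod (z - a))\<^sup>2 \<le> (cmod (b z))\<^sup>2" using id[of z] by linarith
    qed simp
    have beq: "cmod (z - a) = cmod (b z)" if "cmod z = 1" for z
      using id[of z] that by (simp add: power2_eq_iff_nonneg)
    \<comment> \<open>The full power \<open>n\<close> of the factor is exchanged, so
      \<open>a\<close> leaves the zero set and the number of distinct zeros drops whatever the
      multiplicity.\<close>
    define G' where "G' z = b z ^ n * h z" for z
    have G'h: "G' holomorphic_on ball 0 S"
      unfolding G'_def b_def using S by (intro holomorphic_intros holomorphic_on_subset[OF hh]) auto
    have ha: "h a \<noteq> 0" using g(2,6) hg[of a] by simp
    have G'0: "G' z = 0 \<longleftrightarrow> z \<noteq> a \<and> G z = 0" if "z \<in> ball 0 S" for z
      using b0[OF that] Gh[of z] ha by (auto simp: G'_def)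
    have "{z \<in> ball 0 S. G' z = 0} \<subset> {z \<in> ball 0 R. G z = 0}"
      using G'0 a S by (auto intro!: psubsetI)
    moreover from this have "finite {z \<in> ball 0 S. G' z = 0}"
      using less.prems(5) by (meson finite_subset psubset_imp_subset)
    ultimately have card: "card {z \<in> ball 0 S. G' z = 0} < card {z \<in> ball 0 R. G z = 0}"
      and fin: "finite {z \<in> ball 0 S. G' z = 0}"
      using less.prems(5) by (auto intro: psubset_card_mono)
    have nz: "G' z \<noteq> 0" if "z \<in> ball 0 S" "1 \<le> cmod z" for z
      using G'0[OF that(1)] less.prems(4)[of z] that S by auto
    show thesis
    proof (rule less.hyps[OF card _ S(1) G'h nz fin])
      fix S' H
      assume H: "1 < S'" "S' \<le> S" "H holomorphic_on ball 0 S'" "\<And>z. z \<in> ball 0 S' \<Longrightarrow> H z \<noteq> 0"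
        "\<And>z. cmod z = 1 \<Longrightarrow> cmod (H z) = cmod (G' z)" "\<And>z. cmod z < 1 \<Longrightarrow> cmod (G' z) \<le> cmod (H z)"
      show thesis
      proof (rule less.prems(1)[of S' H])
        show "cmod (H z) = cmod (G z)" if "cmod z = 1" for z
          using H(5)[OF that] beq[OF that] by (simp add: G'_def Gh norm_mult norm_power)
        show "cmod (G z) \<le> cmod (H z)" if "cmod z < 1" for z
        proof -
          have "cmod (G z) \<le> cmod (G' z)"
            using bz[of z] that
            by (auto simp: G'_def Gh norm_mult norm_power intro!: mult_right_mono power_mono)
          with H(6)[OF that] show ?thesis by simp
        qed
      qed (use H S in auto)
    qed
  qed
qed

text \<open>Subharmonicity of \<open>|G|^s\<close>, reduced to the Poisson formula: the majorant
  \<open>H\<close> has no zeros on a ball, hence a logarithm \<open>L\<close>, and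
  \<open>exp (s * L)\<close> is holomorphic with modulus \<open>|H|^s\<close>. The kernel is
  nonnegative, so moduli pass under the integral. Working with \<open>H\<close> loses nothing, as it
  has the modulus of \<open>G\<close> on the circle and dominates it inside.\<close>

lemma powr_le_poisson_integral:
  fixes G :: "complex \<Rightarrow> complex"
  assumes R: "1 < R" and G: "G holomorphic_on ball 0 R"
    and nz: "\<And>z. z \<in> ball 0 R \<Longrightarrow> 1 \<le> cmod z \<Longrightarrow> G z \<noteq> 0"
    and fin: "finite {z \<in> ball 0 R. G z = 0}"
    and r: "0 \<le> r" "r < 1" and s: "0 < s"
  shows "2 * pi * cmod (G (rcis r \<theta>)) powr s
           \<le> integral {0..2*pi} (\<lambda>t. poisson_kernel r (\<theta> - t) * cmod (G (cis t)) powr s)"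
proof -
  obtain H S where H: "1 < S" "S \<le> R" "H holomorphic_on ball 0 S" "\<And>z. z \<in> ball 0 S \<Longrightarrow> H z \<noteq> 0"
    "\<And>z. cmod z = 1 \<Longrightarrow> cmod (H z) = cmod (G z)" "\<And>z. cmod z < 1 \<Longrightarrow> cmod (G z) \<le> cmod (H z)"
    by (rule zero_free_majorant[OF R G nz fin], assumption+, rule that)
  obtain L where L: "L holomorphic_on ball 0 S" "\<And>z. z \<in> ball 0 S \<Longrightarrow> exp (L z) = H z"
    using holomorphic_logarithm_exists[OF convex_ball open_ball H(3,4), of 0] H(1) by auto
  define W where "W z = exp (of_real s * L z)" for z
  have W: "W holomorphic_on ball 0 S"
    unfolding W_def by (intro holomorphic_intros L)
  have Wn: "cmod (W z) = cmod (H z) powr s" if "z \<in> ball 0 S" for z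
    using H(4)[OF that] by (simp add: W_def L(2)[OF that, symmetric] norm_exp_eq_Re powr_def)
  have in_S: "cis t \<in> ball 0 S" for t using H(1) by simp
  let ?f = "\<lambda>t. of_real (poisson_kernel r (\<theta> - t)) * W (cis t)"
  have P: "(?f has_integral 2 * pi * W (rcis r \<theta>)) {0..2*pi}"
    by (rule poisson_formula[OF W H(1) r])
  have cW: "continuous_on A (\<lambda>t. W (cis t))" for A
    using in_S by (intro continuous_on_compose2[OF holomorphic_on_imp_continuous_on[OF W]] continuous_intros) auto
  have cP: "continuous_on A (\<lambda>t. poisson_kernel r (\<theta> - t))" for A
    using r by (intro continuous_intros) auto
  have norm: "norm (?f t) = poisson_kernel r (\<theta> - t) * cmod (G (cis t)) powr s" for t
    using poisson_kernel_nonneg[OF r] by (simp add: norm_mult Wn[OF in_S] H(5))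
  have "norm (integral {0..2*pi} ?f) \<le> integral {0..2*pi} (\<lambda>t. norm (?f t))"
  proof (rule integral_norm_bound_integral)
    show "(\<lambda>t. norm (?f t)) integrable_on {0..2*pi}"
      by (intro integrable_continuous_real continuous_intros cW cP)
  qed (use P in auto)
  moreover have "integral {0..2*pi} ?f = 2 * pi * W (rcis r \<theta>)"
    using P by (rule integral_unique)
  moreover have "cmod (G (rcis r \<theta>)) powr s \<le> cmod (W (rcis r \<theta>))"
    using H(1) r s H(6)[of "rcis r \<theta>"] by (subst Wn) (auto intro!: powr_mono2)
  then have "2 * pi * cmod (G (rcis r \<theta>)) powr s \<le> norm (2 * pi * W (rcis r \<theta>))"
    by (simp add: norm_mult)
  ultimately show ?thesis unfolding norm by (simp only:)
qed

text \<open>Nonconstancy leaves only finitely many zeros in a compact disc, so some annulus just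
  below radius \<open>m\<close> contains none. The circle of radius \<open>\<rho>\<close> lies in
  this annulus, and rescaling it to the unit circle leaves room up to
  \<open>R = m / \<rho>\<close>.\<close>

lemma dilation_zero_free_near_circle:
  fixes G :: "complex \<Rightarrow> complex" and r :: real
  assumes G: "G holomorphic_on ball 0 1" and nc: "\<not> G constant_on ball 0 1" and r: "0 < r" "r < 1"
  obtains \<rho> R :: real where "r < \<rho>" "\<rho> < 1" "1 < R" "(\<lambda>z. G (of_real \<rho> * z)) holomorphic_on ball 0 R"
    "\<And>z. z \<in> ball 0 R \<Longrightarrow> 1 \<le> cmod z \<Longrightarrow> G (of_real \<rho> * z) \<noteq> 0" "finite {z \<in> ball 0 R. G (of_real \<rho> * z) = 0}"
proof -
  define m where "m = (1 + r) / 2"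
  have m: "r < m" "m < 1" using r by (auto simp: m_def)
  have fin: "finite {z \<in> cball 0 m. G z = 0}"
    by (rule holomorphic_compact_finite_zeros[OF G _ _ _ _ nc]) (use m in auto)
  \<comment> \<open>\<open>r\<close> is included so that the maximum exists and the annulus starts
    no lower than \<open>r\<close>. Zeros of modulus exactly \<open>m\<close> are left out, since
    only the open annulus below \<open>m\<close> matters.\<close>
  define Z where "Z = insert r (cmod ` {z \<in> cball 0 m. G z = 0} \<inter> {..<m})"
  have Z: "finite Z" "Z \<noteq> {}" using fin by (auto simp: Z_def)
  define l where "l = Max Z"
  have l: "l \<in> Z" "\<And>x. x \<in> Z \<Longrightarrow> x \<le> l" using Z by (auto simp: l_def)
  have rl: "r \<le> l" "l < m" using l(1) l(2)[of r] m by (auto simp: Z_def)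
  have nz: "G z \<noteq> 0" if "l < cmod z" "cmod z < m" for z
  proof
    assume "G z = 0"
    with that have "cmod z \<in> Z" by (auto simp: Z_def)
    with l(2) that show False by fastforce
  qed
  define \<rho> where "\<rho> = (l + m) / 2"
  have \<rho>: "l < \<rho>" "\<rho> < m" using rl by (auto simp: \<rho>_def)
  have \<rho>0: "0 < \<rho>" using \<rho> rl r by linarith
  define R where "R = m / \<rho>"
  have R: "1 < R" using \<rho> \<rho>0 by (simp add: R_def)
  have sc: "cmod (of_real \<rho> * z) < m" if "z \<in> ball 0 R" for z :: complex
    using that \<rho>0 by (simp add: R_def norm_mult field_simps)
  show thesis
  proof (rule that[of \<rho> R])
    have "(G \<circ> (\<lambda>z. of_real \<rho> * z)) holomorphic_on ball 0 R"
    proof (rule holomorphic_on_compose_gen[OF _ G], intro holomorphic_intros, rule image_subsetI)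
      show "of_real \<rho> * z \<in> ball 0 1" if "z \<in> ball 0 R" for z :: complex
        using sc[OF that] m unfolding mem_ball_0 by linarith
    qed
    then show "(\<lambda>z. G (of_real \<rho> * z)) holomorphic_on ball 0 R" by (simp add: o_def)
    show "G (of_real \<rho> * z) \<noteq> 0" if "z \<in> ball 0 R" "1 \<le> cmod z" for z
    proof (rule nz)
      have "\<rho> \<le> cmod (of_real \<rho> * z)" using that(2) \<rho>0 by (simp add: norm_mult)
      then show "l < cmod (of_real \<rho> * z)" using \<rho> by linarith
    qed (rule sc[OF that(1)])
    show "finite {z \<in> ball 0 R. G (of_real \<rho> * z) = 0}"
    proof (rule finite_imageD)
      show "inj_on (\<lambda>z. of_real \<rho> * z) {z \<in> ball 0 R. G (of_real \<rho> * z) = 0}"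
        using \<rho>0 by (auto simp: inj_on_def)
      show "finite ((\<lambda>z. of_real \<rho> * z) ` {z \<in> ball 0 R. G (of_real \<rho> * z) = 0})"
      proof (rule finite_subset[OF _ fin], rule image_subsetI)
        show "of_real \<rho> * z \<in> {z \<in> cball 0 m. G z = 0}"
          if "z \<in> {z \<in> ball 0 R. G (of_real \<rho> * z) = 0}" for z
          using that less_imp_le[OF sc, of z] unfolding mem_Collect_eq mem_cball_0 by blast
      qed
    qed
  qed (use \<rho> rl m R in auto)
qed

subsection \<open>An \<open>L\<^sup>2\<close> bound for kernel operators\<close>

text \<open>
  The \<open>TT\<^sup>*\<close> argument: if \<open>N\<close> bounds \<open>\<parallel>T\<parallel>\<^sup>2\<close>, then so does \<open>2 C \<surd>N\<close>, because
  \<open>\<parallel>T\<^sup>* h\<parallel>\<^sup>2 \<le> 2 C \<langle>h, T h\<rangle>\<close>. The best bound is therefore at most \<open>4 C\<^sup>2\<close>.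
\<close>

lemma (in finite_measure) kernel_operator_L2_bound:
  fixes k :: "'a \<Rightarrow> 'a \<Rightarrow> ennreal" and B C :: real
  assumes k [measurable]: "case_prod k \<in> borel_measurable (M \<Otimes>\<^sub>M M)"
    and B: "\<And>x y. x \<in> space M \<Longrightarrow> y \<in> space M \<Longrightarrow> k x y \<le> ennreal B"
    and C: "0 \<le> C"
    and TT: "\<And>x x'. x \<in> space M \<Longrightarrow> x' \<in> space M \<Longrightarrow>
               (\<integral>\<^sup>+y. k x y * k x' y \<partial>M) \<le> ennreal C * (k x x' + k x' x)"
    and g: "g \<in> borel_measurable M" and g_fin: "(\<integral>\<^sup>+y. (g y)\<^sup>2 \<partial>M) < \<infinity>"
  shows "(\<integral>\<^sup>+x. (\<integral>\<^sup>+y. k x y * g y \<partial>M)\<^sup>2 \<partial>M) \<le> ennreal (4 * C\<^sup>2) * (\<integral>\<^sup>+y. (g y)\<^sup>2 \<partial>M)"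
proof -
  interpret pair_sigma_finite M M ..
  define T where "T h x = (\<integral>\<^sup>+y. k x y * h y \<partial>M)" for h x
  define T' where "T' h y = (\<integral>\<^sup>+x. k x y * h x \<partial>M)" for h y
  define A where "A h = (\<integral>\<^sup>+y. (h y)\<^sup>2 \<partial>M)" for h :: "'a \<Rightarrow> ennreal"
  have k' [measurable]: "(\<lambda>(y, x). k x y) \<in> borel_measurable (M \<Otimes>\<^sub>M M)"
    using measurable_compose[OF measurable_pair_swap' k] by (simp add: case_prod_beta')
  have Tm [measurable]: "T h \<in> borel_measurable M" if [measurable]: "h \<in> borel_measurable M" for h
    unfolding T_def by measurable
  have T'm [measurable]: "T' h \<in> borel_measurable M" if [measurable]: "h \<in> borel_measurable M" for h
    unfolding T'_def by measurable
  \<comment> \<open>A finite starting value for the self-improvement, from Cauchy-Schwarz and the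
    uniform bound on the kernel; only its finiteness counts.\<close>
  have crude: "A (T h) \<le> ennreal (B\<^sup>2 * (measure M (space M))\<^sup>2) * A h"
    if [measurable]: "h \<in> borel_measurable M" for h
  proof -
    have "(T h x)\<^sup>2 \<le> ennreal (B\<^sup>2 * measure M (space M)) * A h" if x: "x \<in> space M" for x
    proof -
      have "(T h x)\<^sup>2 \<le> (\<integral>\<^sup>+y. (k x y)\<^sup>2 \<partial>M) * A h"
        unfolding T_def A_def using x by (intro Cauchy_Schwarz_nn_integral) measurable
      also have "(\<integral>\<^sup>+y. (k x y)\<^sup>2 \<partial>M) \<le> (\<integral>\<^sup>+y. (ennreal B)\<^sup>2 \<partial>M)"
        using B[OF x] by (intro nn_integral_mono power_mono) auto
      also have "\<dots> \<le> ennreal (B\<^sup>2 * measure M (space M))"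
        by (cases "0 \<le> B") (simp_all add: ennreal_power emeasure_eq_measure ennreal_mult ennreal_neg)
      finally show ?thesis by (simp add: mult_right_mono)
    qed
    then have "A (T h) \<le> (\<integral>\<^sup>+x. ennreal (B\<^sup>2 * measure M (space M)) * A h \<partial>M)"
      unfolding A_def[of "T h"] by (intro nn_integral_mono) auto
    also have "\<dots> = ennreal (B\<^sup>2 * (measure M (space M))\<^sup>2) * A h"
    proof -
      have "ennreal (B\<^sup>2 * (measure M (space M))\<^sup>2) =
          ennreal (B\<^sup>2 * measure M (space M)) * ennreal (measure M (space M))"
        by (subst ennreal_mult[symmetric])
           (simp_all add: power2_eq_square[of "measure M (space M)"] mult_ac)
      then show ?thesis by (simp add: emeasure_eq_measure mult_ac)
    qed
    finally show ?thesis .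
  qed
  \<comment> \<open>\<open>A\<close> is the squared norm: \<open>A (T h)\<close> is the inner
    product of \<open>h\<close> and \<open>T' (T h)\<close> by Fubini, and Cauchy-Schwarz
    applies.\<close>
  have dual: "(A (T h))\<^sup>2 \<le> A h * A (T' (T h))" if [measurable]: "h \<in> borel_measurable M" for h
  proof -
    have "A (T h) = (\<integral>\<^sup>+x. (\<integral>\<^sup>+y. T h x * (k x y * h y) \<partial>M) \<partial>M)"
      unfolding A_def power2_eq_square
      by (subst (2) T_def, intro nn_integral_cong, subst nn_integral_cmult[symmetric]) auto
    also have "\<dots> = (\<integral>\<^sup>+y. (\<integral>\<^sup>+x. T h x * (k x y * h y) \<partial>M) \<partial>M)"
      by (rule Fubini'[symmetric]) measurable
    also have "\<dots> = (\<integral>\<^sup>+y. h y * T' (T h) y \<partial>M)"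
      unfolding T'_def
      by (intro nn_integral_cong, subst nn_integral_cmult[symmetric]) (auto simp: mult_ac)
    finally show ?thesis unfolding A_def[of h] A_def[of "T' (T h)"]
      by (metis Cauchy_Schwarz_nn_integral Tm T'm that)
  qed
  \<comment> \<open>Expanding the square brings out the kernel of \<open>T\<close> composed with its
    adjoint. The bound \<open>TT\<close> replaces it by \<open>k\<close> plus its transpose, and
    these contribute equally after an exchange of variables; that is the 2 in
    \<open>2 * C\<close>.\<close>
  have pos: "A (T' h) \<le> ennreal (2 * C) * (\<integral>\<^sup>+x. h x * T h x \<partial>M)"
    if [measurable]: "h \<in> borel_measurable M" for h
  proof -
    have "A (T' h) = (\<integral>\<^sup>+y. (\<integral>\<^sup>+x. (\<integral>\<^sup>+x'. k x y * h x * (k x' y * h x') \<partial>M) \<partial>M) \<partial>M)"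
      unfolding A_def power2_eq_square T'_def
      by (intro nn_integral_cong, subst nn_integral_multc[symmetric])
         (auto intro!: nn_integral_cong nn_integral_cmult[symmetric])
    also have "\<dots> = (\<integral>\<^sup>+x. (\<integral>\<^sup>+y. (\<integral>\<^sup>+x'. k x y * h x * (k x' y * h x') \<partial>M) \<partial>M) \<partial>M)"
      by (rule Fubini') measurable
    also have "\<dots> = (\<integral>\<^sup>+x. (\<integral>\<^sup>+x'. (\<integral>\<^sup>+y. k x y * h x * (k x' y * h x') \<partial>M) \<partial>M) \<partial>M)"
      by (intro nn_integral_cong Fubini') measurable
    also have "\<dots> = (\<integral>\<^sup>+x. (\<integral>\<^sup>+x'. (h x * h x') * (\<integral>\<^sup>+y. k x y * k x' y \<partial>M) \<partial>M) \<partial>M)"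
      by (intro nn_integral_cong, subst nn_integral_cmult[symmetric]) (auto simp: mult_ac)
    also have "\<dots> \<le> (\<integral>\<^sup>+x. (\<integral>\<^sup>+x'. (h x * h x') * (ennreal C * (k x x' + k x' x)) \<partial>M) \<partial>M)"
      by (intro nn_integral_mono mult_left_mono TT) auto
    also have "\<dots> = (\<integral>\<^sup>+x. (\<integral>\<^sup>+x'. ennreal C * (h x * (k x x' * h x')) \<partial>M) \<partial>M) +
                     (\<integral>\<^sup>+x. (\<integral>\<^sup>+x'. ennreal C * (h x' * (k x' x * h x)) \<partial>M) \<partial>M)"
    proof -
      have "(\<integral>\<^sup>+x'. (h x * h x') * (ennreal C * (k x x' + k x' x)) \<partial>M) =
          (\<integral>\<^sup>+x'. ennreal C * (h x * (k x x' * h x')) \<partial>M) + (\<integral>\<^sup>+x'. ennreal C * (h x' * (k x' x * h x)) \<partial>M)"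
        if [measurable]: "x \<in> space M" for x
        by (subst nn_integral_add[symmetric]) (auto simp: algebra_simps)
      then show ?thesis
        by (subst nn_integral_add[symmetric]) (auto intro!: nn_integral_cong)
    qed
    also have "(\<integral>\<^sup>+x. (\<integral>\<^sup>+x'. ennreal C * (h x' * (k x' x * h x)) \<partial>M) \<partial>M) =
               (\<integral>\<^sup>+x. (\<integral>\<^sup>+x'. ennreal C * (h x * (k x x' * h x')) \<partial>M) \<partial>M)"
      by (rule Fubini') measurable
    also have "(\<integral>\<^sup>+x. (\<integral>\<^sup>+x'. ennreal C * (h x * (k x x' * h x')) \<partial>M) \<partial>M) =
               ennreal C * (\<integral>\<^sup>+x. h x * T h x \<partial>M)"
    proof -
      have "(\<integral>\<^sup>+x'. ennreal C * (h x * (k x x' * h x')) \<partial>M) = ennreal C * (h x * T h x)"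
        if [measurable]: "x \<in> space M" for x
        unfolding T_def by (simp add: nn_integral_cmult)
      then have "(\<integral>\<^sup>+x. (\<integral>\<^sup>+x'. ennreal C * (h x * (k x x' * h x')) \<partial>M) \<partial>M) =
          (\<integral>\<^sup>+x. ennreal C * (h x * T h x) \<partial>M)"
        by (intro nn_integral_cong) auto
      also have "\<dots> = ennreal C * (\<integral>\<^sup>+x. h x * T h x \<partial>M)"
        by (rule nn_integral_cmult) measurable
      finally show ?thesis .
    qed
    also have "ennreal C * (\<integral>\<^sup>+x. h x * T h x \<partial>M) + ennreal C * (\<integral>\<^sup>+x. h x * T h x \<partial>M) =
        ennreal (2 * C) * (\<integral>\<^sup>+x. h x * T h x \<partial>M)"
    proof -
      have "ennreal (2 * C) = ennreal C + ennreal C" using C by (simp flip: ennreal_plus)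
      then show ?thesis by (simp only: distrib_right)
    qed
    finally show ?thesis .
  qed
  \<comment> \<open>Admissible constants for the squared norm. Only functions with finite
    \<open>A h\<close> are tested, so that norms can be turned into reals, where cancellation is
    legitimate.\<close>
  define V where "V = {N. 0 \<le> N \<and> (\<forall>h\<in>borel_measurable M. A h < \<infinity> \<longrightarrow> A (T h) \<le> ennreal N * A h)}"
  have step: "2 * C * sqrt N \<in> V" if N: "N \<in> V" for N
    unfolding V_def
  proof (intro CollectI conjI ballI impI)
    show "0 \<le> 2 * C * sqrt N" using C N by (auto simp: V_def)
    fix h assume h [measurable]: "h \<in> borel_measurable M" and fin: "A h < \<infinity>"
    have N0: "0 \<le> N" using N by (simp add: V_def)
    have Th: "A (T h) \<le> ennreal N * A h" using N h fin by (simp add: V_def)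
    also have "\<dots> < \<infinity>" using fin by (simp add: ennreal_mult_less_top)
    finally have Tfin: "A (T h) < \<infinity>" .
    have TTh: "A (T (T h)) \<le> ennreal N * A (T h)" using N Tm[OF h] Tfin by (simp add: V_def)
    obtain a where a: "0 \<le> a" "A h = ennreal a" using fin by (cases "A h") auto
    obtain b where b: "0 \<le> b" "A (T h) = ennreal b" using Tfin by (cases "A (T h)") auto
    \<comment> \<open>\<open>dual\<close> is squared because Cauchy-Schwarz bounds the square of the
      inner product of \<open>T h\<close> and \<open>T (T h)\<close>. In real terms the chain says
      \<open>b^4 \<le> a^2 * (2 * C)^2 * N * b^2\<close>.\<close>
    have "((A (T h))\<^sup>2)\<^sup>2 \<le> (A h * A (T' (T h)))\<^sup>2"
      by (intro power_mono dual h) auto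
    also have "\<dots> \<le> (A h * (ennreal (2 * C) * (\<integral>\<^sup>+x. T h x * T (T h) x \<partial>M)))\<^sup>2"
      by (intro power_mono mult_left_mono pos) auto
    also have "\<dots> = (A h * ennreal (2 * C))\<^sup>2 * (\<integral>\<^sup>+x. T h x * T (T h) x \<partial>M)\<^sup>2"
      by (simp add: power_mult_distrib mult_ac)
    also have "\<dots> \<le> (A h * ennreal (2 * C))\<^sup>2 * (A (T h) * A (T (T h)))"
      unfolding A_def[of "T h"] A_def[of "T (T h)"] by (intro mult_left_mono Cauchy_Schwarz_nn_integral) auto
    also have "\<dots> \<le> (A h * ennreal (2 * C))\<^sup>2 * (A (T h) * (ennreal N * A (T h)))"
      using TTh by (intro mult_left_mono) auto
    finally have "ennreal ((b\<^sup>2)\<^sup>2) \<le> ennreal ((a * (2 * C))\<^sup>2 * (b * (N * b)))"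
      using a b C N0 by (simp add: ennreal_power ennreal_mult[symmetric])
    then have "(b\<^sup>2)\<^sup>2 \<le> (a * (2 * C))\<^sup>2 * (b * (N * b))"
      using a b C N0 by (subst (asm) ennreal_le_iff) auto
    then have *: "b\<^sup>2 * b\<^sup>2 \<le> (2 * C * sqrt N * a)\<^sup>2 * b\<^sup>2"
    proof -
      have sq: "(2 * C * sqrt N * a)\<^sup>2 = (a * (2 * C))\<^sup>2 * N"
        using N0 by (simp add: power_mult_distrib)
      show ?thesis using \<open>(b\<^sup>2)\<^sup>2 \<le> _\<close> unfolding sq by (simp add: power2_eq_square mult_ac)
    qed
    have "b \<le> 2 * C * sqrt N * a"
    proof (cases "b = 0")
      case True
      then show ?thesis using a C N0 by simp
    next
      case False
      then have "b\<^sup>2 \<le> (2 * C * sqrt N * a)\<^sup>2"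
        by (intro mult_right_le_imp_le[OF *]) auto
      then show ?thesis using a C N0 by (intro power2_le_imp_le[of b]) auto
    qed
    then have "ennreal b \<le> ennreal (2 * C * sqrt N * a)" by (rule ennreal_leI)
    then show "A (T h) \<le> ennreal (2 * C * sqrt N) * A h"
      using a b C N0 by (simp add: ennreal_mult)
  qed
  have V_ne: "V \<noteq> {}"
    using crude by (auto simp: V_def intro!: exI[of _ "B\<^sup>2 * (measure M (space M))\<^sup>2"])
  have V_bdd: "bdd_below V" by (auto simp: V_def bdd_below_def)
  define N where "N = Inf V"
  have N0: "0 \<le> N" unfolding N_def by (rule cInf_greatest[OF V_ne]) (simp add: V_def)
  \<comment> \<open>The infimum is itself admissible, because the inequality is closed in the
    constant; only then can \<open>step\<close> be applied to it.\<close>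
  have NV: "N \<in> V" unfolding V_def
  proof (intro CollectI conjI ballI impI N0)
    fix h assume h: "h \<in> borel_measurable M" and fin: "A h < \<infinity>"
    obtain a where a: "0 \<le> a" "A h = ennreal a" using fin by (cases "A h") auto
    obtain N1 where N1: "N1 \<in> V" using V_ne by blast
    then have "A (T h) \<le> ennreal N1 * A h" using h fin by (simp add: V_def)
    also have "\<dots> < \<infinity>" using fin by (simp add: ennreal_mult_less_top)
    finally obtain b where b: "0 \<le> b" "A (T h) = ennreal b" by (cases "A (T h)") auto
    have le: "b \<le> n * a" if n: "n \<in> V" for n
    proof -
      have "0 \<le> n" using n by (simp add: V_def)
      have "A (T h) \<le> ennreal n * A h" using n h fin by (simp add: V_def)
      then have "ennreal b \<le> ennreal (n * a)" using a b \<open>0 \<le> n\<close> by (simp add: ennreal_mult)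
      then show ?thesis using a \<open>0 \<le> n\<close> by (subst (asm) ennreal_le_iff) auto
    qed
    have "b \<le> N * a"
    proof (cases "a = 0")
      case True
      then show ?thesis using le[OF N1] by simp
    next
      case False
      then have "b / a \<le> N" unfolding N_def using le a
        by (intro cInf_greatest[OF V_ne]) (auto simp: field_simps)
      then show ?thesis using False a by (simp add: field_simps)
    qed
    then have "ennreal b \<le> ennreal (N * a)" by (rule ennreal_leI)
    then show "A (T h) \<le> ennreal N * A h" using a b N0 by (simp add: ennreal_mult)
  qed
  \<comment> \<open>Minimality of \<open>N\<close> against its own improvement, which forces
    \<open>sqrt N \<le> 2 * C\<close>.\<close>
  have "N \<le> 2 * C * sqrt N" unfolding N_def by (rule cInf_lower[OF step[OF NV, unfolded N_def] V_bdd])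
  then have "sqrt N * sqrt N \<le> (2 * C) * sqrt N" using N0 by (simp only: real_sqrt_mult_self abs_of_nonneg)
  then have "sqrt N \<le> 2 * C"
    using C N0 by (cases "N = 0") (auto intro: mult_right_le_imp_le[of "sqrt N" "sqrt N"])
  then have "(sqrt N)\<^sup>2 \<le> (2 * C)\<^sup>2" using N0 by (intro power_mono) auto
  then have "N \<le> 4 * C\<^sup>2" using N0 by (simp add: power_mult_distrib)
  then have "ennreal N * A g \<le> ennreal (4 * C\<^sup>2) * A g" by (intro mult_right_mono ennreal_leI) auto
  moreover have "A g < \<infinity>" using g_fin by (simp only: A_def)
  then have "A (T g) \<le> ennreal N * A g" using NV g by (simp add: V_def)
  ultimately show ?thesis unfolding A_def T_def by (rule order_trans[rotated])
qed

subsection \<open>Radial maximal functions\<close>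

text \<open>Based on \<open>lborel\<close>, so that measurability of the kernels on the product
  space can be read off from Borel measurability in both variables.\<close>

abbreviation circle_measure :: "real measure" where
  "circle_measure \<equiv> restrict_space lborel {0..2*pi}"

lemma nn_integral_circle_measure:
  assumes "\<And>t. t \<in> {0..2*pi} \<Longrightarrow> 0 \<le> f t" and "(f has_integral I) {0..2*pi}"
  shows "(\<integral>\<^sup>+t. ennreal (f t) \<partial>circle_measure) = ennreal I"
  using nn_integral_has_integral_lebesgue'[OF assms]
  by (simp add: nn_integral_restrict_space)

lemma finite_measure_circle_measure: "finite_measure circle_measure"
  by (rule finite_measureI) (simp add: emeasure_restrict_space space_restrict_space)

lemma poisson_kernel_measurable [measurable]:
  "case_prod poisson_kernel \<in> borel_measurable (borel \<Otimes>\<^sub>M borel)"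
proof -
  have [measurable]: "cis \<in> borel_measurable borel"
    by (intro borel_measurable_continuous_onI continuous_intros)
  show ?thesis unfolding poisson_kernel_def rcis_def by measurable
qed

text \<open>
  A radius depending measurably on the direction linearises the radial maximal function of the
  Poisson integral.
\<close>

lemma poisson_integral_maximal_L2:
  fixes \<rho> g F :: "real \<Rightarrow> real"
  assumes \<rho> [measurable]: "\<rho> \<in> borel_measurable borel" and \<rho>r: "\<And>\<theta>. 0 \<le> \<rho> \<theta> \<and> \<rho> \<theta> \<le> r" and r: "r < 1"
    and g: "continuous_on UNIV g" "\<And>t. 0 \<le> g t"
    and F: "\<And>\<theta>. \<theta> \<in> {0..2*pi} \<Longrightarrow> 0 \<le> F \<theta> \<and>
              2 * pi * F \<theta> \<le> integral {0..2*pi} (\<lambda>t. poisson_kernel (\<rho> \<theta>) (\<theta> - t) * g t)"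
  shows "(\<integral>\<^sup>+\<theta>. (ennreal (F \<theta>))\<^sup>2 \<partial>circle_measure) \<le> ennreal (256 * integral {0..2*pi} (\<lambda>t. (g t)\<^sup>2))"
proof -
  interpret finite_measure circle_measure by (rule finite_measure_circle_measure)
  define k where "k \<theta> t = ennreal (poisson_kernel (\<rho> \<theta>) (\<theta> - t) / (2 * pi))" for \<theta> t
  have [measurable]: "g \<in> borel_measurable borel"
    using g(1) by (rule borel_measurable_continuous_onI)
  have \<rho>1: "0 \<le> \<rho> \<theta>" "\<rho> \<theta> < 1" for \<theta> using \<rho>r[of \<theta>] r by auto
  have pos: "0 \<le> poisson_kernel (\<rho> \<theta>) \<tau>" for \<theta> \<tau>
    using \<rho>1 by (rule poisson_kernel_nonneg)
  have km: "case_prod k \<in> borel_measurable (circle_measure \<Otimes>\<^sub>M circle_measure)"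
  proof -
    have id: "(\<lambda>x. x) \<in> circle_measure \<rightarrow>\<^sub>M borel"
      by (rule measurable_restrict_space1) simp
    have 1: "fst \<in> circle_measure \<Otimes>\<^sub>M circle_measure \<rightarrow>\<^sub>M borel"
      by (rule measurable_compose[OF measurable_fst id])
    have 2: "snd \<in> circle_measure \<Otimes>\<^sub>M circle_measure \<rightarrow>\<^sub>M borel"
      by (rule measurable_compose[OF measurable_snd id])
    have "(\<lambda>(\<theta>, t). k \<theta> t) \<in> borel_measurable (borel \<Otimes>\<^sub>M borel)"
      unfolding k_def by measurable
    from measurable_compose[OF measurable_Pair[OF 1 2] this] show ?thesis by simp
  qed
  \<comment> \<open>Here the uniform gap between the radii and 1 is used. The bound blows up as
    \<open>r\<close> tends to 1, which is harmless because it does not reach the final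
    constant.\<close>
  have kB: "k \<theta> t \<le> ennreal (2 / (1 - r) / (2 * pi))" for \<theta> t
  proof -
    have "poisson_kernel (\<rho> \<theta>) (\<theta> - t) \<le> 2 / (1 - \<rho> \<theta>)" by (rule poisson_kernel_le[OF \<rho>1])
    also have "\<dots> \<le> 2 / (1 - r)" using \<rho>r[of \<theta>] r by (intro divide_left_mono) auto
    finally show ?thesis unfolding k_def by (intro ennreal_leI divide_right_mono) auto
  qed
  \<comment> \<open>The semigroup law evaluates the composed kernel exactly, and its
    \<open>2 * pi\<close> cancels one of the two factors \<open>1 / (2 * pi)\<close>. Comparing
    kernels then gives \<open>C = 8\<close>, hence \<open>256 = 4 * 8^2\<close> in the
    conclusion.\<close>
  have TT: "(\<integral>\<^sup>+y. k x y * k x' y \<partial>circle_measure) \<le> ennreal 8 * (k x x' + k x' x)" for x x'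
  proof -
    let ?a = "\<rho> x" and ?b = "\<rho> x'"
    have "k x y * k x' y = ennreal (poisson_kernel ?a (x - y) * poisson_kernel ?b (x' - y) * (1 / (4 * pi\<^sup>2)))" for y
      unfolding k_def by (subst ennreal_mult[symmetric]) (auto simp: pos power2_eq_square)
    moreover have "((\<lambda>y. poisson_kernel ?a (x - y) * poisson_kernel ?b (x' - y) * (1 / (4 * pi\<^sup>2))) has_integral
        2 * pi * poisson_kernel (?a * ?b) (x - x') * (1 / (4 * pi\<^sup>2))) {0..2*pi}"
      by (intro has_integral_mult_left poisson_kernel_semigroup \<rho>1)
    ultimately have "(\<integral>\<^sup>+y. k x y * k x' y \<partial>circle_measure) =
        ennreal (2 * pi * poisson_kernel (?a * ?b) (x - x') * (1 / (4 * pi\<^sup>2)))"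
      using nn_integral_circle_measure[of "\<lambda>y. poisson_kernel ?a (x - y) * poisson_kernel ?b (x' - y) * (1 / (4 * pi\<^sup>2))"]
      by (auto simp: pos)
    also have "2 * pi * poisson_kernel (?a * ?b) (x - x') * (1 / (4 * pi\<^sup>2)) = poisson_kernel (?a * ?b) (x - x') / (2 * pi)"
      by (simp add: power2_eq_square)
    also have "\<dots> \<le> 8 * (poisson_kernel ?a (x - x') + poisson_kernel ?b (x - x')) / (2 * pi)"
      by (intro divide_right_mono poisson_kernel_mult_le \<rho>1) auto
    also have "\<dots> = 8 * (poisson_kernel ?a (x - x') / (2 * pi) + poisson_kernel ?b (x' - x) / (2 * pi))"
      using poisson_kernel_minus[of ?b "x - x'"] by (simp add: add_divide_distrib)
    also have "ennreal \<dots> = ennreal 8 * (k x x' + k x' x)"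
      unfolding k_def by (subst ennreal_mult) (auto simp: pos ennreal_plus)
    finally show ?thesis by (simp add: ennreal_leI)
  qed
  have g2: "(\<integral>\<^sup>+t. (ennreal (g t))\<^sup>2 \<partial>circle_measure) = ennreal (integral {0..2*pi} (\<lambda>t. (g t)\<^sup>2))"
  proof -
    have "((\<lambda>t. (g t)\<^sup>2) has_integral integral {0..2*pi} (\<lambda>t. (g t)\<^sup>2)) {0..2*pi}"
      by (intro integrable_integral integrable_continuous_real continuous_intros continuous_on_subset[OF g(1)]) auto
    from nn_integral_circle_measure[OF _ this] show ?thesis using g(2) by (simp add: ennreal_power)
  qed
  have gm: "(\<lambda>t. ennreal (g t)) \<in> borel_measurable circle_measure"
    by (intro measurable_restrict_space1) measurable
  have "(\<integral>\<^sup>+\<theta>. (ennreal (F \<theta>))\<^sup>2 \<partial>circle_measure) \<le>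
      (\<integral>\<^sup>+\<theta>. (\<integral>\<^sup>+t. k \<theta> t * ennreal (g t) \<partial>circle_measure)\<^sup>2 \<partial>circle_measure)"
  proof (intro nn_integral_mono power_mono)
    fix \<theta> assume "\<theta> \<in> space circle_measure"
    then have \<theta>: "\<theta> \<in> {0..2*pi}" by (simp add: space_restrict_space)
    let ?h = "\<lambda>t. poisson_kernel (\<rho> \<theta>) (\<theta> - t) * g t"
    have "(?h has_integral integral {0..2*pi} ?h) {0..2*pi}"
      using \<rho>1 by (intro integrable_integral integrable_continuous_real continuous_intros continuous_on_subset[OF g(1)]) auto
    then have "((\<lambda>t. ?h t * (1 / (2 * pi))) has_integral integral {0..2*pi} ?h * (1 / (2 * pi))) {0..2*pi}"
      by (rule has_integral_mult_left)
    from nn_integral_circle_measure[OF _ this]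
    have "(\<integral>\<^sup>+t. ennreal (?h t * (1 / (2 * pi))) \<partial>circle_measure) = ennreal (integral {0..2*pi} ?h * (1 / (2 * pi)))"
      using pos g(2) by simp
    moreover have "ennreal (?h t * (1 / (2 * pi))) = k \<theta> t * ennreal (g t)" for t
      unfolding k_def by (subst ennreal_mult[symmetric]) (auto simp: pos g(2))
    ultimately have "(\<integral>\<^sup>+t. k \<theta> t * ennreal (g t) \<partial>circle_measure) = ennreal (integral {0..2*pi} ?h * (1 / (2 * pi)))"
      by simp
    moreover have "F \<theta> \<le> integral {0..2*pi} ?h * (1 / (2 * pi))"
      using F[OF \<theta>] by (simp add: field_simps)
    ultimately show "ennreal (F \<theta>) \<le> (\<integral>\<^sup>+t. k \<theta> t * ennreal (g t) \<partial>circle_measure)"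
      by (simp add: ennreal_leI)
  qed auto
  also have "\<dots> \<le> ennreal (4 * 8\<^sup>2) * (\<integral>\<^sup>+t. (ennreal (g t))\<^sup>2 \<partial>circle_measure)"
    by (rule kernel_operator_L2_bound[OF km kB _ TT gm]) (auto simp: g2)
  also have "\<dots> = ennreal (256 * integral {0..2*pi} (\<lambda>t. (g t)\<^sup>2))"
    unfolding g2 by (subst ennreal_mult[symmetric]) (auto intro!: integral_nonneg integrable_continuous_real
        continuous_intros continuous_on_subset[OF g(1)])
  finally show ?thesis .
qed

lemma measurable_argmax:
  fixes f :: "real \<Rightarrow> real \<Rightarrow> real"
  assumes "finite J" "J \<noteq> {}" and "\<And>j. j \<in> J \<Longrightarrow> f j \<in> borel_measurable borel"
  shows "\<exists>s\<in>borel_measurable borel. (\<forall>x. s x \<in> J) \<and> (\<lambda>x. f (s x) x) \<in> borel_measurable borel \<and>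
           (\<forall>x. \<forall>j\<in>J. f j x \<le> f (s x) x)"
  using assms
proof (induction J rule: finite_ne_induct)
  case (singleton j)
  then show ?case by (intro bexI[of _ "\<lambda>_. j"]) auto
next
  case (insert j J)
  from insert.IH insert.prems obtain s where [measurable]: "s \<in> borel_measurable borel" "(\<lambda>x. f (s x) x) \<in> borel_measurable borel"
    and s: "\<And>x. s x \<in> J" "\<And>x i. i \<in> J \<Longrightarrow> f i x \<le> f (s x) x" by auto
  have [measurable]: "f j \<in> borel_measurable borel" using insert.prems by simp
  define s' where "s' x = (if f (s x) x \<le> f j x then j else s x)" for x
  have [measurable]: "s' \<in> borel_measurable borel" unfolding s'_def by measurable
  have eq: "f (s' x) x = (if f (s x) x \<le> f j x then f j x else f (s x) x)" for x
    by (simp add: s'_def)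
  have "(\<lambda>x. f (s' x) x) \<in> borel_measurable borel" unfolding eq by measurable
  moreover have "s' x \<in> insert j J" for x using s(1) by (simp add: s'_def)
  moreover have "f i x \<le> f (s' x) x" if "i \<in> insert j J" for x i
    using that s(2)[of i x] by (auto simp: eq)
  ultimately show ?case by (intro bexI[of _ s']) auto
qed

lemma continuous_on_rcis [continuous_intros]:
  assumes "continuous_on S f" "continuous_on S g"
  shows "continuous_on S (\<lambda>x. rcis (f x) (g x))"
  unfolding rcis_def by (intro continuous_intros assms)

lemma continuous_on_compose_rcis:
  assumes "continuous_on (ball 0 1) G" "continuous_on S f" "continuous_on S g"
    and "\<And>x. x \<in> S \<Longrightarrow> \<bar>f x\<bar> < 1"
  shows "continuous_on S (\<lambda>x. G (rcis (f x) (g x)))"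
  using assms by (intro continuous_on_compose2[OF assms(1)] continuous_intros) auto

section \<open>Functions with bounded p-means: pointwise growth and the radial maximal
  function\<close>

context
  fixes G :: "complex \<Rightarrow> complex" and p A :: real
  assumes hol: "G holomorphic_on ball 0 1" and p: "0 < p"
    and A: "\<And>r. 0 \<le> r \<Longrightarrow> r < 1 \<Longrightarrow> integral {0..2*pi} (\<lambda>\<theta>. cmod (G (rcis r \<theta>)) powr p) \<le> A"
begin

lemma Hardy_constant_le:
  assumes "\<And>z. z \<in> ball 0 1 \<Longrightarrow> G z = c"
  shows "2 * pi * cmod c powr p \<le> A"
  using A[of 0] assms[of 0] by simp

lemma Hardy_constant_nonneg: "0 \<le> A"
  by (rule order_trans[OF _ A[of 0]]) simp_all

text \<open>The Poisson majorant on the circle of radius \<open>\<rho>\<close>, with the kernel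
  replaced by its maximum. Taking \<open>\<rho>\<close> beyond \<open>(1 + r) / 2\<close> gives
  \<open>1 - r / \<rho> \<ge> (1 - r) / 2\<close>, by \<open>4 * r \<le> (1 + r)^2\<close>, so the
  kernel is at most \<open>4 / (1 - r)\<close>; the 4 is absorbed by \<open>2 * pi\<close>. Constant
  \<open>G\<close> is separate because it may be identically zero, and then no zero-free circle
  exists.\<close>

lemma Hardy_pointwise_le:
  assumes r: "0 \<le> r" "r < 1"
  shows "cmod (G (rcis r \<theta>)) powr p \<le> A / (1 - r)"
proof (cases "G constant_on ball 0 1")
  case True
  then obtain c where c: "\<And>z. z \<in> ball 0 1 \<Longrightarrow> G z = c" unfolding constant_on_def by blast
  have "1 * cmod c powr p \<le> (2 * pi) * cmod c powr p"
    using pi_gt3 by (intro mult_right_mono) auto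
  also have "\<dots> \<le> A" by (rule Hardy_constant_le[OF c])
  also have "A \<le> A / (1 - r)"
    using r Hardy_constant_nonneg by (simp add: field_simps)
  finally show ?thesis using c[of "rcis r \<theta>"] r by simp
next
  case False
  obtain \<rho> R :: real where \<rho>: "(1 + r) / 2 < \<rho>" "\<rho> < 1" and R: "1 < R"
    and H: "(\<lambda>z. G (of_real \<rho> * z)) holomorphic_on ball 0 R"
      "\<And>z. z \<in> ball 0 R \<Longrightarrow> 1 \<le> cmod z \<Longrightarrow> G (of_real \<rho> * z) \<noteq> 0"
      "finite {z \<in> ball 0 R. G (of_real \<rho> * z) = 0}"
    by (rule dilation_zero_free_near_circle[OF hol False, of "(1 + r) / 2"])
       (use r in simp, use r in simp, rule that)
  define a where "a = r / \<rho>"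
  have "0 \<le> (1 + r) / 2" using r by simp
  then have \<rho>0: "0 < \<rho>" using \<rho> by linarith
  have a: "0 \<le> a" "a < 1" using \<rho> r \<rho>0 by (auto simp: a_def)
  have a2: "(1 - r) / 2 \<le> 1 - a"
  proof -
    have "a \<le> r / ((1 + r) / 2)" unfolding a_def using \<rho> r \<rho>0 by (intro divide_left_mono) auto
    moreover have "r / ((1 + r) / 2) \<le> (1 + r) / 2"
    proof -
      have "0 \<le> (1 - r)\<^sup>2" by simp
      then have "r * 4 \<le> (1 + r) * (1 + r)" by (simp add: power2_eq_square algebra_simps)
      then show ?thesis using r by (simp add: field_simps)
    qed
    ultimately have "a \<le> (1 + r) / 2" by (rule order_trans)
    then show ?thesis by (simp add: field_simps)
  qed
  have eq: "of_real \<rho> * rcis a \<theta> = rcis r \<theta>" for \<theta> using \<rho>0 by (simp add: a_def rcis_def)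
  have eq': "of_real \<rho> * cis t = rcis \<rho> t" for t by (simp add: rcis_def)
  have cG: "continuous_on {0..2*pi} (\<lambda>t. cmod (G (rcis \<rho> t)) powr p)"
    using \<rho> \<rho>0 p
    by (intro continuous_on_powr' continuous_intros
        continuous_on_compose_rcis[OF holomorphic_on_imp_continuous_on[OF hol]]) auto
  have cP: "continuous_on {0..2*pi} (\<lambda>t. poisson_kernel a (\<theta> - t))"
    using a by (intro continuous_intros) auto
  have "2 * pi * cmod (G (rcis r \<theta>)) powr p
      \<le> integral {0..2*pi} (\<lambda>t. poisson_kernel a (\<theta> - t) * cmod (G (rcis \<rho> t)) powr p)"
    using powr_le_poisson_integral[OF R H a p, of \<theta>] by (simp add: eq eq')
  also have "\<dots> \<le> integral {0..2*pi} (\<lambda>t. (4 / (1 - r)) * cmod (G (rcis \<rho> t)) powr p)"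
  proof (rule integral_le)
    fix t
    have "poisson_kernel a (\<theta> - t) \<le> 2 / (1 - a)" by (rule poisson_kernel_le[OF a])
    also have "\<dots> \<le> 2 / ((1 - r) / 2)" using a2 r a by (intro divide_left_mono) auto
    finally show "poisson_kernel a (\<theta> - t) * cmod (G (rcis \<rho> t)) powr p
        \<le> (4 / (1 - r)) * cmod (G (rcis \<rho> t)) powr p" by (intro mult_right_mono) auto
  qed (intro integrable_continuous_real continuous_intros cG cP)+
  also have "\<dots> = (4 / (1 - r)) * integral {0..2*pi} (\<lambda>t. cmod (G (rcis \<rho> t)) powr p)" by simp
  also have "\<dots> \<le> (4 / (1 - r)) * A"
    using A[of \<rho>] \<rho> \<rho>0 r by (intro mult_left_mono) auto
  also have "\<dots> \<le> (2 * pi / (1 - r)) * A"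
    using Hardy_constant_nonneg r pi_gt3 by (intro mult_right_mono divide_right_mono) auto
  finally have "(2 * pi) * cmod (G (rcis r \<theta>)) powr p \<le> (2 * pi) * (A / (1 - r))" by simp
  then show ?thesis by (rule mult_left_le_imp_le) simp
qed

text \<open>For \<open>s = p / 2\<close> the squared L^2 norm of \<open>|G|^s\<close> on the circle
  of radius \<open>\<sigma>\<close> is a p-mean of \<open>G\<close>, so \<open>A\<close> bounds it
  wherever \<open>\<sigma>\<close> lies. This makes the constant free of \<open>r\<close> and of the
  chosen radii.\<close>

lemma Hardy_radial_maximal:
  assumes \<rho> [measurable]: "\<rho> \<in> borel_measurable borel" and \<rho>r: "\<And>\<theta>. 0 \<le> \<rho> \<theta> \<and> \<rho> \<theta> \<le> r" and r: "r < 1"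
  shows "(\<integral>\<^sup>+\<theta>. ennreal (cmod (G (rcis (\<rho> \<theta>) \<theta>)) powr p) \<partial>circle_measure) \<le> ennreal (256 * A)"
proof (cases "G constant_on ball 0 1")
  case True
  then obtain c where c: "\<And>z. z \<in> ball 0 1 \<Longrightarrow> G z = c" unfolding constant_on_def by blast
  have "G (rcis (\<rho> \<theta>) \<theta>) = c" for \<theta> using \<rho>r[of \<theta>] r by (intro c) simp
  then have "(\<integral>\<^sup>+\<theta>. ennreal (cmod (G (rcis (\<rho> \<theta>) \<theta>)) powr p) \<partial>circle_measure)
      = ennreal (2 * pi * cmod c powr p)"
    by (simp add: emeasure_restrict_space space_restrict_space ennreal_mult mult.commute)
  also have "\<dots> \<le> ennreal (256 * A)"
    using Hardy_constant_le[OF c] Hardy_constant_nonneg by (intro ennreal_leI) linarith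
  finally show ?thesis .
next
  case False
  \<comment> \<open>The zero-free circle is sought above a strictly positive radius, while
    \<open>r\<close> may be 0.\<close>
  define r' where "r' = max r (1/2)"
  have r': "0 < r'" "r' < 1" "r \<le> r'" using r by (auto simp: r'_def)
  obtain \<sigma> R :: real where \<sigma>: "r' < \<sigma>" "\<sigma> < 1" and R: "1 < R"
    and H: "(\<lambda>z. G (of_real \<sigma> * z)) holomorphic_on ball 0 R"
      "\<And>z. z \<in> ball 0 R \<Longrightarrow> 1 \<le> cmod z \<Longrightarrow> G (of_real \<sigma> * z) \<noteq> 0"
      "finite {z \<in> ball 0 R. G (of_real \<sigma> * z) = 0}"
    by (rule dilation_zero_free_near_circle[OF hol False r'(1,2)]) (rule that)
  have \<sigma>0: "0 < \<sigma>" using \<sigma> r' by linarith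
  define s where "s = p / 2"
  have s: "0 < s" "s * 2 = p" using p by (auto simp: s_def)
  define g where "g t = cmod (G (rcis \<sigma> t)) powr s" for t
  define F where "F \<theta> = cmod (G (rcis (\<rho> \<theta>) \<theta>)) powr s" for \<theta>
  have sq: "x powr p = (x powr s)\<^sup>2" if "0 \<le> x" for x :: real
  proof -
    have "(x powr s)\<^sup>2 = x powr (s + s)" by (simp only: powr_add power2_eq_square)
    also have "s + s = p" using s by simp
    finally show ?thesis ..
  qed
  have "(\<integral>\<^sup>+\<theta>. (ennreal (F \<theta>))\<^sup>2 \<partial>circle_measure) \<le> ennreal (256 * integral {0..2*pi} (\<lambda>t. (g t)\<^sup>2))"
  proof (rule poisson_integral_maximal_L2)
    show "(\<lambda>\<theta>. \<rho> \<theta> / \<sigma>) \<in> borel_measurable borel" by measurable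
    show "0 \<le> \<rho> \<theta> / \<sigma> \<and> \<rho> \<theta> / \<sigma> \<le> r' / \<sigma>" for \<theta>
      using \<rho>r[of \<theta>] r' \<sigma>0 by (auto intro!: divide_right_mono)
    show "r' / \<sigma> < 1" using \<sigma> \<sigma>0 by simp
    show "continuous_on UNIV g" unfolding g_def using \<sigma> \<sigma>0 s
      by (intro continuous_on_powr' continuous_intros
        continuous_on_compose_rcis[OF holomorphic_on_imp_continuous_on[OF hol]]) auto
    show "0 \<le> g t" for t by (simp add: g_def)
    fix \<theta> :: real
    have a: "0 \<le> \<rho> \<theta> / \<sigma>" "\<rho> \<theta> / \<sigma> < 1" using \<rho>r[of \<theta>] r' \<sigma> \<sigma>0 by auto
    have eq: "of_real \<sigma> * rcis (\<rho> \<theta> / \<sigma>) \<theta> = rcis (\<rho> \<theta>) \<theta>" using \<sigma>0 by (simp add: rcis_def)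
    have eq': "of_real \<sigma> * cis t = rcis \<sigma> t" for t by (simp add: rcis_def)
    show "0 \<le> F \<theta> \<and> 2 * pi * F \<theta> \<le>
        integral {0..2*pi} (\<lambda>t. poisson_kernel (\<rho> \<theta> / \<sigma>) (\<theta> - t) * g t)"
      using powr_le_poisson_integral[OF R H a s(1), of \<theta>]
      unfolding eq eq' by (simp add: F_def g_def)
  qed
  also have "integral {0..2*pi} (\<lambda>t. (g t)\<^sup>2) \<le> A"
    using A[of \<sigma>] \<sigma> \<sigma>0 by (simp add: g_def sq)
  finally show ?thesis unfolding F_def by (simp add: sq ennreal_power ennreal_leI)
qed

end

subsection \<open>The Hardy-Littlewood theorem on radial integrals\<close>

lemma continuous_on_radial_integral:
  assumes G: "continuous_on (ball 0 1) G" and r: "0 \<le> r" "r < 1"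
  shows "continuous_on S (\<lambda>\<theta>. integral {0..r} (\<lambda>x. cmod (G (rcis x \<theta>))))"
proof -
  have "continuous_on (S \<times> cbox 0 r) (\<lambda>(\<theta>, x). cmod (G (rcis x \<theta>)))"
    unfolding case_prod_beta
    using r by (intro continuous_intros continuous_on_compose_rcis[OF G]) auto
  from integral_continuous_on_param[OF this] show ?thesis by simp
qed

text \<open>A finite net of radii, fine enough for uniform continuity, provides the near-maximal radius.\<close>

lemma near_maximal_radius:
  assumes G: "continuous_on (ball 0 1) G" and r: "0 \<le> r" "r < 1"
  obtains \<rho> where "\<rho> \<in> borel_measurable borel" "(\<lambda>\<theta>. cmod (G (rcis (\<rho> \<theta>) \<theta>))) \<in> borel_measurable borel"
    "\<And>\<theta>. 0 \<le> \<rho> \<theta> \<and> \<rho> \<theta> \<le> r"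
    "\<And>x \<theta>. \<theta> \<in> {0..2*pi} \<Longrightarrow> x \<in> {0..r} \<Longrightarrow> cmod (G (rcis x \<theta>)) \<le> 1 + cmod (G (rcis (\<rho> \<theta>) \<theta>))"
proof -
  define f where "f x \<theta> = cmod (G (rcis x \<theta>))" for x \<theta>
  define K where "K = {0..r} \<times> {0..2*pi}"
  have "continuous_on K (\<lambda>(x, \<theta>). f x \<theta>)"
    unfolding case_prod_beta f_def K_def
    using r by (intro continuous_intros continuous_on_compose_rcis[OF G]) auto
  moreover have "compact K" unfolding K_def by (intro compact_Times compact_Icc)
  ultimately have "uniformly_continuous_on K (\<lambda>(x, \<theta>). f x \<theta>)" by (rule compact_uniformly_continuous)
  \<comment> \<open>Tolerance 1 is enough: the additive 1 is later kept as part of the maximum and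
    secures \<open>1 \<le> S\<close> in the estimate of the radial integral.\<close>
  then have "\<exists>d>0. \<forall>u\<in>K. \<forall>v\<in>K. dist v u < d \<longrightarrow>
      dist (case v of (x, \<theta>) \<Rightarrow> f x \<theta>) (case u of (x, \<theta>) \<Rightarrow> f x \<theta>) < 1"
    unfolding uniformly_continuous_on_def by (elim allE impE) (rule zero_less_one)
  then obtain d where d: "0 < d" "\<forall>u\<in>K. \<forall>v\<in>K. dist v u < d \<longrightarrow>
      dist (case v of (x, \<theta>) \<Rightarrow> f x \<theta>) (case u of (x, \<theta>) \<Rightarrow> f x \<theta>) < 1"
    by blast
  obtain J where J: "finite J" "J \<subseteq> {0..r}" "{0..r} \<subseteq> (\<Union>j\<in>J. ball j d)"
    using seq_compact_imp_totally_bounded[OF compact_imp_seq_compact[OF compact_Icc], rule_format, OF d(1), of 0 r]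
    by blast
  have "J \<noteq> {}" using J(3) r(1) by auto
  have fm: "f j \<in> borel_measurable borel" if "j \<in> J" for j
    unfolding f_def using that J(2) r
    by (intro borel_measurable_continuous_onI continuous_intros continuous_on_compose_rcis[OF G]) auto
  have "\<exists>s\<in>borel_measurable borel. (\<forall>x. s x \<in> J) \<and> (\<lambda>x. f (s x) x) \<in> borel_measurable borel \<and>
      (\<forall>x. \<forall>j\<in>J. f j x \<le> f (s x) x)"
    by (rule measurable_argmax[OF J(1) \<open>J \<noteq> {}\<close>]) (rule fm)
  then obtain \<rho> where \<rho>: "\<rho> \<in> borel_measurable borel" "\<And>\<theta>. \<rho> \<theta> \<in> J" "(\<lambda>\<theta>. f (\<rho> \<theta>) \<theta>) \<in> borel_measurable borel"
    "\<And>\<theta> j. j \<in> J \<Longrightarrow> f j \<theta> \<le> f (\<rho> \<theta>) \<theta>" by auto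
  show thesis
  proof (rule that[OF \<rho>(1)])
    show "(\<lambda>\<theta>. cmod (G (rcis (\<rho> \<theta>) \<theta>))) \<in> borel_measurable borel" using \<rho>(3) by (simp add: f_def)
    show "0 \<le> \<rho> \<theta> \<and> \<rho> \<theta> \<le> r" for \<theta> using \<rho>(2)[of \<theta>] J(2) by auto
    fix x \<theta> :: real assume \<theta>: "\<theta> \<in> {0..2*pi}" and x: "x \<in> {0..r}"
    then obtain j where j: "j \<in> J" "dist j x < d" using J(3) by auto
    have "(x, \<theta>) \<in> K" "(j, \<theta>) \<in> K" using x \<theta> j(1) J(2) by (auto simp: K_def)
    moreover have "dist (x, \<theta>) (j, \<theta>) < d" using j(2) by (simp add: dist_Pair_Pair dist_commute)
    ultimately have "dist (f x \<theta>) (f j \<theta>) < 1" using d(2)[rule_format, of "(j, \<theta>)" "(x, \<theta>)"] by simp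
    then have "f x \<theta> \<le> 1 + f j \<theta>" by (simp add: dist_real_def)
    with \<rho>(4)[OF j(1), of \<theta>] show "cmod (G (rcis x \<theta>)) \<le> 1 + cmod (G (rcis (\<rho> \<theta>) \<theta>))" by (simp add: f_def)
  qed
qed

text \<open>The shift by \<open>\<delta>\<close> keeps the antiderivative below its finite value at
  \<open>x = 1\<close>, so the bound is independent of \<open>r\<close>.\<close>

lemma integral_powr_le:
  fixes b \<delta> r :: real
  assumes b: "1 < b" and \<delta>: "0 < \<delta>" and r: "0 \<le> r" "r < 1"
  shows "integral {0..r} (\<lambda>x. (1 - x + \<delta>) powr (- b)) \<le> \<delta> powr (1 - b) / (b - 1)"
proof -
  have "((\<lambda>x. (1 - x + \<delta>) powr (- b)) has_integral
      (1 - r + \<delta>) powr (1 - b) / (b - 1) - (1 - 0 + \<delta>) powr (1 - b) / (b - 1)) {0..r}"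
  proof (rule fundamental_theorem_of_calculus)
    fix x assume x: "x \<in> {0..r}"
    then have "0 < 1 - x + \<delta>" using r \<delta> by auto
    then have "((\<lambda>z. z powr (1 - b)) has_real_derivative (1 - b) * (1 - x + \<delta>) powr (1 - b - 1)) (at (1 - x + \<delta>))"
      by (rule has_real_derivative_powr)
    moreover have "((\<lambda>x. 1 - x + \<delta>) has_real_derivative - 1) (at x within {0..r})"
      by (auto intro!: derivative_eq_intros)
    ultimately have "((\<lambda>x. (1 - x + \<delta>) powr (1 - b) / (b - 1)) has_real_derivative
        (1 - b) * (1 - x + \<delta>) powr (1 - b - 1) * - 1 / (b - 1)) (at x within {0..r})"
      by (intro DERIV_cdivide[OF DERIV_chain2])
    moreover have "(1 - b) * (1 - x + \<delta>) powr (1 - b - 1) * - 1 / (b - 1) = (1 - x + \<delta>) powr (- b)"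
      using b by (simp add: field_simps)
    ultimately have "((\<lambda>x. (1 - x + \<delta>) powr (1 - b) / (b - 1)) has_real_derivative (1 - x + \<delta>) powr (- b))
        (at x within {0..r})" by (simp only:)
    then show "((\<lambda>x. (1 - x + \<delta>) powr (1 - b) / (b - 1)) has_vector_derivative (1 - x + \<delta>) powr (- b))
        (at x within {0..r})"
      by (simp add: has_real_derivative_iff_has_vector_derivative)
  qed (use r in auto)
  then have "integral {0..r} (\<lambda>x. (1 - x + \<delta>) powr (- b)) =
      (1 - r + \<delta>) powr (1 - b) / (b - 1) - (1 - 0 + \<delta>) powr (1 - b) / (b - 1)"
    by (rule integral_unique)
  also have "\<dots> \<le> (1 - r + \<delta>) powr (1 - b) / (b - 1)" using b by simp
  also have "\<dots> \<le> \<delta> powr (1 - b) / (b - 1)"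
    using b r \<delta> by (intro divide_right_mono powr_mono2') auto
  finally show ?thesis .
qed

text \<open>
  The radial integral is split, in effect, at distance \<open>\<delta> = S\<^sup>-\<^sup>p\<close> from the circle, where \<open>S\<close> is the
  radial maximum: the pointwise bound of order \<open>(1 - x)\<^sup>-\<^sup>1\<^sup>/\<^sup>p\<close> is used outside and \<open>S\<close> itself inside.
\<close>

lemma radial_integral_le_maximal:
  fixes h :: "real \<Rightarrow> real"
  assumes p: "0 < p" "p < 1" and A: "0 \<le> A" and r: "0 \<le> r" "r < 1" and S: "1 \<le> S"
    and h: "continuous_on {0..r} h" "\<And>x. x \<in> {0..r} \<Longrightarrow> 0 \<le> h x"
    and hS: "\<And>x. x \<in> {0..r} \<Longrightarrow> h x \<le> S"
    and hA: "\<And>x. x \<in> {0..r} \<Longrightarrow> h x powr p \<le> A / (1 - x)"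
  shows "integral {0..r} h \<le> max 1 (A powr (1/p)) * 2 powr (1/p) * (p / (1 - p)) * S powr (1 - p)"
proof -
  define b where "b = 1 / p"
  have b: "1 < b" "p * b = 1" "1 / (b - 1) = p / (1 - p)" using p by (auto simp: b_def field_simps)
  define a where "a = max 1 (A powr b)"
  define \<delta> where "\<delta> = S powr (- p)"
  have \<delta>: "0 < \<delta>" using S by (simp add: \<delta>_def)
  have S\<delta>: "S = \<delta> powr (- b)"
    using S b by (simp add: \<delta>_def powr_powr)
  \<comment> \<open>Instead of cutting the interval at \<open>1 - x = \<delta>\<close>, one majorant
    covers both regimes: the larger of \<open>1 - x\<close> and \<open>\<delta>\<close> is at least
    half their sum. As \<open>a\<close> is at least 1 and at least \<open>A powr b\<close>, it
    serves both.\<close>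
  have le: "h x \<le> a * 2 powr b * (1 - x + \<delta>) powr (- b)" if x: "x \<in> {0..r}" for x
  proof -
    have x1: "0 < 1 - x" using x r by auto
    have half: "((1 - x + \<delta>) / 2) powr (- b) = 2 powr b * (1 - x + \<delta>) powr (- b)"
      using x1 \<delta> by (simp add: powr_divide powr_minus divide_simps)
    show ?thesis
    proof (cases "\<delta> \<le> 1 - x")
      case True
      have "h x = (h x powr p) powr b" using h(2)[OF x] b by (simp add: powr_powr)
      also have "\<dots> \<le> (A / (1 - x)) powr b" using b by (intro powr_mono2 hA[OF x]) auto
      also have "\<dots> = A powr b * (1 - x) powr (- b)"
        using A x1 by (simp add: powr_divide powr_minus divide_simps)
      also have "\<dots> \<le> a * ((1 - x + \<delta>) / 2) powr (- b)"
        using True b \<delta> x1 by (intro mult_mono powr_mono2') (auto simp: a_def)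
      finally show ?thesis unfolding half by (simp add: mult_ac)
    next
      case False
      have "h x \<le> 1 * \<delta> powr (- b)" using hS[OF x] S\<delta> by simp
      also have "\<dots> \<le> a * ((1 - x + \<delta>) / 2) powr (- b)"
        using False b \<delta> x1 by (intro mult_mono powr_mono2') (auto simp: a_def)
      finally show ?thesis unfolding half by (simp add: mult_ac)
    qed
  qed
  have c: "continuous_on {0..r} (\<lambda>x. (1 - x + \<delta>) powr (- b))"
    using r \<delta> by (intro continuous_on_powr continuous_intros) auto
  have "integral {0..r} h \<le> integral {0..r} (\<lambda>x. a * 2 powr b * (1 - x + \<delta>) powr (- b))"
    using le by (intro integral_le integrable_continuous_real continuous_intros c h) auto
  also have "\<dots> = a * 2 powr b * integral {0..r} (\<lambda>x. (1 - x + \<delta>) powr (- b))" by simp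
  also have "\<dots> \<le> a * 2 powr b * (\<delta> powr (1 - b) / (b - 1))"
    by (intro mult_left_mono integral_powr_le b(1) \<delta> r) (auto simp: a_def)
  also have "\<delta> powr (1 - b) = S powr (1 - p)"
  proof -
    have "(- p) * (1 - b) = 1 - p" using b(2) by (simp add: algebra_simps)
    then show ?thesis unfolding \<delta>_def by (simp only: powr_powr)
  qed
  also have "a * 2 powr b * (S powr (1 - p) / (b - 1)) = a * 2 powr b * (1 / (b - 1)) * S powr (1 - p)" by simp
  finally have "integral {0..r} h \<le> a * 2 powr b * (p / (1 - p)) * S powr (1 - p)" unfolding b(3) .
  then show ?thesis unfolding a_def b_def .
qed

text \<open>Because \<open>(1 - p) * q = p\<close>, the q-th power of a bound of order
  \<open>S powr (1 - p)\<close> is of order \<open>S powr p\<close>, where \<open>S\<close> is one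
  plus the value of \<open>|G|\<close> at a near-maximal radius. The maximal estimate integrates
  this with constants that do not depend on \<open>r\<close>.\<close>

theorem Hardy_Littlewood_radial_integral:
  fixes G :: "complex \<Rightarrow> complex" and p A :: real
  assumes hol: "G holomorphic_on ball 0 1" and p: "0 < p" "p < 1"
    and A: "\<And>r. 0 \<le> r \<Longrightarrow> r < 1 \<Longrightarrow> integral {0..2*pi} (\<lambda>\<theta>. cmod (G (rcis r \<theta>)) powr p) \<le> A"
  obtains B where "\<And>r. 0 \<le> r \<Longrightarrow> r < 1 \<Longrightarrow>
    integral {0..2*pi} (\<lambda>\<theta>. (integral {0..r} (\<lambda>x. cmod (G (rcis x \<theta>)))) powr (p / (1 - p))) \<le> B"
proof -
  define q where "q = p / (1 - p)"
  have q: "0 < q" "(1 - p) * q = p" using p by (auto simp: q_def)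
  define C where "C = max 1 (A powr (1/p)) * 2 powr (1/p) * (p / (1 - p))"
  have C: "0 \<le> C" using p by (simp add: C_def)
  have A0: "0 \<le> A" by (rule Hardy_constant_nonneg[OF hol p(1) A])
  have cont: "continuous_on (ball 0 1) G" using hol by (rule holomorphic_on_imp_continuous_on)
  show thesis
  proof (rule that)
    fix r :: real assume r: "0 \<le> r" "r < 1"
    obtain \<rho> where \<rho>: "\<rho> \<in> borel_measurable borel" "(\<lambda>\<theta>. cmod (G (rcis (\<rho> \<theta>) \<theta>))) \<in> borel_measurable borel"
      "\<And>\<theta>. 0 \<le> \<rho> \<theta> \<and> \<rho> \<theta> \<le> r"
      "\<And>x \<theta>. \<theta> \<in> {0..2*pi} \<Longrightarrow> x \<in> {0..r} \<Longrightarrow> cmod (G (rcis x \<theta>)) \<le> 1 + cmod (G (rcis (\<rho> \<theta>) \<theta>))"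
      by (rule near_maximal_radius[OF cont r]) (rule that)
    define \<Phi> where "\<Phi> \<theta> = integral {0..r} (\<lambda>x. cmod (G (rcis x \<theta>)))" for \<theta>
    define y where "y \<theta> = cmod (G (rcis (\<rho> \<theta>) \<theta>))" for \<theta>
    have \<Phi>0: "0 \<le> \<Phi> \<theta>" for \<theta>
      unfolding \<Phi>_def using r
      by (intro integral_nonneg integrable_continuous_real continuous_intros continuous_on_compose_rcis[OF cont]) auto
    have le: "\<Phi> \<theta> powr q \<le> C powr q * 2 powr p * (1 + y \<theta> powr p)" if \<theta>: "\<theta> \<in> {0..2*pi}" for \<theta>
    proof -
      have y0: "0 \<le> y \<theta>" by (simp add: y_def)
      have "\<Phi> \<theta> \<le> C * (1 + y \<theta>) powr (1 - p)"
        unfolding \<Phi>_def C_def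
      proof (rule radial_integral_le_maximal[OF p A0 r])
        show "continuous_on {0..r} (\<lambda>x. cmod (G (rcis x \<theta>)))"
          using r by (intro continuous_intros continuous_on_compose_rcis[OF cont]) auto
        show "cmod (G (rcis x \<theta>)) \<le> 1 + y \<theta>" if "x \<in> {0..r}" for x
          unfolding y_def by (rule \<rho>(4)[OF \<theta> that])
        show "cmod (G (rcis x \<theta>)) powr p \<le> A / (1 - x)" if "x \<in> {0..r}" for x
          using that r by (intro Hardy_pointwise_le[OF hol p(1) A]) auto
      qed (use y0 in auto)
      then have "\<Phi> \<theta> powr q \<le> (C * (1 + y \<theta>) powr (1 - p)) powr q"
        using \<Phi>0 q by (intro powr_mono2) auto
      also have "\<dots> = C powr q * (1 + y \<theta>) powr p"
        using C y0 q(2) by (simp add: powr_mult powr_powr)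
      also have "\<dots> \<le> C powr q * (2 powr p * (1 + y \<theta> powr p))"
      proof (rule mult_left_mono)
        have "(1 + y \<theta>) powr p \<le> (2 * max 1 (y \<theta>)) powr p"
          using y0 p by (intro powr_mono2) auto
        also have "\<dots> = 2 powr p * (max 1 (y \<theta>)) powr p" by (simp add: powr_mult)
        also have "\<dots> \<le> 2 powr p * (1 + y \<theta> powr p)" by (intro mult_left_mono) (auto simp: max_def)
        finally show "(1 + y \<theta>) powr p \<le> 2 powr p * (1 + y \<theta> powr p)" .
      qed simp
      finally show ?thesis by (simp add: mult_ac)
    qed
    have \<Phi>c: "continuous_on {0..2*pi} (\<lambda>\<theta>. \<Phi> \<theta> powr q)"
      using \<Phi>0 q unfolding \<Phi>_def
      by (intro continuous_on_powr' continuous_intros continuous_on_radial_integral[OF cont r]) auto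
    have ym [measurable]: "(\<lambda>\<theta>. y \<theta> powr p) \<in> borel_measurable circle_measure"
    proof (rule measurable_restrict_space1)
      have [measurable]: "y \<in> borel_measurable borel" using \<rho>(2) unfolding y_def by simp
      show "(\<lambda>\<theta>. y \<theta> powr p) \<in> borel_measurable lborel" by measurable
    qed
    \<comment> \<open>The near-maximal value is known to be measurable only, so the estimate runs
      through nonnegative integrals and returns to reals at the end.\<close>
    have "ennreal (integral {0..2*pi} (\<lambda>\<theta>. \<Phi> \<theta> powr q)) = (\<integral>\<^sup>+\<theta>. ennreal (\<Phi> \<theta> powr q) \<partial>circle_measure)"
      by (intro nn_integral_circle_measure[symmetric] integrable_integral integrable_continuous_real \<Phi>c) auto
    also have "\<dots> \<le> (\<integral>\<^sup>+\<theta>. ennreal (C powr q * 2 powr p) * (1 + ennreal (y \<theta> powr p)) \<partial>circle_measure)"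
    proof (rule nn_integral_mono)
      fix \<theta> assume "\<theta> \<in> space circle_measure"
      then have "ennreal (\<Phi> \<theta> powr q) \<le> ennreal (C powr q * 2 powr p * (1 + y \<theta> powr p))"
        by (intro ennreal_leI le) (simp add: space_restrict_space)
      also have "\<dots> = ennreal (C powr q * 2 powr p) * (1 + ennreal (y \<theta> powr p))"
        by (subst ennreal_mult) auto
      finally show "ennreal (\<Phi> \<theta> powr q) \<le> ennreal (C powr q * 2 powr p) * (1 + ennreal (y \<theta> powr p))" .
    qed
    also have "\<dots> = ennreal (C powr q * 2 powr p) * (ennreal (2 * pi) + (\<integral>\<^sup>+\<theta>. ennreal (y \<theta> powr p) \<partial>circle_measure))"
      by (subst nn_integral_cmult, measurable, subst nn_integral_add)
         (auto simp: emeasure_restrict_space space_restrict_space)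
    also have "\<dots> \<le> ennreal (C powr q * 2 powr p) * (ennreal (2 * pi) + ennreal (256 * A))"
      unfolding y_def
      by (intro mult_left_mono add_left_mono Hardy_radial_maximal[OF hol p(1) A \<rho>(1,3) r(2)]) auto
    also have "\<dots> = ennreal (C powr q * 2 powr p * (2 * pi + 256 * A))"
      using A0 by (subst ennreal_mult) auto
    finally have "integral {0..2*pi} (\<lambda>\<theta>. \<Phi> \<theta> powr q) \<le> C powr q * 2 powr p * (2 * pi + 256 * A)"
      using A0 by (subst (asm) ennreal_le_iff) auto
    then show "integral {0..2*pi} (\<lambda>\<theta>. (integral {0..r} (\<lambda>x. cmod (G (rcis x \<theta>)))) powr (p / (1 - p)))
        \<le> C powr q * 2 powr p * (2 * pi + 256 * A)"
      unfolding \<Phi>_def q_def .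
  qed
qed

subsection \<open>Partial derivatives and harmonic functions\<close>

text \<open>\<open>pdx\<close> differentiates at parameter 0 of a translated line. Translating back
  gives the derivative at every parameter of one fixed line, the form that mean value arguments
  need.\<close>

lemma has_vector_derivative_pdx:
  assumes "has_partials_at f (z + of_real t)"
  shows "((\<lambda>s. f (z + of_real s)) has_vector_derivative pdx f (z + of_real t)) (at t)"
proof -
  have "((\<lambda>s. f (z + of_real t + of_real s)) has_vector_derivative pdx f (z + of_real t)) (at 0)"
    using assms unfolding has_partials_at_def pdx_def vector_derivative_works[symmetric] by blast
  then have "((\<lambda>s. f (z + of_real t + of_real s)) has_vector_derivative pdx f (z + of_real t)) (at (t - t))"
    by simp
  moreover have "((\<lambda>s. s - t) has_vector_derivative 1) (at t)"
    by (auto intro!: derivative_eq_intros)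
  ultimately have "((\<lambda>s. f (z + of_real t + of_real s)) \<circ> (\<lambda>s. s - t) has_vector_derivative 1 *\<^sub>R pdx f (z + of_real t)) (at t)"
    by (intro vector_diff_chain_at)
  then show ?thesis by (simp add: o_def)
qed

lemma has_vector_derivative_pdy:
  assumes "has_partials_at f (z + \<i> * of_real t)"
  shows "((\<lambda>s. f (z + \<i> * of_real s)) has_vector_derivative pdy f (z + \<i> * of_real t)) (at t)"
proof -
  have "((\<lambda>s. f (z + \<i> * of_real t + \<i> * of_real s)) has_vector_derivative pdy f (z + \<i> * of_real t)) (at 0)"
    using assms unfolding has_partials_at_def pdy_def vector_derivative_works[symmetric] by blast
  then have "((\<lambda>s. f (z + \<i> * of_real t + \<i> * of_real s)) has_vector_derivative pdy f (z + \<i> * of_real t)) (at (t - t))"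
    by simp
  moreover have "((\<lambda>s. s - t) has_vector_derivative 1) (at t)"
    by (auto intro!: derivative_eq_intros)
  ultimately have "((\<lambda>s. f (z + \<i> * of_real t + \<i> * of_real s)) \<circ> (\<lambda>s. s - t) has_vector_derivative 1 *\<^sub>R pdy f (z + \<i> * of_real t)) (at t)"
    by (intro vector_diff_chain_at)
  then show ?thesis by (simp add: o_def algebra_simps)
qed

lemma partials_eqI:
  assumes "((\<lambda>t. f (z + of_real t)) has_vector_derivative a) (at 0)"
    and "((\<lambda>t. f (z + \<i> * of_real t)) has_vector_derivative b) (at 0)"
  shows "has_partials_at f z" "pdx f z = a" "pdy f z = b"
  using assms unfolding has_partials_at_def pdx_def pdy_def
  by (auto intro: differentiableI_vector vector_derivative_at)

lemma partials_at_0: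
  assumes "has_partials_at f z"
  shows "((\<lambda>t. f (z + of_real t)) has_vector_derivative pdx f z) (at 0)"
    and "((\<lambda>t. f (z + \<i> * of_real t)) has_vector_derivative pdy f z) (at 0)"
  using assms has_vector_derivative_pdx[of f z 0] has_vector_derivative_pdy[of f z 0] by simp_all

lemma partials_bounded_linear:
  assumes L: "bounded_linear L" and f: "has_partials_at f z"
  shows "has_partials_at (\<lambda>w. L (f w)) z" "pdx (\<lambda>w. L (f w)) z = L (pdx f z)" "pdy (\<lambda>w. L (f w)) z = L (pdy f z)"
  using partials_eqI[OF bounded_linear.has_vector_derivative[OF L partials_at_0(1)[OF f]]
      bounded_linear.has_vector_derivative[OF L partials_at_0(2)[OF f]]]
  by blast+

text \<open>Partials see only values near \<open>z\<close>. This permits a second differentiation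
  when a formula for the first partials is known just on the open set.\<close>

lemma partials_cong:
  assumes S: "open S" "z \<in> S" and eq: "\<And>w. w \<in> S \<Longrightarrow> f w = g w" and f: "has_partials_at f z"
  shows "has_partials_at g z" "pdx g z = pdx f z" "pdy g z = pdy f z"
proof -
  have e: "\<forall>\<^sub>F t in at 0. z + of_real t \<in> S" "\<forall>\<^sub>F t in at 0. z + \<i> * of_real t \<in> S"
    by (rule topological_tendstoD[OF _ S(1)], (auto intro!: tendsto_eq_intros simp: S(2))[2])+
  have "\<forall>\<^sub>F t in at 0. f (z + of_real t) = g (z + of_real t)"
    using e(1) by (rule eventually_mono) (rule eq)
  moreover have "\<forall>\<^sub>F t in at 0. f (z + \<i> * of_real t) = g (z + \<i> * of_real t)"
    using e(2) by (rule eventually_mono) (rule eq)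
  ultimately have "((\<lambda>t. g (z + of_real t)) has_vector_derivative pdx f z) (at 0)"
      "((\<lambda>t. g (z + \<i> * of_real t)) has_vector_derivative pdy f z) (at 0)"
    using partials_at_0[OF f] eq[OF S(2)]
    by (auto simp: has_vector_derivative_def intro: has_derivative_transform_eventually)
  from partials_eqI[OF this] show "has_partials_at g z" "pdx g z = pdx f z" "pdy g z = pdy f z" by blast+
qed

lemma C1_on_cong:
  assumes S: "open S" and eq: "\<And>w. w \<in> S \<Longrightarrow> f w = g w" and f: "C1_on S f"
  shows "C1_on S g"
  unfolding C1_on_def
proof (intro conjI ballI)
  note c = partials_cong[OF S _ eq]
  have fp: "has_partials_at f z" if "z \<in> S" for z using f that by (simp add: C1_on_def)
  show "has_partials_at g z" if "z \<in> S" for z using c(1)[OF that _ fp[OF that]] .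
  show "continuous_on S g" using f eq by (simp add: C1_on_def cong: continuous_on_cong)
  have "continuous_on S (pdx f)" "continuous_on S (pdy f)" using f by (simp_all add: C1_on_def)
  then show "continuous_on S (pdx g)" "continuous_on S (pdy g)"
    using c(2,3)[OF _ _ fp] by (simp_all cong: continuous_on_cong)
qed

lemma C1_on_bounded_linear:
  fixes L :: "complex \<Rightarrow> complex"
  assumes L: "bounded_linear L" and f: "C1_on S f"
  shows "C1_on S (\<lambda>w. L (f w))"
proof -
  have fp: "has_partials_at f z" if "z \<in> S" for z using f that by (simp add: C1_on_def)
  note p = partials_bounded_linear[OF L fp]
  have "continuous_on S (\<lambda>z. L (pdx f z))" "continuous_on S (\<lambda>z. L (pdy f z))" "continuous_on S (\<lambda>z. L (f z))"
    using f by (auto simp: C1_on_def intro!: bounded_linear.continuous_on[OF L])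
  then show ?thesis unfolding C1_on_def using p by (auto cong: continuous_on_cong)
qed

text \<open>\<open>L\<close> need only be real-linear, which covers conjugation and the imaginary
  part viewed as a complex-valued function.\<close>

lemma harmonic_on_bounded_linear:
  fixes L :: "complex \<Rightarrow> complex"
  assumes S: "open S" and L: "bounded_linear L" and f: "harmonic_on S f"
  shows "harmonic_on S (\<lambda>w. L (f w))"
proof -
  have C: "C1_on S f" "C1_on S (pdx f)" "C1_on S (pdy f)" using f by (auto simp: harmonic_on_def C2_on_def)
  then have fp: "has_partials_at f z" "has_partials_at (pdx f) z" "has_partials_at (pdy f) z" if "z \<in> S" for z
    using that by (auto simp: C1_on_def)
  note p = partials_bounded_linear[OF L fp(1)] and px = partials_bounded_linear[OF L fp(2)]
    and py = partials_bounded_linear[OF L fp(3)]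
  have x: "C1_on S (pdx (\<lambda>w. L (f w)))"
    by (rule C1_on_cong[OF S _ C1_on_bounded_linear[OF L C(2)]]) (simp add: p)
  have y: "C1_on S (pdy (\<lambda>w. L (f w)))"
    by (rule C1_on_cong[OF S _ C1_on_bounded_linear[OF L C(3)]]) (simp add: p)
  have "pdx (pdx (\<lambda>w. L (f w))) z + pdy (pdy (\<lambda>w. L (f w))) z = 0" if z: "z \<in> S" for z
  proof -
    have "pdx (pdx (\<lambda>w. L (f w))) z = L (pdx (pdx f) z)"
      using partials_cong(2)[OF S z _ px(1)[OF z], of "pdx (\<lambda>w. L (f w))"] px(2)[OF z] p(2) by simp
    moreover have "pdy (pdy (\<lambda>w. L (f w))) z = L (pdy (pdy f) z)"
      using partials_cong(3)[OF S z _ py(1)[OF z], of "pdy (\<lambda>w. L (f w))"] py(3)[OF z] p(3) by simp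
    moreover have "L (pdx (pdx f) z) + L (pdy (pdy f) z) = L (pdx (pdx f) z + pdy (pdy f) z)"
      using L by (simp add: linear_simps)
    moreover have "pdx (pdx f) z + pdy (pdy f) z = 0" using f z by (simp add: harmonic_on_def)
    ultimately show ?thesis using L by (simp add: linear_simps)
  qed
  then show ?thesis unfolding harmonic_on_def C2_on_def using C1_on_bounded_linear[OF L C(1)] x y by blast
qed

section \<open>Symmetry of the mixed second derivatives\<close>

lemma mixed_difference_pdy_pdx:
  fixes u :: "complex \<Rightarrow> real"
  assumes h: "0 < h" and u: "\<And>t s. t \<in> {0..h} \<Longrightarrow> s \<in> {0..h} \<Longrightarrow> has_partials_at u (z + of_real t + \<i> * of_real s)"
    and ux: "\<And>t s. t \<in> {0..h} \<Longrightarrow> s \<in> {0..h} \<Longrightarrow> has_partials_at (pdx u) (z + of_real t + \<i> * of_real s)"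
  shows "\<exists>t\<in>{0..h}. \<exists>s\<in>{0..h}. u (z + of_real h + \<i> * of_real h) - u (z + of_real h) - u (z + \<i> * of_real h) + u z
           = h * h * pdy (pdx u) (z + of_real t + \<i> * of_real s)"
proof -
  define \<phi> where "\<phi> t = u (z + \<i> * of_real h + of_real t) - u (z + of_real t)" for t
  have "(\<phi> has_real_derivative pdx u (z + \<i> * of_real h + of_real t) - pdx u (z + of_real t)) (at t)"
    if "0 \<le> t" "t \<le> h" for t
    unfolding \<phi>_def
  proof (rule DERIV_diff)
    show "((\<lambda>t. u (z + \<i> * of_real h + of_real t)) has_real_derivative pdx u (z + \<i> * of_real h + of_real t)) (at t)"
      unfolding has_real_derivative_iff_has_vector_derivative
      using u[of t h] that h by (intro has_vector_derivative_pdx) (simp add: add_ac)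
    show "((\<lambda>t. u (z + of_real t)) has_real_derivative pdx u (z + of_real t)) (at t)"
      unfolding has_real_derivative_iff_has_vector_derivative
      using u[of t 0] that h by (intro has_vector_derivative_pdx) simp
  qed
  from MVT2[OF h this] obtain t where t: "0 < t" "t < h"
    and \<phi>t: "\<phi> h - \<phi> 0 = h * (pdx u (z + \<i> * of_real h + of_real t) - pdx u (z + of_real t))" by auto
  have "((\<lambda>s. pdx u (z + of_real t + \<i> * of_real s)) has_real_derivative pdy (pdx u) (z + of_real t + \<i> * of_real s)) (at s)"
    if "0 \<le> s" "s \<le> h" for s
    unfolding has_real_derivative_iff_has_vector_derivative
    using ux[of t s] that t by (intro has_vector_derivative_pdy) simp
  from MVT2[OF h this] obtain s where s: "0 < s" "s < h"
    and "pdx u (z + of_real t + \<i> * of_real h) - pdx u (z + of_real t) = h * pdy (pdx u) (z + of_real t + \<i> * of_real s)"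
    by auto
  then have "\<phi> h - \<phi> 0 = h * h * pdy (pdx u) (z + of_real t + \<i> * of_real s)"
    using \<phi>t by (simp add: add_ac)
  then show ?thesis using t s by (intro bexI[of _ t] bexI[of _ s]) (auto simp: \<phi>_def add_ac)
qed

lemma mixed_difference_pdx_pdy:
  fixes u :: "complex \<Rightarrow> real"
  assumes h: "0 < h" and u: "\<And>t s. t \<in> {0..h} \<Longrightarrow> s \<in> {0..h} \<Longrightarrow> has_partials_at u (z + of_real t + \<i> * of_real s)"
    and uy: "\<And>t s. t \<in> {0..h} \<Longrightarrow> s \<in> {0..h} \<Longrightarrow> has_partials_at (pdy u) (z + of_real t + \<i> * of_real s)"
  shows "\<exists>t\<in>{0..h}. \<exists>s\<in>{0..h}. u (z + of_real h + \<i> * of_real h) - u (z + of_real h) - u (z + \<i> * of_real h) + u z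
           = h * h * pdx (pdy u) (z + of_real t + \<i> * of_real s)"
proof -
  define \<phi> where "\<phi> s = u (z + of_real h + \<i> * of_real s) - u (z + \<i> * of_real s)" for s
  have "(\<phi> has_real_derivative pdy u (z + of_real h + \<i> * of_real s) - pdy u (z + \<i> * of_real s)) (at s)"
    if "0 \<le> s" "s \<le> h" for s
    unfolding \<phi>_def
  proof (rule DERIV_diff)
    show "((\<lambda>s. u (z + of_real h + \<i> * of_real s)) has_real_derivative pdy u (z + of_real h + \<i> * of_real s)) (at s)"
      unfolding has_real_derivative_iff_has_vector_derivative
      using u[of h s] that h by (intro has_vector_derivative_pdy) simp
    show "((\<lambda>s. u (z + \<i> * of_real s)) has_real_derivative pdy u (z + \<i> * of_real s)) (at s)"
      unfolding has_real_derivative_iff_has_vector_derivative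
      using u[of 0 s] that h by (intro has_vector_derivative_pdy) simp
  qed
  from MVT2[OF h this] obtain s where s: "0 < s" "s < h"
    and \<phi>s: "\<phi> h - \<phi> 0 = h * (pdy u (z + of_real h + \<i> * of_real s) - pdy u (z + \<i> * of_real s))" by auto
  have "((\<lambda>t. pdy u (z + \<i> * of_real s + of_real t)) has_real_derivative pdx (pdy u) (z + \<i> * of_real s + of_real t)) (at t)"
    if "0 \<le> t" "t \<le> h" for t
    unfolding has_real_derivative_iff_has_vector_derivative
    using uy[of t s] that s by (intro has_vector_derivative_pdx) (simp add: add_ac)
  from MVT2[OF h this] obtain t where t: "0 < t" "t < h"
    and "pdy u (z + \<i> * of_real s + of_real h) - pdy u (z + \<i> * of_real s) = h * pdx (pdy u) (z + \<i> * of_real s + of_real t)"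
    by auto
  then have "\<phi> h - \<phi> 0 = h * h * pdx (pdy u) (z + of_real t + \<i> * of_real s)"
    using \<phi>s by (simp add: add_ac)
  then show ?thesis using t s by (intro bexI[of _ t] bexI[of _ s]) (auto simp: \<phi>_def add_ac)
qed

text \<open>The second difference of \<open>u\<close> over a small square is \<open>h * h\<close>
  times either mixed derivative, each at some point of the square, by two mean value steps. If the
  two derivatives differed at \<open>z\<close>, continuity would keep their values near
  \<open>z\<close> apart.\<close>

lemma symmetric_mixed_partials_real:
  fixes u :: "complex \<Rightarrow> real"
  assumes S: "open S" "z \<in> S"
    and u: "\<And>w. w \<in> S \<Longrightarrow> has_partials_at u w" "\<And>w. w \<in> S \<Longrightarrow> has_partials_at (pdx u) w"
      "\<And>w. w \<in> S \<Longrightarrow> has_partials_at (pdy u) w"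
    and cont: "continuous_on S (pdy (pdx u))" "continuous_on S (pdx (pdy u))"
  shows "pdy (pdx u) z = pdx (pdy u) z"
proof (rule ccontr)
  assume ne: "pdy (pdx u) z \<noteq> pdx (pdy u) z"
  define e where "e = \<bar>pdy (pdx u) z - pdx (pdy u) z\<bar> / 2"
  have e: "0 < e" using ne by (simp add: e_def)
  have c: "continuous (at z) (pdy (pdx u))" "continuous (at z) (pdx (pdy u))"
    using cont S by (simp_all add: continuous_on_eq_continuous_at)
  obtain d1 where d1: "0 < d1" "\<forall>w. dist w z < d1 \<longrightarrow> dist (pdy (pdx u) w) (pdy (pdx u) z) < e"
    using c(1)[unfolded continuous_at_eps_delta, rule_format, OF e] by blast
  obtain d2 where d2: "0 < d2" "\<forall>w. dist w z < d2 \<longrightarrow> dist (pdx (pdy u) w) (pdx (pdy u) z) < e"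
    using c(2)[unfolded continuous_at_eps_delta, rule_format, OF e] by blast
  note d = d1(1) d2(1) d1(2)[rule_format] d2(2)[rule_format]
  obtain d0 where d0: "0 < d0" "ball z d0 \<subseteq> S" using openE[OF S] .
  \<comment> \<open>The third leaves room: points of the square are within
    \<open>2 * h < 3 * h\<close> of \<open>z\<close>.\<close>
  define h where "h = min d0 (min d1 d2) / 3"
  have h: "0 < h" using d d0 by (simp add: h_def)
  have in_h: "dist (z + of_real t + \<i> * of_real s) z < min d0 (min d1 d2)"
    if "t \<in> {0..h}" "s \<in> {0..h}" for t s
  proof -
    have "dist (z + of_real t + \<i> * of_real s) z \<le> \<bar>t\<bar> + \<bar>s\<bar>"
      using norm_triangle_ineq[of "of_real t" "\<i> * of_real s"] by (simp add: dist_norm norm_mult)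
    also have "\<dots> \<le> 2 * h" using that by simp
    also have "\<dots> < 3 * h" using h by simp
    finally show ?thesis by (simp add: h_def)
  qed
  have in_S: "z + of_real t + \<i> * of_real s \<in> S" if "t \<in> {0..h}" "s \<in> {0..h}" for t s
    using in_h[OF that] d0(2) by (auto simp: dist_commute)
  have "\<exists>t\<in>{0..h}. \<exists>s\<in>{0..h}. u (z + of_real h + \<i> * of_real h) - u (z + of_real h) - u (z + \<i> * of_real h) + u z
      = h * h * pdy (pdx u) (z + of_real t + \<i> * of_real s)"
    by (rule mixed_difference_pdy_pdx[OF h]) (use u in_S in auto)
  then obtain t s where ts: "t \<in> {0..h}" "s \<in> {0..h}"
    and 1: "u (z + of_real h + \<i> * of_real h) - u (z + of_real h) - u (z + \<i> * of_real h) + u z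
      = h * h * pdy (pdx u) (z + of_real t + \<i> * of_real s)"
    by blast
  have "\<exists>t\<in>{0..h}. \<exists>s\<in>{0..h}. u (z + of_real h + \<i> * of_real h) - u (z + of_real h) - u (z + \<i> * of_real h) + u z
      = h * h * pdx (pdy u) (z + of_real t + \<i> * of_real s)"
    by (rule mixed_difference_pdx_pdy[OF h]) (use u in_S in auto)
  then obtain t' s' where ts': "t' \<in> {0..h}" "s' \<in> {0..h}"
    and 2: "u (z + of_real h + \<i> * of_real h) - u (z + of_real h) - u (z + \<i> * of_real h) + u z
      = h * h * pdx (pdy u) (z + of_real t' + \<i> * of_real s')"
    by blast
  define X where "X = pdy (pdx u) (z + of_real t + \<i> * of_real s)"
  have X: "X = pdx (pdy u) (z + of_real t' + \<i> * of_real s')"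
    using 1 2 h by (simp add: X_def)
  have "dist X (pdy (pdx u) z) < e"
    unfolding X_def using in_h[OF ts] by (intro d(3)) simp
  moreover have "dist X (pdx (pdy u) z) < e"
    unfolding X using in_h[OF ts'] by (intro d(4)) simp
  moreover have "dist (pdy (pdx u) z) (pdx (pdy u) z) \<le> dist X (pdy (pdx u) z) + dist X (pdx (pdy u) z)"
    by (rule dist_triangle3)
  moreover have "dist (pdy (pdx u) z) (pdx (pdy u) z) = 2 * e" by (simp add: e_def dist_real_def)
  ultimately show False by linarith
qed

lemma symmetric_mixed_partials:
  assumes S: "open S" "z \<in> S" and f: "C2_on S f"
  shows "pdy (pdx f) z = pdx (pdy f) z"
proof -
  have C: "C1_on S f" "C1_on S (pdx f)" "C1_on S (pdy f)" using f by (auto simp: C2_on_def)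
  then have fp: "has_partials_at f w" "has_partials_at (pdx f) w" "has_partials_at (pdy f) w" if "w \<in> S" for w
    using that by (auto simp: C1_on_def)
  have *: "L (pdy (pdx f) z) = L (pdx (pdy f) z)" if L: "bounded_linear L" for L :: "complex \<Rightarrow> real"
  proof -
    note p = partials_bounded_linear[OF L fp(1)] and px = partials_bounded_linear[OF L fp(2)]
      and py = partials_bounded_linear[OF L fp(3)]
    define u where "u w = L (f w)" for w
    have ux: "L (pdx f w) = pdx u w" and uy: "L (pdy f w) = pdy u w" if "w \<in> S" for w
      using p(2,3)[OF that] by (simp_all add: u_def[abs_def])
    have 1: "has_partials_at (pdx u) w" "pdy (pdx u) w = L (pdy (pdx f) w)" if "w \<in> S" for w
      using partials_cong(1,3)[OF S(1) that ux px(1)[OF that]] px(3)[OF that] by auto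
    have 2: "has_partials_at (pdy u) w" "pdx (pdy u) w = L (pdx (pdy f) w)" if "w \<in> S" for w
      using partials_cong(1,2)[OF S(1) that uy py(1)[OF that]] py(2)[OF that] by auto
    have "continuous_on S (\<lambda>w. L (pdy (pdx f) w))" "continuous_on S (\<lambda>w. L (pdx (pdy f) w))"
      using C by (auto simp: C1_on_def intro!: bounded_linear.continuous_on[OF L])
    then have "continuous_on S (pdy (pdx u))" "continuous_on S (pdx (pdy u))"
      using 1 2 by (simp_all cong: continuous_on_cong)
    moreover have "has_partials_at u w" if "w \<in> S" for w
      using p(1)[OF that] by (simp add: u_def[abs_def])
    ultimately have "pdy (pdx u) z = pdx (pdy u) z"
      using 1 2 by (intro symmetric_mixed_partials_real[OF S]) auto
    then show ?thesis using 1(2)[OF S(2)] 2(2)[OF S(2)] by simp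
  qed
  show ?thesis using *[OF bounded_linear_Re] *[OF bounded_linear_Im] by (simp add: complex_eq_iff)
qed

subsection \<open>The holomorphic functions attached to a harmonic function\<close>

text \<open>Continuous partials give total differentiability. On an open square around
  \<open>z\<close> the partial in \<open>x\<close> is needed at \<open>z\<close> only, the one in
  \<open>y\<close> throughout and with continuity.\<close>

lemma C1_on_has_derivative:
  assumes S: "open S" "z \<in> S" and f: "C1_on S f"
  shows "(f has_derivative (\<lambda>h. Re h *\<^sub>R pdx f z + Im h *\<^sub>R pdy f z)) (at z)"
proof -
  obtain e where e: "0 < e" "ball z e \<subseteq> S" using openE[OF S] .
  define X where "X = {Re z - e / 2<..<Re z + e / 2}"
  define Y where "Y = {Im z - e / 2<..<Im z + e / 2}"
  have in_S: "Complex x y \<in> S" if "x \<in> X" "y \<in> Y" for x y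
  proof -
    have "cmod (z - Complex x y) \<le> \<bar>Re (z - Complex x y)\<bar> + \<bar>Im (z - Complex x y)\<bar>"
      by (rule cmod_le)
    also have "\<dots> < e / 2 + e / 2"
    proof (rule add_strict_mono)
      show "\<bar>Re (z - Complex x y)\<bar> < e / 2" using that(1) unfolding X_def greaterThanLessThan_iff minus_complex.sel complex.sel abs_less_iff by linarith
      show "\<bar>Im (z - Complex x y)\<bar> < e / 2" using that(2) unfolding Y_def greaterThanLessThan_iff minus_complex.sel complex.sel abs_less_iff by linarith
    qed
    finally show ?thesis using e(2) by (auto simp: dist_norm)
  qed
  have zXY: "Re z \<in> X" "Im z \<in> Y" using e(1) by (auto simp: X_def Y_def)
  have fp: "has_partials_at f w" if "w \<in> S" for w using f that by (simp add: C1_on_def)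
  have fx: "((\<lambda>x. f (Complex x (Im z))) has_derivative (\<lambda>t. t *\<^sub>R pdx f z)) (at (Re z) within X)"
  proof -
    have z: "Complex 0 (Im z) + of_real (Re z) = z" by (simp add: complex_eq_iff)
    have "((\<lambda>s. f (Complex 0 (Im z) + of_real s)) has_vector_derivative pdx f z) (at (Re z))"
      using has_vector_derivative_pdx[of f "Complex 0 (Im z)" "Re z"] fp[OF S(2)] unfolding z by simp
    moreover have "Complex 0 (Im z) + of_real s = Complex s (Im z)" for s by (simp add: complex_eq_iff)
    ultimately show ?thesis unfolding has_vector_derivative_def by (simp add: has_derivative_at_withinI)
  qed
  have fy: "((\<lambda>y. f (Complex x y)) has_derivative blinfun_apply (blinfun_scaleR_left (pdy f (Complex x y)))) (at y within Y)"
    if "x \<in> X" "y \<in> Y" for x y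
  proof -
    have z: "Complex x 0 + \<i> * of_real y = Complex x y" for y by (simp add: complex_eq_iff)
    have "((\<lambda>s. f (Complex x 0 + \<i> * of_real s)) has_vector_derivative pdy f (Complex x y)) (at y)"
      using has_vector_derivative_pdy[of f "Complex x 0" y] fp[OF in_S[OF that]] unfolding z by simp
    then show ?thesis unfolding has_vector_derivative_def z by (simp add: has_derivative_at_withinI)
  qed
  have cont: "continuous (at (Re z, Im z) within X \<times> Y) (\<lambda>(x, y). blinfun_scaleR_left (pdy f (Complex x y)))"
  proof -
    have "continuous_on S (pdy f)" using f by (simp add: C1_on_def)
    moreover have "continuous_on (X \<times> Y) (\<lambda>p. Complex (fst p) (snd p))" by (intro continuous_intros)
    moreover have "(\<lambda>p. Complex (fst p) (snd p)) ` (X \<times> Y) \<subseteq> S" using in_S by auto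
    ultimately have "continuous_on (X \<times> Y) (\<lambda>p. pdy f (Complex (fst p) (snd p)))"
      by (rule continuous_on_compose2)
    then have "continuous_on (X \<times> Y) (\<lambda>p. blinfun_scaleR_left (pdy f (Complex (fst p) (snd p))))"
      by (rule bounded_linear.continuous_on[OF bounded_linear_blinfun_scaleR_left])
    then show ?thesis using zXY by (simp add: continuous_on_eq_continuous_within case_prod_beta')
  qed
  have DXY: "((\<lambda>(x, y). f (Complex x y)) has_derivative
      (\<lambda>(tx, ty). tx *\<^sub>R pdx f z + blinfun_scaleR_left (pdy f (Complex (Re z) (Im z))) ty))
      (at (Re z, Im z) within X \<times> Y)"
    by (rule has_derivative_partialsI[OF fx fy cont zXY(2)]) (auto simp: Y_def)
  have "open (X \<times> Y)" unfolding X_def Y_def by (intro open_Times open_greaterThanLessThan)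
  then have at: "at (Re z, Im z) within X \<times> Y = at (Re z, Im z)"
    using zXY by (intro at_within_open) auto
  have D: "((\<lambda>(x, y). f (Complex x y)) has_derivative (\<lambda>(tx, ty). tx *\<^sub>R pdx f z + ty *\<^sub>R pdy f z))
      (at (Re z, Im z))"
    using DXY unfolding at complex_surj blinfun_scaleR_left.rep_eq .
  have "((\<lambda>w. (Re w, Im w)) has_derivative (\<lambda>h. (Re h, Im h))) (at z)"
    by (intro has_derivative_Pair bounded_linear_imp_has_derivative bounded_linear_Re bounded_linear_Im)
  from has_derivative_compose[OF this D] show ?thesis by simp
qed

text \<open>The real derivative of \<open>f_z\<close> involves four second derivatives of
  \<open>f\<close>. Symmetry and Laplace's equation leave only \<open>a\<close> and
  \<open>b\<close>, and the resulting real-linear map is multiplication by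
  \<open>(a - i b) / 2\<close>.\<close>

lemma wirtinger_z_holomorphic:
  assumes S: "open S" and f: "harmonic_on S f"
  shows "wirtinger_z f holomorphic_on S"
  unfolding holomorphic_on_open[OF S]
proof
  fix z assume z: "z \<in> S"
  have C: "C1_on S (pdx f)" "C1_on S (pdy f)" "C2_on S f" and h: "pdx (pdx f) z + pdy (pdy f) z = 0"
    using f z by (auto simp: harmonic_on_def C2_on_def)
  define a where "a = pdx (pdx f) z"
  define b where "b = pdx (pdy f) z"
  have yy: "pdy (pdy f) z = - a" using h by (simp add: a_def add_eq_0_iff)
  have xy: "pdy (pdx f) z = b" unfolding b_def by (rule symmetric_mixed_partials[OF S z C(3)])
  have D: "((\<lambda>w. (1 / 2) * (pdx f w - \<i> * pdy f w)) has_derivative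
      (\<lambda>h. (1 / 2) * ((Re h *\<^sub>R a + Im h *\<^sub>R b) - \<i> * (Re h *\<^sub>R b + Im h *\<^sub>R (- a))))) (at z)"
    using C1_on_has_derivative[OF S z C(1)] C1_on_has_derivative[OF S z C(2)]
    unfolding yy xy a_def[symmetric] b_def[symmetric]
    by (intro has_derivative_mult_right has_derivative_diff)
  have eq: "(1 / 2) * ((Re h *\<^sub>R a + Im h *\<^sub>R b) - \<i> * (Re h *\<^sub>R b + Im h *\<^sub>R (- a))) = (a - \<i> * b) / 2 * h" for h
    by (simp add: complex_eq_iff) (simp add: field_simps)
  have wz: "wirtinger_z f = (\<lambda>w. (1 / 2) * (pdx f w - \<i> * pdy f w))"
    by (simp add: fun_eq_iff wirtinger_z_def)
  have "(wirtinger_z f has_derivative (\<lambda>h. (a - \<i> * b) / 2 * h)) (at z)"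
    unfolding wz using D unfolding eq .
  then show "\<exists>f'. (wirtinger_z f has_field_derivative f') (at z)"
    unfolding has_field_derivative_def by blast
qed

text \<open>Conjugating \<open>f\<close> exchanges the two Wirtinger derivatives up to conjugation,
  so this is holomorphy of \<open>f_z\<close> for the harmonic function
  \<open>cnj f\<close>.\<close>

lemma cnj_wirtinger_zbar_holomorphic:
  assumes S: "open S" and f: "harmonic_on S f"
  shows "(\<lambda>z. cnj (wirtinger_zbar f z)) holomorphic_on S"
proof -
  have "harmonic_on S (\<lambda>w. cnj (f w))"
    by (rule harmonic_on_bounded_linear[OF S bounded_linear_cnj f])
  then have "wirtinger_z (\<lambda>w. cnj (f w)) holomorphic_on S" by (rule wirtinger_z_holomorphic[OF S])
  moreover have "wirtinger_z (\<lambda>w. cnj (f w)) z = cnj (wirtinger_zbar f z)" if "z \<in> S" for z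
  proof -
    have "has_partials_at f z" using f that by (auto simp: harmonic_on_def C2_on_def C1_on_def)
    from partials_bounded_linear[OF bounded_linear_cnj this] show ?thesis
      by (simp add: wirtinger_z_def wirtinger_zbar_def)
  qed
  ultimately show ?thesis by (rule holomorphic_transform)
qed

section \<open>Growth along radii and the gradient bound\<close>

lemma continuous_on_Lambda:
  assumes "C1_on S f"
  shows "continuous_on S (Lambda f)"
  using assms unfolding Lambda_def[abs_def] wirtinger_z_def wirtinger_zbar_def C1_on_def
  by (intro continuous_intros) auto

text \<open>Along the ray of angle \<open>\<theta>\<close> the derivative of \<open>f\<close> is
  \<open>f_z e^(i \<theta>) + f_zbar e^(-i \<theta>)\<close>, of modulus at most
  \<open>Lambda f\<close>.\<close>

lemma cmod_diff_le_radial_integral: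
  assumes f: "C1_on unit_disc f" and r: "0 \<le> r" "r < 1"
  shows "cmod (f (rcis r \<theta>) - f 0) \<le> integral {0..r} (\<lambda>x. Lambda f (rcis x \<theta>))"
proof -
  define v where "v x = cos \<theta> *\<^sub>R pdx f (rcis x \<theta>) + sin \<theta> *\<^sub>R pdy f (rcis x \<theta>)" for x
  have "((\<lambda>x. f (rcis x \<theta>)) has_vector_derivative v x) (at x within {0..r})" if "x \<in> {0..r}" for x
  proof -
    have "rcis x \<theta> \<in> unit_disc" using that r by simp
    from C1_on_has_derivative[OF open_ball this f]
    have D: "(f has_derivative (\<lambda>h. Re h *\<^sub>R pdx f (rcis x \<theta>) + Im h *\<^sub>R pdy f (rcis x \<theta>))) (at (rcis x \<theta>))" .
    have "((\<lambda>x. rcis x \<theta>) has_derivative (\<lambda>t. of_real t * cis \<theta>)) (at x within {0..r})"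
      unfolding rcis_def by (intro has_derivative_mult_left has_derivative_of_real has_derivative_ident)
    from has_derivative_compose[OF this D]
    show ?thesis unfolding has_vector_derivative_def v_def by (simp add: scaleR_add_right)
  qed
  then have "(v has_integral f (rcis r \<theta>) - f (rcis 0 \<theta>)) {0..r}"
    using r by (intro fundamental_theorem_of_calculus) auto
  then have I: "v integrable_on {0..r}" "integral {0..r} v = f (rcis r \<theta>) - f 0"
    by (auto simp: integral_unique)
  have "cmod (v x) \<le> Lambda f (rcis x \<theta>)" for x
  proof -
    have "v x = wirtinger_z f (rcis x \<theta>) * cis \<theta> + wirtinger_zbar f (rcis x \<theta>) * cis (- \<theta>)"
      unfolding v_def wirtinger_z_def wirtinger_zbar_def
      by (simp add: complex_eq_iff algebra_simps add_divide_distrib diff_divide_distrib)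
    then have "cmod (v x) \<le> cmod (wirtinger_z f (rcis x \<theta>) * cis \<theta>) + cmod (wirtinger_zbar f (rcis x \<theta>) * cis (- \<theta>))"
      by (simp only: norm_triangle_ineq)
    then show ?thesis by (simp add: Lambda_def norm_mult)
  qed
  moreover have "(\<lambda>x. Lambda f (rcis x \<theta>)) integrable_on {0..r}"
    by (intro integrable_continuous_real
        continuous_on_compose_rcis[OF continuous_on_Lambda[OF f] continuous_on_id continuous_on_const]) (use r in auto)
  ultimately have "norm (integral {0..r} v) \<le> integral {0..r} (\<lambda>x. Lambda f (rcis x \<theta>))"
    using I(1) by (intro integral_norm_bound_integral) auto
  then show ?thesis unfolding I(2) .
qed

text \<open>The set where the inequality fails is open and null, hence empty. Circles are null sets,
  so an inequality almost everywhere in the disc says nothing about a given circle before this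
  upgrade.\<close>

lemma AE_lebesgue_on_open_imp_le:
  fixes g h :: "complex \<Rightarrow> real"
  assumes S: "open S" and g: "continuous_on S g" and h: "continuous_on S h"
    and AE: "AE z in lebesgue_on S. g z \<le> h z" and z: "z \<in> S"
  shows "g z \<le> h z"
proof (rule ccontr)
  assume "\<not> g z \<le> h z"
  define U where "U = S \<inter> (\<lambda>w. g w - h w) -` {0<..}"
  have "open U" unfolding U_def
    by (intro continuous_open_preimage continuous_intros g h S)
  have "AE w in lebesgue. w \<in> S \<longrightarrow> g w \<le> h w"
    using AE S by (subst (asm) AE_restrict_space_iff) auto
  then obtain N where N: "negligible N" "{w. \<not> (w \<in> S \<longrightarrow> g w \<le> h w)} \<subseteq> N"
    unfolding eventually_ae_filter_negligible by blast
  have "U \<subseteq> {w. \<not> (w \<in> S \<longrightarrow> g w \<le> h w)}" by (auto simp: U_def)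
  then have "negligible U" using N(2) by (intro negligible_subset[OF N(1)]) (rule order_trans)
  with open_not_negligible[OF \<open>open U\<close>] have "U = {}" by blast
  with z \<open>\<not> g z \<le> h z\<close> show False by (auto simp: U_def)
qed

text \<open>For \<open>u = Re f\<close> one has \<open>2 u_z = f_z + cnj f_zbar\<close>, and
  \<open>|grad u| = 2 |u_z|\<close>.\<close>

lemma grad_norm_Re:
  assumes "has_partials_at f z"
  shows "grad_norm (\<lambda>w. Re (f w)) z = cmod (wirtinger_z f z + cnj (wirtinger_zbar f z))"
proof -
  have "wirtinger_z f z + cnj (wirtinger_zbar f z) = Complex (Re (pdx f z)) (- Re (pdy f z))"
    unfolding wirtinger_z_def wirtinger_zbar_def
    by (simp add: complex_eq_iff algebra_simps add_divide_distrib diff_divide_distrib)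
  then show ?thesis
    using partials_bounded_linear[OF bounded_linear_Re assms] by (simp add: grad_norm_def cmod_def)
qed

text \<open>
  Since \<open>J = \<Lambda> (\<bar>f\<^sub>z\<bar> - \<bar>f\<^sub>z\<^sub>b\<^sub>a\<^sub>r\<bar>)\<close> and \<open>\<bar>f\<^sub>z\<bar> - \<bar>f\<^sub>z\<^sub>b\<^sub>a\<^sub>r\<bar> \<le> \<bar>\<nabla>u\<bar>\<close>, quasiregularity is a quadratic inequality for
  \<open>\<Lambda>\<close> with coefficients controlled by \<open>\<bar>\<nabla>u\<bar>\<close>.
\<close>

lemma Lambda_le_grad_norm_Re:
  assumes K: "1 \<le> K" "0 \<le> K'" and f: "harmonic_quasiregular K K' f" and z: "z \<in> unit_disc"
  shows "Lambda f z \<le> K * grad_norm (\<lambda>w. Re (f w)) z + sqrt K'"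
proof -
  have C: "C1_on unit_disc f" using f by (auto simp: harmonic_quasiregular_def harmonic_on_def C2_on_def)
  have qr: "(Lambda f z)\<^sup>2 \<le> K * Jacobian f z + K'"
  proof (rule AE_lebesgue_on_open_imp_le[OF open_ball _ _ _ z])
    show "AE z in lebesgue_on unit_disc. (Lambda f z)\<^sup>2 \<le> K * Jacobian f z + K'"
      using f by (simp add: harmonic_quasiregular_def quasiregular_def)
    show "continuous_on unit_disc (\<lambda>z. (Lambda f z)\<^sup>2)" by (intro continuous_intros continuous_on_Lambda C)
    show "continuous_on unit_disc (\<lambda>z. K * Jacobian f z + K')"
      using C unfolding Jacobian_def[abs_def] wirtinger_z_def wirtinger_zbar_def C1_on_def
      by (intro continuous_intros) auto
  qed
  define g where "g = grad_norm (\<lambda>w. Re (f w)) z"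
  define L where "L = Lambda f z"
  define l where "l = cmod (wirtinger_z f z) - cmod (wirtinger_zbar f z)"
  have J: "Jacobian f z = L * l"
    by (simp add: L_def l_def Lambda_def Jacobian_def power2_eq_square algebra_simps)
  have "has_partials_at f z" using C z by (simp add: C1_on_def)
  then have l: "l \<le> g"
    unfolding g_def l_def using norm_diff_ineq[of "wirtinger_z f z" "cnj (wirtinger_zbar f z)"]
    by (simp add: grad_norm_Re)
  have L0: "0 \<le> L" by (simp add: L_def Lambda_def)
  have "L\<^sup>2 \<le> K * (L * l) + K'" using qr unfolding J L_def[symmetric] .
  also have "\<dots> \<le> K * (L * g) + K'" using K l L0 by (intro add_right_mono mult_left_mono) auto
  finally have q: "L\<^sup>2 \<le> K * (L * g) + K'" .
  have g0: "0 \<le> g" by (simp add: g_def grad_norm_def)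
  have "L \<le> K * g + sqrt K'"
  \<comment> \<open>An \<open>L\<close> above \<open>K * g + sqrt K'\<close> also exceeds
    \<open>sqrt K'\<close>, and then \<open>L * L\<close> beats the right side of \<open>q\<close>
    term by term; the quadratic need not be solved.\<close>
  proof (rule ccontr)
    assume "\<not> L \<le> K * g + sqrt K'"
    then have gt: "K * g + sqrt K' < L" by simp
    have Kg: "0 \<le> K * g" using K g0 by simp
    have "0 \<le> sqrt K'" using K by simp
    then have "0 < L" "sqrt K' \<le> L" using gt Kg by linarith+
    have "K * (L * g) + K' = L * (K * g) + sqrt K' * sqrt K'" using K by simp
    also have "\<dots> \<le> L * (K * g) + L * sqrt K'"
      using \<open>sqrt K' \<le> L\<close> \<open>0 \<le> sqrt K'\<close> by (intro add_left_mono mult_right_mono)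
    also have "\<dots> = L * (K * g + sqrt K')" by (simp add: algebra_simps)
    also have "\<dots> < L * L" using gt \<open>0 < L\<close> by (rule mult_strict_left_mono)
    finally show False using q by (simp add: power2_eq_square)
  qed
  then show ?thesis by (simp add: L_def g_def)
qed

subsection \<open>Membership in Hardy type spaces\<close>

lemma powr_add_le:
  fixes a b q :: real
  assumes "0 \<le> a" "0 \<le> b" "0 < q"
  shows "(a + b) powr q \<le> 2 powr q * (a powr q + b powr q)"
proof -
  have "(a + b) powr q \<le> (2 * max a b) powr q" using assms by (intro powr_mono2) auto
  also have "\<dots> = 2 powr q * max a b powr q" using assms by (simp add: powr_mult)
  also have "\<dots> \<le> 2 powr q * (a powr q + b powr q)" by (intro mult_left_mono) (auto simp: max_def)
  finally show ?thesis .
qed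

lemma continuous_on_circle_powr:
  assumes f: "continuous_on unit_disc f" and q: "0 < q" and r: "0 \<le> r" "r < 1"
  shows "continuous_on {0..2*pi} (\<lambda>\<theta>. cmod (f (rcis r \<theta>)) powr q)"
proof -
  have "continuous_on {0..2*pi} (\<lambda>\<theta>. f (rcis r \<theta>))"
    by (rule continuous_on_compose_rcis[OF f continuous_on_const continuous_on_id]) (use r in auto)
  then show ?thesis using q by (intro continuous_on_powr' continuous_intros) auto
qed

text \<open>For continuous functions measurability and existence of the means are automatic, and the
  root and the factor \<open>1 / (2 * pi)\<close> are monotone. What remains is a uniform bound on
  gauge integrals over circles.\<close>

lemma Hg_continuous_iff:
  assumes f: "continuous_on unit_disc f" and q: "0 < q"
  shows "f \<in> Hg q \<longleftrightarrow> (\<exists>B. \<forall>r. 0 \<le> r \<longrightarrow> r < 1 \<longrightarrow> integral {0..2*pi} (\<lambda>\<theta>. cmod (f (rcis r \<theta>)) powr q) \<le> B)"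
proof -
  define I where "I r = integral {0..2*pi} (\<lambda>\<theta>. cmod (f (rcis r \<theta>)) powr q)" for r
  note cont = continuous_on_circle_powr[OF f q]
  have M1: "M_exists q r f" if "0 \<le> r" "r < 1" for r
    unfolding M_exists_def
    by (intro absolutely_integrable_imp_integrable absolutely_integrable_continuous_real cont that) auto
  have Mr: "M q r f = (1 / (2 * pi) * I r) powr (1 / q)" if "0 \<le> r" "r < 1" for r
    using M1[OF that] unfolding M_def I_def M_exists_def by (subst lebesgue_integral_eq_integral) auto
  have I0: "0 \<le> I r" if "0 \<le> r" "r < 1" for r
    unfolding I_def by (intro integral_nonneg integrable_continuous_real cont that) auto
  have meas: "f \<in> borel_measurable (lebesgue_on unit_disc)"
    by (rule continuous_imp_measurable_on_sets_lebesgue[OF f]) auto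
  have "bdd_above ((\<lambda>r. M q r f) ` {0..<1}) \<longleftrightarrow> (\<exists>B. \<forall>r. 0 \<le> r \<longrightarrow> r < 1 \<longrightarrow> I r \<le> B)"
  proof
    assume "bdd_above ((\<lambda>r. M q r f) ` {0..<1})"
    then obtain m where m: "\<And>r. 0 \<le> r \<Longrightarrow> r < 1 \<Longrightarrow> M q r f \<le> m" by (force simp: bdd_above_def)
    have "I r \<le> 2 * pi * m powr q" if r: "0 \<le> r" "r < 1" for r
    proof -
      have "1 / (2 * pi) * I r = (M q r f) powr q"
        using I0[OF r] q unfolding Mr[OF r] by (simp add: powr_powr)
      also have "\<dots> \<le> m powr q" using m[OF r] q by (intro powr_mono2) (auto simp: M_def)
      finally show ?thesis by (simp add: field_simps)
    qed
    then show "\<exists>B. \<forall>r. 0 \<le> r \<longrightarrow> r < 1 \<longrightarrow> I r \<le> B" by blast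
  next
    assume "\<exists>B. \<forall>r. 0 \<le> r \<longrightarrow> r < 1 \<longrightarrow> I r \<le> B"
    then obtain B where B: "\<And>r. 0 \<le> r \<Longrightarrow> r < 1 \<Longrightarrow> I r \<le> B" by blast
    have *: "M q r f \<le> (1 / (2 * pi) * B) powr (1 / q)" if r: "0 \<le> r" "r < 1" for r
      unfolding Mr[OF r] using I0[OF r] B[OF r] q by (intro powr_mono2 mult_left_mono) auto
    show "bdd_above ((\<lambda>r. M q r f) ` {0..<1})" by (rule bdd_aboveI2, rule *) auto
  qed
  then show ?thesis unfolding Hg_def I_def using M1 meas by auto
qed

lemma C1_on_harmonic: "harmonic_on S f \<Longrightarrow> C1_on S f"
  by (simp add: harmonic_on_def C2_on_def)

lemma continuous_on_grad_norm_Re: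
  assumes f: "C1_on S f"
  shows "continuous_on S (grad_norm (\<lambda>w. Re (f w)))"
proof -
  have "continuous_on S (\<lambda>z. cmod (wirtinger_z f z + cnj (wirtinger_zbar f z)))"
    using f unfolding wirtinger_z_def wirtinger_zbar_def C1_on_def
    by (intro continuous_intros) auto
  then show ?thesis using f grad_norm_Re[of f] by (simp add: C1_on_def cong: continuous_on_cong)
qed

lemma harmonic_quasiregular_Hg:
  assumes K: "1 \<le> K" "0 \<le> K'" and p: "0 < p" "p < 1" and f: "harmonic_quasiregular K K' f"
    and u: "(\<lambda>z. complex_of_real (grad_norm (\<lambda>w. Re (f w)) z)) \<in> Hg p"
  shows "f \<in> Hg (p / (1 - p))"
proof -
  define q where "q = p / (1 - p)"
  have q: "0 < q" using p by (simp add: q_def)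
  have h: "harmonic_on unit_disc f" using f by (simp add: harmonic_quasiregular_def)
  have C: "C1_on unit_disc f" by (rule C1_on_harmonic[OF h])
  have cf: "continuous_on unit_disc f" using C by (simp add: C1_on_def)
  define g where "g = grad_norm (\<lambda>w. Re (f w))"
  have g0: "0 \<le> g z" for z by (simp add: g_def grad_norm_def)
  have cg: "continuous_on unit_disc (\<lambda>z. complex_of_real (g z))"
    unfolding g_def by (intro continuous_intros continuous_on_grad_norm_Re[OF C])
  obtain A where A: "\<And>r. 0 \<le> r \<Longrightarrow> r < 1 \<Longrightarrow> integral {0..2*pi} (\<lambda>\<theta>. g (rcis r \<theta>) powr p) \<le> A"
    using u g0 unfolding g_def[symmetric] Hg_continuous_iff[OF cg p(1)] by auto
  \<comment> \<open>Stated for any holomorphic \<open>G\<close> below \<open>Lambda f\<close>, as it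
    is applied to \<open>f_z\<close> and to the conjugate of \<open>f_zbar\<close>, whose moduli add
    up to \<open>Lambda f\<close>.\<close>
  have radial: "\<exists>B. \<forall>r. 0 \<le> r \<longrightarrow> r < 1 \<longrightarrow>
      integral {0..2*pi} (\<lambda>\<theta>. (integral {0..r} (\<lambda>x. cmod (G (rcis x \<theta>)))) powr q) \<le> B"
    if hol: "G holomorphic_on unit_disc" and le: "\<And>z. z \<in> unit_disc \<Longrightarrow> cmod (G z) \<le> Lambda f z" for G
  proof -
    have cG: "continuous_on unit_disc G" using hol by (rule holomorphic_on_imp_continuous_on)
    define D where "D = 2 powr p * (K powr p * A + 2 * pi * sqrt K' powr p)"
    have "integral {0..2*pi} (\<lambda>\<theta>. cmod (G (rcis r \<theta>)) powr p) \<le> D" if r: "0 \<le> r" "r < 1" for r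
    proof -
      have cg': "continuous_on {0..2*pi} (\<lambda>\<theta>. g (rcis r \<theta>) powr p)"
        using continuous_on_circle_powr[OF cg p(1) r] g0 by simp
      have "cmod (G (rcis r \<theta>)) powr p \<le> 2 powr p * (K powr p * g (rcis r \<theta>) powr p + sqrt K' powr p)" for \<theta>
      proof -
        have z: "rcis r \<theta> \<in> unit_disc" using r by simp
        have "cmod (G (rcis r \<theta>)) powr p \<le> (K * g (rcis r \<theta>) + sqrt K') powr p"
          using le[OF z] Lambda_le_grad_norm_Re[OF K f z] p unfolding g_def by (intro powr_mono2) auto
        also have "\<dots> \<le> 2 powr p * ((K * g (rcis r \<theta>)) powr p + sqrt K' powr p)"
          using K p g0 by (intro powr_add_le) auto
        finally show ?thesis using K g0 by (simp add: powr_mult)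
      qed
      then have "integral {0..2*pi} (\<lambda>\<theta>. cmod (G (rcis r \<theta>)) powr p)
          \<le> integral {0..2*pi} (\<lambda>\<theta>. 2 powr p * (K powr p * g (rcis r \<theta>) powr p + sqrt K' powr p))"
        by (intro integral_le integrable_continuous_real continuous_on_circle_powr[OF cG p(1) r]
            continuous_on_mult continuous_on_add continuous_on_const cg')
      also have "\<dots> = 2 powr p * (K powr p * integral {0..2*pi} (\<lambda>\<theta>. g (rcis r \<theta>) powr p) + 2 * pi * sqrt K' powr p)"
        by (subst integral_mult_right, subst integral_add)
           (auto intro!: integrable_continuous_real continuous_on_mult continuous_on_const cg')
      also have "\<dots> \<le> D" unfolding D_def
        by (intro mult_left_mono add_right_mono A r) auto
      finally show ?thesis .
    qed
    from Hardy_Littlewood_radial_integral[OF hol p this] show ?thesis unfolding q_def by blast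
  qed
  have rz: "wirtinger_z f holomorphic_on unit_disc" by (rule wirtinger_z_holomorphic[OF open_ball h])
  have rb: "(\<lambda>z. cnj (wirtinger_zbar f z)) holomorphic_on unit_disc"
    by (rule cnj_wirtinger_zbar_holomorphic[OF open_ball h])
  note cz = holomorphic_on_imp_continuous_on[OF rz] and cb = holomorphic_on_imp_continuous_on[OF rb]
  define P where "P r \<theta> = integral {0..r} (\<lambda>x. cmod (wirtinger_z f (rcis x \<theta>)))" for r \<theta>
  define Q where "Q r \<theta> = integral {0..r} (\<lambda>x. cmod (cnj (wirtinger_zbar f (rcis x \<theta>))))" for r \<theta>
  have "\<exists>B. \<forall>r. 0 \<le> r \<longrightarrow> r < 1 \<longrightarrow> integral {0..2*pi} (\<lambda>\<theta>. P r \<theta> powr q) \<le> B"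
    unfolding P_def by (rule radial[OF rz]) (simp add: Lambda_def)
  then obtain B1 where B1: "\<And>r. 0 \<le> r \<Longrightarrow> r < 1 \<Longrightarrow> integral {0..2*pi} (\<lambda>\<theta>. P r \<theta> powr q) \<le> B1" by blast
  have "\<exists>B. \<forall>r. 0 \<le> r \<longrightarrow> r < 1 \<longrightarrow> integral {0..2*pi} (\<lambda>\<theta>. Q r \<theta> powr q) \<le> B"
    unfolding Q_def by (rule radial[OF rb]) (simp add: Lambda_def)
  then obtain B2 where B2: "\<And>r. 0 \<le> r \<Longrightarrow> r < 1 \<Longrightarrow> integral {0..2*pi} (\<lambda>\<theta>. Q r \<theta> powr q) \<le> B2" by blast
  define c where "c = cmod (f 0) powr q"
  have "integral {0..2*pi} (\<lambda>\<theta>. cmod (f (rcis r \<theta>)) powr q)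
      \<le> 2 powr q * (2 * pi * c + 2 powr q * (B1 + B2))" if r: "0 \<le> r" "r < 1" for r
  proof -
    have ic: "continuous_on {0..r} (\<lambda>x. cmod (wirtinger_z f (rcis x \<theta>)))"
      "continuous_on {0..r} (\<lambda>x. cmod (cnj (wirtinger_zbar f (rcis x \<theta>))))" for \<theta>
      using r by (auto intro!: continuous_on_norm continuous_on_compose_rcis[OF cz continuous_on_id continuous_on_const]
          continuous_on_compose_rcis[OF cb continuous_on_id continuous_on_const] simp del: complex_mod_cnj)
    have P0: "0 \<le> P r \<theta>" and Q0: "0 \<le> Q r \<theta>" for \<theta>
      unfolding P_def Q_def by (intro integral_nonneg integrable_continuous_real ic; simp)+
    have cP: "continuous_on {0..2*pi} (\<lambda>\<theta>. P r \<theta> powr q)"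
      using continuous_on_radial_integral[OF cz r, of "{0..2*pi}"] q P0 unfolding P_def
      by (intro continuous_on_powr' continuous_on_const) auto
    have cQ: "continuous_on {0..2*pi} (\<lambda>\<theta>. Q r \<theta> powr q)"
      using continuous_on_radial_integral[OF cb r, of "{0..2*pi}"] q Q0 unfolding Q_def
      by (intro continuous_on_powr' continuous_on_const) auto
    have "cmod (f (rcis r \<theta>)) powr q \<le> 2 powr q * (c + 2 powr q * (P r \<theta> powr q + Q r \<theta> powr q))" for \<theta>
    proof -
      have "cmod (f (rcis r \<theta>)) \<le> cmod (f 0) + cmod (f (rcis r \<theta>) - f 0)"
        using norm_triangle_ineq[of "f 0" "f (rcis r \<theta>) - f 0"] by simp
      also have "cmod (f (rcis r \<theta>) - f 0) \<le> integral {0..r} (\<lambda>x. Lambda f (rcis x \<theta>))"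
        by (rule cmod_diff_le_radial_integral[OF C r])
      also have "integral {0..r} (\<lambda>x. Lambda f (rcis x \<theta>)) = P r \<theta> + Q r \<theta>"
        unfolding P_def Q_def Lambda_def complex_mod_cnj
        using ic by (intro integral_add integrable_continuous_real) (simp_all only: complex_mod_cnj)
      finally have "cmod (f (rcis r \<theta>)) powr q \<le> (cmod (f 0) + (P r \<theta> + Q r \<theta>)) powr q"
        using q by (intro powr_mono2) auto
      also have "\<dots> \<le> 2 powr q * (c + (P r \<theta> + Q r \<theta>) powr q)"
        unfolding c_def using P0[of \<theta>] Q0[of \<theta>] q by (intro powr_add_le) auto
      also have "\<dots> \<le> 2 powr q * (c + 2 powr q * (P r \<theta> powr q + Q r \<theta> powr q))"
        by (intro mult_left_mono add_left_mono powr_add_le P0 Q0 q) auto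
      finally show ?thesis .
    qed
    then have "integral {0..2*pi} (\<lambda>\<theta>. cmod (f (rcis r \<theta>)) powr q)
        \<le> integral {0..2*pi} (\<lambda>\<theta>. 2 powr q * (c + 2 powr q * (P r \<theta> powr q + Q r \<theta> powr q)))"
      by (intro integral_le integrable_continuous_real continuous_on_circle_powr[OF cf q r]
            continuous_on_mult continuous_on_add continuous_on_const cP cQ)
    also have "\<dots> = 2 powr q * (2 * pi * c + 2 powr q *
        (integral {0..2*pi} (\<lambda>\<theta>. P r \<theta> powr q) + integral {0..2*pi} (\<lambda>\<theta>. Q r \<theta> powr q)))"
    proof -
      have "(\<lambda>\<theta>. P r \<theta> powr q) integrable_on {0..2*pi}" "(\<lambda>\<theta>. Q r \<theta> powr q) integrable_on {0..2*pi}"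
        by (intro integrable_continuous_real cP cQ)+
      moreover have "((\<lambda>_. c) has_integral 2 * pi * c) {0..2*pi}"
        using has_integral_const_real[of c 0 "2 * pi"] by simp
      ultimately have "((\<lambda>\<theta>. 2 powr q * (c + 2 powr q * (P r \<theta> powr q + Q r \<theta> powr q))) has_integral
        2 powr q * (2 * pi * c + 2 powr q *
        (integral {0..2*pi} (\<lambda>\<theta>. P r \<theta> powr q) + integral {0..2*pi} (\<lambda>\<theta>. Q r \<theta> powr q)))) {0..2*pi}"
        by (intro has_integral_mult_right has_integral_add integrable_integral)
      then show ?thesis by (rule integral_unique)
    qed
    also have "\<dots> \<le> 2 powr q * (2 * pi * c + 2 powr q * (B1 + B2))"
      by (intro mult_left_mono add_left_mono add_mono B1 B2 r) auto
    finally show ?thesis .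
  qed
  then show ?thesis unfolding q_def[symmetric] Hg_continuous_iff[OF cf q] by blast
qed

lemma h_space_Im:
  assumes q: "0 < q" and f: "f \<in> Hg q" "harmonic_on unit_disc f"
  shows "(\<lambda>z. complex_of_real (Im (f z))) \<in> h_space q"
proof -
  define v where "v z = complex_of_real (Im (f z))" for z
  have "bounded_linear (\<lambda>w. complex_of_real (Im w))"
    by (rule bounded_linear_compose[OF bounded_linear_of_real bounded_linear_Im])
  then have hv: "harmonic_on unit_disc v"
    unfolding v_def by (rule harmonic_on_bounded_linear[OF open_ball _ f(2)])
  have cf: "continuous_on unit_disc f" and cv: "continuous_on unit_disc v"
    using C1_on_harmonic[OF f(2)] C1_on_harmonic[OF hv] by (simp_all add: C1_on_def)
  obtain B where B: "\<And>r. 0 \<le> r \<Longrightarrow> r < 1 \<Longrightarrow> integral {0..2*pi} (\<lambda>\<theta>. cmod (f (rcis r \<theta>)) powr q) \<le> B"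
    using f(1) unfolding Hg_continuous_iff[OF cf q] by blast
  have "integral {0..2*pi} (\<lambda>\<theta>. cmod (v (rcis r \<theta>)) powr q) \<le> B" if r: "0 \<le> r" "r < 1" for r
  proof -
    have "integral {0..2*pi} (\<lambda>\<theta>. cmod (v (rcis r \<theta>)) powr q) \<le> integral {0..2*pi} (\<lambda>\<theta>. cmod (f (rcis r \<theta>)) powr q)"
      using q by (intro integral_le integrable_continuous_real continuous_on_circle_powr cf cv r powr_mono2)
        (auto simp: v_def abs_Im_le_cmod)
    also have "\<dots> \<le> B" by (rule B[OF r])
    finally show ?thesis .
  qed
  then have "v \<in> Hg q" unfolding Hg_continuous_iff[OF cv q] by blast
  then show ?thesis using hv by (simp add: h_space_def v_def[abs_def])
qed

subsection \<open>Holomorphic functions as harmonic quasiregular mappings\<close>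

lemma holomorphic_partials:
  assumes F: "F holomorphic_on S" and S: "open S" "z \<in> S"
  shows "has_partials_at F z" "pdx F z = deriv F z" "pdy F z = \<i> * deriv F z"
proof -
  have D: "(F has_field_derivative deriv F z) (at z)" by (rule holomorphic_derivI[OF F S])
  have "((\<lambda>t. z + of_real t) has_vector_derivative 1) (at (0::real))"
    by (auto intro!: derivative_eq_intros)
  from field_vector_diff_chain_at[OF this] D
  have 1: "((\<lambda>t. F (z + of_real t)) has_vector_derivative deriv F z) (at 0)" by (simp add: o_def)
  have "((\<lambda>t. z + \<i> * of_real t) has_vector_derivative \<i>) (at (0::real))"
    by (auto intro!: derivative_eq_intros)
  from field_vector_diff_chain_at[OF this] D
  have 2: "((\<lambda>t. F (z + \<i> * of_real t)) has_vector_derivative \<i> * deriv F z) (at 0)" by (simp add: o_def)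
  show "has_partials_at F z" "pdx F z = deriv F z" "pdy F z = \<i> * deriv F z"
    using partials_eqI[OF 1 2] by blast+
qed

lemma holomorphic_C1_on:
  assumes F: "F holomorphic_on S" and S: "open S"
  shows "C1_on S F"
proof -
  note p = holomorphic_partials[OF F S]
  have "continuous_on S (deriv F)" by (intro holomorphic_on_imp_continuous_on holomorphic_deriv F S)
  then have "continuous_on S (deriv F)" "continuous_on S (\<lambda>z. \<i> * deriv F z)"
    by (auto intro: continuous_intros)
  then show ?thesis unfolding C1_on_def using p holomorphic_on_imp_continuous_on[OF F]
    by (simp cong: continuous_on_cong)
qed

lemma holomorphic_harmonic_on:
  assumes F: "F holomorphic_on S" and S: "open S"
  shows "harmonic_on S F"
proof -
  note p = holomorphic_partials[OF F S]
  have d: "deriv F holomorphic_on S" "(\<lambda>z. \<i> * deriv F z) holomorphic_on S"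
    using holomorphic_deriv[OF F S] by (auto intro: holomorphic_intros)
  have x: "pdx F holomorphic_on S" by (rule holomorphic_transform[OF d(1)]) (simp add: p)
  have y: "pdy F holomorphic_on S" by (rule holomorphic_transform[OF d(2)]) (simp add: p)
  have "pdx (pdx F) z + pdy (pdy F) z = 0" if z: "z \<in> S" for z
  proof -
    note pd = holomorphic_partials[OF d(1) S z]
    have "pdx (pdx F) z = deriv (deriv F) z"
      using partials_cong(2)[OF S z _ pd(1), of "pdx F"] pd(2) p(2) by simp
    moreover have "pdy (\<lambda>z. \<i> * deriv F z) z = \<i> * (\<i> * deriv (deriv F) z)"
      using partials_bounded_linear(3)[OF bounded_linear_mult_right pd(1)] pd(3) by simp
    then have "pdy (pdy F) z = \<i> * (\<i> * deriv (deriv F) z)"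
      using partials_cong(3)[OF S z _ holomorphic_partials(1)[OF d(2) S z], of "pdy F"] p(3) by simp
    ultimately show ?thesis by (simp add: mult.assoc[symmetric])
  qed
  then show ?thesis unfolding harmonic_on_def C2_on_def
    using holomorphic_C1_on[OF F S] holomorphic_C1_on[OF x S] holomorphic_C1_on[OF y S] by blast
qed

section \<open>Continuously differentiable functions are absolutely continuous on lines\<close>

lemma Lipschitz_abs_continuous_Icc:
  assumes L: "\<And>s t. a \<le> s \<Longrightarrow> s \<le> t \<Longrightarrow> t \<le> b \<Longrightarrow> cmod (g t - g s) \<le> L * (t - s)"
  shows "abs_continuous_Icc a b g"
  unfolding abs_continuous_Icc_def
proof (intro allI impI)
  fix \<epsilon> :: real assume \<epsilon>: "0 < \<epsilon>"
  define \<delta> where "\<delta> = \<epsilon> / (\<bar>L\<bar> + 1)"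
  have \<delta>: "0 < \<delta>" using \<epsilon> by (simp add: \<delta>_def)
  have main: "(\<Sum>i<n. cmod (g (t i) - g (s i))) < \<epsilon>"
    if st: "\<forall>i<n. a \<le> s i \<and> s i \<le> t i \<and> t i \<le> b" and sm: "(\<Sum>i<n. t i - s i) < \<delta>" for n :: nat and s t
  proof -
    have "(\<Sum>i<n. cmod (g (t i) - g (s i))) \<le> (\<Sum>i<n. \<bar>L\<bar> * (t i - s i))"
    proof (rule sum_mono)
      fix i assume "i \<in> {..<n}"
      then have i: "a \<le> s i" "s i \<le> t i" "t i \<le> b" using st by auto
      have "L * (t i - s i) \<le> \<bar>L\<bar> * (t i - s i)" using i by (intro mult_right_mono) auto
      with L[OF i] show "cmod (g (t i) - g (s i)) \<le> \<bar>L\<bar> * (t i - s i)" by simp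
    qed
    also have "\<dots> = \<bar>L\<bar> * (\<Sum>i<n. t i - s i)" by (simp add: sum_distrib_left)
    also have "\<dots> \<le> \<bar>L\<bar> * \<delta>" using sm by (intro mult_left_mono) auto
    also have "\<dots> < (\<bar>L\<bar> + 1) * \<delta>" using \<delta> by simp
    also have "\<dots> = \<epsilon>" by (simp add: \<delta>_def)
    finally show ?thesis .
  qed
  show "\<exists>\<delta>>0. \<forall>(n::nat) s t. (\<forall>i<n. a \<le> s i \<and> s i \<le> t i \<and> t i \<le> b) \<and>
      disjoint_family_on (\<lambda>i. {s i<..<t i}) {..<n} \<and> (\<Sum>i<n. t i - s i) < \<delta> \<longrightarrow>
      (\<Sum>i<n. cmod (g (t i) - g (s i))) < \<epsilon>"
  proof (intro exI[of _ \<delta>] conjI[OF \<delta>] allI impI)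
    fix n :: nat and s t :: "nat \<Rightarrow> real"
    assume "(\<forall>i<n. a \<le> s i \<and> s i \<le> t i \<and> t i \<le> b) \<and>
      disjoint_family_on (\<lambda>i. {s i<..<t i}) {..<n} \<and> (\<Sum>i<n. t i - s i) < \<delta>"
    then show "(\<Sum>i<n. cmod (g (t i) - g (s i))) < \<epsilon>" by (elim conjE) (rule main)
  qed
qed

lemma abs_continuous_Icc_C1:
  assumes d: "\<And>t. t \<in> {a..b} \<Longrightarrow> (g has_vector_derivative g' t) (at t)"
    and B: "\<And>t. t \<in> {a..b} \<Longrightarrow> cmod (g' t) \<le> B"
  shows "abs_continuous_Icc a b g"
proof (rule Lipschitz_abs_continuous_Icc)
  fix s t assume st: "a \<le> s" "s \<le> t" "t \<le> b"
  have "norm (g t - g s) \<le> B * norm (t - s)"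
  proof (rule differentiable_bound[of "{a..b}"])
    show "(g has_derivative (\<lambda>h. h *\<^sub>R g' x)) (at x within {a..b})" if "x \<in> {a..b}" for x
      using d[OF that] unfolding has_vector_derivative_def by (rule has_derivative_at_withinI)
    show "onorm (\<lambda>h. h *\<^sub>R g' x) \<le> B" if "x \<in> {a..b}" for x
    proof (rule onorm_bound)
      show "norm (h *\<^sub>R g' x) \<le> B * norm h" for h
      proof -
        have "\<bar>h\<bar> * cmod (g' x) \<le> \<bar>h\<bar> * B" by (intro mult_left_mono B that) auto
        then show ?thesis by (simp only: norm_scaleR real_norm_def mult.commute[of B])
      qed
      show "0 \<le> B" using order_trans[OF norm_ge_zero B[OF that]] .
    qed
  qed (use st in auto)
  then show "cmod (g t - g s) \<le> B * (t - s)" using st by simp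
qed

lemma locally_L2_on_continuous:
  assumes g: "continuous_on S g"
  shows "locally_L2_on S g"
  unfolding locally_L2_on_def
proof (intro allI impI)
  fix C assume C: "compact C \<and> C \<subseteq> S"
  then have gC: "continuous_on C g" using g continuous_on_subset by blast
  have Cl: "C \<in> lmeasurable" using C by (simp add: lmeasurable_compact)
  then have Cm: "C \<in> sets lebesgue" by (rule fmeasurableD)
  have m: "g \<in> borel_measurable (lebesgue_on C)"
    by (rule continuous_imp_measurable_on_sets_lebesgue[OF gC Cm])
  have "compact (g ` C)" using C gC by (auto intro: compact_continuous_image)
  then have "\<exists>B. \<forall>z\<in>C. cmod (g z) \<le> B"
    by (auto dest!: compact_imp_bounded simp: bounded_iff)
  then obtain B where B: "\<And>z. z \<in> C \<Longrightarrow> cmod (g z) \<le> B" by blast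
  interpret finite_measure "lebesgue_on C" by (rule finite_measure_lebesgue_on[OF Cl])
  have "integrable (lebesgue_on C) (\<lambda>z. (cmod (g z))\<^sup>2)"
  proof (rule integrable_const_bound[of _ "B\<^sup>2"])
    show "AE z in lebesgue_on C. norm ((cmod (g z))\<^sup>2) \<le> B\<^sup>2"
      using B by (intro AE_I2) (auto simp: space_restrict_space intro!: power_mono)
  qed (use m in measurable)
  with m show "g \<in> borel_measurable (lebesgue_on C) \<and> integrable (lebesgue_on C) (\<lambda>z. (cmod (g z))\<^sup>2)"
    by blast
qed

text \<open>Partials are bounded on a compact rectangle, so \<open>f\<close> is Lipschitz, hence
  absolutely continuous, on every line segment of it and not just on almost every one.\<close>

lemma C1_on_ACL2_on:
  assumes f: "C1_on S f"
  shows "ACL2_on S f"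
proof -
  have fp: "has_partials_at f z" if "z \<in> S" for z using f that by (simp add: C1_on_def)
  have c: "continuous_on S f" "continuous_on S (pdx f)" "continuous_on S (pdy f)"
    using f by (simp_all add: C1_on_def)
  have main: "(AE y in lebesgue_on {c..d}. abs_continuous_Icc a b (\<lambda>x. f (Complex x y))) \<and>
        (AE x in lebesgue_on {a..b}. abs_continuous_Icc c d (\<lambda>y. f (Complex x y)))"
    if Q: "cbox (Complex a c) (Complex b d) \<subseteq> S" for a b c d
  proof -
    have in_S: "Complex x y \<in> S" if "x \<in> {a..b}" "y \<in> {c..d}" for x y
      using that Q by (auto simp: in_cbox_complex_iff)
    have bound: "\<exists>B. \<forall>z\<in>cbox (Complex a c) (Complex b d). cmod (h z) \<le> B" if "continuous_on S h" for h :: "complex \<Rightarrow> complex"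
    proof -
      have "compact (h ` cbox (Complex a c) (Complex b d))"
        using continuous_on_subset[OF that Q] by (intro compact_continuous_image compact_cbox)
      then show ?thesis by (auto dest!: compact_imp_bounded simp: bounded_iff)
    qed
    obtain B1 where B1: "\<And>z. z \<in> cbox (Complex a c) (Complex b d) \<Longrightarrow> cmod (pdx f z) \<le> B1"
      using bound[OF c(2)] by blast
    obtain B2 where B2: "\<And>z. z \<in> cbox (Complex a c) (Complex b d) \<Longrightarrow> cmod (pdy f z) \<le> B2"
      using bound[OF c(3)] by blast
    have "abs_continuous_Icc a b (\<lambda>x. f (Complex x y))" if y: "y \<in> {c..d}" for y
    proof (rule abs_continuous_Icc_C1)
      fix x assume x: "x \<in> {a..b}"
      have eq: "Complex 0 y + of_real x = Complex x y" for x by (simp add: complex_eq_iff)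
      show "((\<lambda>x. f (Complex x y)) has_vector_derivative pdx f (Complex x y)) (at x)"
        using has_vector_derivative_pdx[of f "Complex 0 y" x] fp[OF in_S[OF x y]] unfolding eq by simp
      show "cmod (pdx f (Complex x y)) \<le> B1" using x y by (intro B1) (auto simp: in_cbox_complex_iff)
    qed
    moreover have "abs_continuous_Icc c d (\<lambda>y. f (Complex x y))" if x: "x \<in> {a..b}" for x
    proof (rule abs_continuous_Icc_C1)
      fix y assume y: "y \<in> {c..d}"
      have eq: "Complex x 0 + \<i> * of_real y = Complex x y" for y by (simp add: complex_eq_iff)
      show "((\<lambda>y. f (Complex x y)) has_vector_derivative pdy f (Complex x y)) (at y)"
        using has_vector_derivative_pdy[of f "Complex x 0" y] fp[OF in_S[OF x y]] unfolding eq by simp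
      show "cmod (pdy f (Complex x y)) \<le> B2" using x y by (intro B2) (auto simp: in_cbox_complex_iff)
    qed
    ultimately show ?thesis by (intro conjI AE_I2) (auto simp: space_restrict_space)
  qed
  have "ACL_on S f" unfolding ACL_on_def
    by (rule conjI[OF c(1)], intro allI impI main, elim conjE)
  then show ?thesis unfolding ACL2_on_def using c locally_L2_on_continuous by blast
qed

text \<open>With \<open>f_zbar = 0\<close> both the square of \<open>Lambda\<close> and the Jacobian
  equal \<open>|F'|^2\<close>, so the condition holds with constant 1. One holomorphic example thus
  serves every admissible \<open>K\<close> and \<open>K'\<close>.\<close>

lemma holomorphic_harmonic_quasiregular:
  assumes F: "F holomorphic_on unit_disc" and K: "1 \<le> K" "0 \<le> K'"
  shows "harmonic_quasiregular K K' F"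
proof -
  note p = holomorphic_partials[OF F open_ball]
  have w: "wirtinger_z F z = deriv F z" "wirtinger_zbar F z = 0" if "z \<in> unit_disc" for z
    using p[OF that] by (simp_all add: wirtinger_z_def wirtinger_zbar_def mult.assoc[symmetric])
  have "Jacobian F z \<ge> 0 \<and> (Lambda F z)\<^sup>2 \<le> K * Jacobian F z + K'" if "z \<in> unit_disc" for z
  proof -
    have "1 * (cmod (deriv F z))\<^sup>2 \<le> K * (cmod (deriv F z))\<^sup>2" using K by (intro mult_right_mono) auto
    then show ?thesis using K w[OF that] by (simp add: Jacobian_def Lambda_def)
  qed
  then have "AE z in lebesgue_on unit_disc. Jacobian F z \<ge> 0"
      "AE z in lebesgue_on unit_disc. (Lambda F z)\<^sup>2 \<le> K * Jacobian F z + K'"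
    by (auto intro!: AE_I2 simp: space_restrict_space)
  then show ?thesis unfolding harmonic_quasiregular_def quasiregular_def
    using holomorphic_harmonic_on[OF F open_ball] C1_on_ACL2_on[OF holomorphic_C1_on[OF F open_ball]] by blast
qed

lemma grad_norm_Re_holomorphic:
  assumes F: "F holomorphic_on unit_disc" and z: "z \<in> unit_disc"
  shows "grad_norm (\<lambda>w. Re (F w)) z = cmod (deriv F z)"
  using grad_norm_Re[OF holomorphic_partials(1)[OF F open_ball z]] holomorphic_partials[OF F open_ball z]
  by (simp add: wirtinger_z_def wirtinger_zbar_def mult.assoc[symmetric])

subsection \<open>Sharpness of the index\<close>

text \<open>The chord \<open>|1 - e^(i \<theta>)| = 2 |sin (\<theta> / 2)|\<close> is at most
  \<open>|1 - r e^(i \<theta>)| + (1 - r)\<close>, and the second term is at most the first.\<close>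

lemma half_angle_le_cmod_one_minus_rcis:
  assumes r: "0 \<le> r" "r < 1"
  shows "\<bar>sin (\<theta> / 2)\<bar> \<le> cmod (1 - rcis r \<theta>)"
proof -
  have "cmod (1 - cis \<theta>) = 2 * \<bar>sin (\<theta> / 2)\<bar>"
    using dist_exp_i_1[of \<theta>] by (simp add: cis_conv_exp norm_minus_commute)
  moreover have "1 - cis \<theta> = (1 - rcis r \<theta>) - of_real (1 - r) * cis \<theta>"
    by (simp add: rcis_def algebra_simps)
  then have "cmod (1 - cis \<theta>) \<le> cmod (1 - rcis r \<theta>) + cmod (of_real (1 - r) * cis \<theta>)"
    using norm_triangle_ineq4 by metis
  moreover have "cmod (of_real (1 - r) * cis \<theta>) = 1 - r"
    using r by (simp add: norm_mult del: of_real_diff)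
  ultimately show ?thesis using cmod_one_minus_rcis_ge[OF r(1), of \<theta>] by linarith
qed

text \<open>The Taylor remainder \<open>x^3 / 6\<close> is at most \<open>2 * x / 3\<close> since
  \<open>x \<le> 2\<close>. A crude form of Jordan's inequality suffices.\<close>

lemma sin_ge_third:
  fixes x :: real
  assumes "0 \<le> x" "x \<le> pi / 2"
  shows "x / 3 \<le> sin x"
proof -
  have x2: "x \<le> 2" using assms pi_less_4 by linarith
  have "\<bar>sin x - (\<Sum>m<3. sin_coeff m * x ^ m)\<bar> \<le> inverse (fact 3) * \<bar>x\<bar> ^ 3"
    by (rule Maclaurin_sin_bound)
  moreover have "(\<Sum>m<3. sin_coeff m * x ^ m) = x"
    by (simp add: eval_nat_numeral sin_coeff_def)
  moreover have "inverse (fact 3) * \<bar>x\<bar> ^ 3 \<le> (2 / 3) * x"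
  proof -
    have "x * x \<le> 2 * 2" using assms(1) x2 by (intro mult_mono) auto
    then have "(x * x) * x \<le> 4 * x" using assms(1) by (intro mult_right_mono) auto
    then show ?thesis using assms(1) by (simp add: eval_nat_numeral power3_eq_cube)
  qed
  ultimately show ?thesis by linarith
qed

lemma arc_le_cmod_one_minus_rcis:
  assumes r: "0 \<le> r" "r < 1" and \<theta>: "\<theta> \<in> {0..2*pi}"
  shows "min \<theta> (2 * pi - \<theta>) / 6 \<le> cmod (1 - rcis r \<theta>)"
proof -
  have "min \<theta> (2 * pi - \<theta>) / 6 \<le> sin (\<theta> / 2)"
  proof (cases "\<theta> \<le> pi")
    case True
    then show ?thesis using sin_ge_third[of "\<theta> / 2"] \<theta> by (simp add: min_def)
  next
    case False
    have "sin (\<theta> / 2) = sin (pi - \<theta> / 2)" by simp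
    then show ?thesis using False sin_ge_third[of "pi - \<theta> / 2"] \<theta> by (simp add: min_def field_simps)
  qed
  with half_angle_le_cmod_one_minus_rcis[OF r, of \<theta>] show ?thesis by linarith
qed

lemma has_integral_powr_affine:
  fixes b c k \<beta> :: real
  assumes k: "k \<noteq> 0" and \<beta>: "\<beta> < 1" and b: "0 \<le> b" and pos: "\<And>x. x \<in> {0..b} \<Longrightarrow> 0 < c + k * x"
  shows "((\<lambda>x. (c + k * x) powr (- \<beta>)) has_integral
           ((c + k * b) powr (1 - \<beta>) - c powr (1 - \<beta>)) / (k * (1 - \<beta>))) {0..b}"
proof -
  have "((\<lambda>x. (c + k * x) powr (- \<beta>)) has_integral
      (c + k * b) powr (1 - \<beta>) / (k * (1 - \<beta>)) - (c + k * 0) powr (1 - \<beta>) / (k * (1 - \<beta>))) {0..b}"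
  proof (rule fundamental_theorem_of_calculus[OF b])
    fix x assume x: "x \<in> {0..b}"
    have "((\<lambda>z. z powr (1 - \<beta>)) has_real_derivative (1 - \<beta>) * (c + k * x) powr (1 - \<beta> - 1)) (at (c + k * x))"
      by (rule has_real_derivative_powr[OF pos[OF x]])
    moreover have "((\<lambda>x. c + k * x) has_real_derivative k) (at x within {0..b})"
      by (auto intro!: derivative_eq_intros)
    ultimately have "((\<lambda>x. (c + k * x) powr (1 - \<beta>) / (k * (1 - \<beta>))) has_real_derivative
        (1 - \<beta>) * (c + k * x) powr (1 - \<beta> - 1) * k / (k * (1 - \<beta>))) (at x within {0..b})"
      by (intro DERIV_cdivide[OF DERIV_chain2])
    moreover have "(1 - \<beta>) * (c + k * x) powr (1 - \<beta> - 1) * k / (k * (1 - \<beta>)) = (c + k * x) powr (- \<beta>)"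
      using k \<beta> by simp
    ultimately show "((\<lambda>x. (c + k * x) powr (1 - \<beta>) / (k * (1 - \<beta>))) has_vector_derivative
        (c + k * x) powr (- \<beta>)) (at x within {0..b})"
      unfolding has_real_derivative_iff_has_vector_derivative by (simp only:)
  qed
  then show ?thesis by (simp add: diff_divide_distrib)
qed

lemma continuous_on_cmod_one_minus_rcis_powr:
  assumes r: "0 \<le> r" "r < 1"
  shows "continuous_on S (\<lambda>\<theta>. cmod (1 - rcis r \<theta>) powr \<beta>)"
  using one_minus_rcis_nonzero[OF r]
  by (intro continuous_on_powr continuous_on_norm continuous_on_diff continuous_on_rcis
      continuous_on_const continuous_on_id) auto

text \<open>The gap \<open>1 - r\<close> and a sixth of the arc to the point 1 both lie below
  \<open>|1 - r e^(i \<theta>)|\<close>; their average is a minimum of two affine functions that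
  stay positive on the whole interval. A negative power of a minimum is at most the sum of the
  powers, and \<open>\<beta> < 1\<close> keeps the integrals bounded as the gap closes.\<close>

lemma integral_cmod_one_minus_rcis_powr_bounded:
  assumes \<beta>: "0 < \<beta>" "\<beta> < 1"
  obtains B where "\<And>r. 0 \<le> r \<Longrightarrow> r < 1 \<Longrightarrow> integral {0..2*pi} (\<lambda>\<theta>. cmod (1 - rcis r \<theta>) powr (- \<beta>)) \<le> B"
proof
  fix r :: real assume r: "0 \<le> r" "r < 1"
  define c where "c = (1 - r) / 2"
  \<comment> \<open>\<open>d - \<theta> / 12\<close> is the reflection of
    \<open>c + \<theta> / 12\<close> under exchange of \<open>\<theta>\<close> and
    \<open>2 * pi - \<theta>\<close>.\<close>
  define d where "d = (1 - r) / 2 + pi / 6"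
  have c: "0 < c" "c \<le> 1" using r by (auto simp: c_def)
  have d: "d = c + pi / 6" by (simp add: c_def d_def)
  have pos1: "0 < c + (1 / 12) * x" if "x \<in> {0..2*pi}" for x using that c by (intro add_pos_nonneg) auto
  have pos2: "0 < d + (- 1 / 12) * x" if "x \<in> {0..2*pi}" for x using that c unfolding d by simp
  \<comment> \<open>12 is the reciprocal of the slope, and 3 dominates the largest base
    \<open>c + pi / 6\<close>, because \<open>c \<le> 1\<close> and \<open>pi < 4\<close>.\<close>
  define C where "C = 12 * 3 powr (1 - \<beta>) / (1 - \<beta>)"
  have bd: "x powr (1 - \<beta>) - y powr (1 - \<beta>) \<le> 3 powr (1 - \<beta>)" if "0 \<le> x" "x \<le> 3" for x y :: real
    using powr_mono2[of "1 - \<beta>" x 3] powr_ge_zero[of y "1 - \<beta>"] that \<beta> by linarith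
  have i1: "((\<lambda>x. (c + (1 / 12) * x) powr (- \<beta>)) has_integral
      ((c + (1 / 12) * (2 * pi)) powr (1 - \<beta>) - c powr (1 - \<beta>)) / ((1 / 12) * (1 - \<beta>))) {0..2*pi}"
    by (rule has_integral_powr_affine) (use \<beta> pos1 in auto)
  have i2: "((\<lambda>x. (d + (- 1 / 12) * x) powr (- \<beta>)) has_integral
      ((d + (- 1 / 12) * (2 * pi)) powr (1 - \<beta>) - d powr (1 - \<beta>)) / ((- 1 / 12) * (1 - \<beta>))) {0..2*pi}"
    by (rule has_integral_powr_affine) (use \<beta> pos2 in auto)
  have e1: "((c + (1 / 12) * (2 * pi)) powr (1 - \<beta>) - c powr (1 - \<beta>)) / ((1 / 12) * (1 - \<beta>)) \<le> C"
  proof -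
    have "12 * ((c + (1 / 12) * (2 * pi)) powr (1 - \<beta>) - c powr (1 - \<beta>)) / (1 - \<beta>) \<le> C"
      unfolding C_def using c pi_less_4 \<beta> by (intro divide_right_mono mult_left_mono bd) auto
    moreover have "(x - y) / ((1 / 12) * (1 - \<beta>)) = 12 * (x - y) / (1 - \<beta>)" for x y :: real
      using \<beta> by (simp add: field_simps)
    ultimately show ?thesis by (simp only:)
  qed
  have e2: "((d + (- 1 / 12) * (2 * pi)) powr (1 - \<beta>) - d powr (1 - \<beta>)) / ((- 1 / 12) * (1 - \<beta>)) \<le> C"
  proof -
    have "12 * (d powr (1 - \<beta>) - (d + (- 1 / 12) * (2 * pi)) powr (1 - \<beta>)) / (1 - \<beta>) \<le> C"
      unfolding C_def using c pi_less_4 \<beta> unfolding d by (intro divide_right_mono mult_left_mono bd) auto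
    moreover have "(x - y) / ((- 1 / 12) * (1 - \<beta>)) = 12 * (y - x) / (1 - \<beta>)" for x y :: real
      using \<beta> by (simp add: field_simps)
    ultimately show ?thesis by (simp only:)
  qed
  have "integral {0..2*pi} (\<lambda>\<theta>. cmod (1 - rcis r \<theta>) powr (- \<beta>))
      \<le> integral {0..2*pi} (\<lambda>\<theta>. (c + (1 / 12) * \<theta>) powr (- \<beta>) + (d + (- 1 / 12) * \<theta>) powr (- \<beta>))"
  proof (rule integral_le)
    show "(\<lambda>\<theta>. cmod (1 - rcis r \<theta>) powr (- \<beta>)) integrable_on {0..2*pi}"
      by (intro integrable_continuous_real continuous_on_cmod_one_minus_rcis_powr r)
    show "(\<lambda>\<theta>. (c + (1 / 12) * \<theta>) powr (- \<beta>) + (d + (- 1 / 12) * \<theta>) powr (- \<beta>)) integrable_on {0..2*pi}"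
      using i1 i2 by (intro integrable_add) (auto simp: integrable_on_def)
    fix \<theta> assume \<theta>: "\<theta> \<in> {0..2*pi}"
    have m: "min (c + (1 / 12) * \<theta>) (d + (- 1 / 12) * \<theta>) \<le> cmod (1 - rcis r \<theta>)"
      using arc_le_cmod_one_minus_rcis[OF r \<theta>] cmod_one_minus_rcis_ge[OF r(1), of \<theta>]
      unfolding d c_def by (simp add: min_def field_simps split: if_splits)
    show "cmod (1 - rcis r \<theta>) powr (- \<beta>) \<le> (c + (1 / 12) * \<theta>) powr (- \<beta>) + (d + (- 1 / 12) * \<theta>) powr (- \<beta>)"
    proof (cases "c + (1 / 12) * \<theta> \<le> cmod (1 - rcis r \<theta>)")
      case True
      then have "cmod (1 - rcis r \<theta>) powr (- \<beta>) \<le> (c + (1 / 12) * \<theta>) powr (- \<beta>)"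
        using pos1[OF \<theta>] \<beta> by (intro powr_mono2') auto
      then show ?thesis by (rule order_trans) simp
    next
      case False
      then have "d + (- 1 / 12) * \<theta> \<le> cmod (1 - rcis r \<theta>)" using m unfolding min_le_iff_disj by blast
      then have "cmod (1 - rcis r \<theta>) powr (- \<beta>) \<le> (d + (- 1 / 12) * \<theta>) powr (- \<beta>)"
        using pos2[OF \<theta>] \<beta> by (intro powr_mono2') auto
      then show ?thesis by (rule order_trans) simp
    qed
  qed
  also have "\<dots> \<le> C + C"
    unfolding integral_unique[OF has_integral_add[OF i1 i2]] by (intro add_mono e1 e2)
  finally show "integral {0..2*pi} (\<lambda>\<theta>. cmod (1 - rcis r \<theta>) powr (- \<beta>)) \<le>
      12 * 3 powr (1 - \<beta>) / (1 - \<beta>) + 12 * 3 powr (1 - \<beta>) / (1 - \<beta>)" unfolding C_def .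
qed

text \<open>Near the point 1, \<open>|1 - r e^(i \<theta>)| \<le> (1 - r) + \<theta>\<close>, so the
  part over \<open>[0, 1]\<close> alone is at least \<open>ln ((2 - r) / (1 - r))\<close>.\<close>

lemma integral_inverse_cmod_one_minus_rcis_ge:
  assumes r: "0 \<le> r" "r < 1"
  shows "- ln (1 - r) \<le> integral {0..2*pi} (\<lambda>\<theta>. cmod (1 - rcis r \<theta>) powr (- 1))"
proof -
  let ?f = "\<lambda>\<theta>. cmod (1 - rcis r \<theta>) powr (- 1)"
  have int: "?f integrable_on A" if "A = {0..b}" for A b
    unfolding that by (intro integrable_continuous_real continuous_on_cmod_one_minus_rcis_powr r)
  have "((\<lambda>\<theta>. 1 / (1 - r + \<theta>)) has_integral ln (1 - r + 1) - ln (1 - r + 0)) {0..1}"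
  proof (rule fundamental_theorem_of_calculus)
    fix x :: real assume "x \<in> {0..1}"
    then have "0 < 1 - r + x" using r by auto
    then have "((\<lambda>\<theta>. ln (1 - r + \<theta>)) has_real_derivative 1 / (1 - r + x)) (at x within {0..1})"
      by (auto intro!: derivative_eq_intros)
    then show "((\<lambda>\<theta>. ln (1 - r + \<theta>)) has_vector_derivative 1 / (1 - r + x)) (at x within {0..1})"
      unfolding has_real_derivative_iff_has_vector_derivative .
  qed simp
  note I = this
  have "0 \<le> ln (1 - r + 1)" using r by simp
  then have "- ln (1 - r) \<le> ln (1 - r + 1) - ln (1 - r + 0)" by simp
  also have "\<dots> = integral {0..1} (\<lambda>\<theta>. 1 / (1 - r + \<theta>))" using I by (simp add: integral_unique)
  also have "\<dots> \<le> integral {0..1} ?f"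
  proof (rule integral_le)
    fix \<theta> :: real assume \<theta>: "\<theta> \<in> {0..1}"
    have "1 - rcis r \<theta> = of_real (1 - r) + of_real r * (1 - cis \<theta>)" by (simp add: rcis_def algebra_simps)
    then have "cmod (1 - rcis r \<theta>) \<le> cmod (of_real (1 - r)) + cmod (of_real r * (1 - cis \<theta>))"
      by (simp only: norm_triangle_ineq)
    also have "\<dots> = (1 - r) + r * cmod (1 - cis \<theta>)" using r by (simp add: norm_mult del: of_real_diff)
    also have "cmod (1 - cis \<theta>) = 2 * \<bar>sin (\<theta> / 2)\<bar>"
      using dist_exp_i_1[of \<theta>] by (simp add: cis_conv_exp norm_minus_commute)
    also have "\<dots> \<le> \<theta>" using abs_sin_x_le_abs_x[of "\<theta> / 2"] \<theta> by simp
    also have "r * \<theta> \<le> 1 * \<theta>" using r \<theta> by (intro mult_right_mono) auto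
    finally have "cmod (1 - rcis r \<theta>) \<le> 1 - r + \<theta>" using r by (simp add: mult_left_mono)
    moreover have "0 < cmod (1 - rcis r \<theta>)" using one_minus_rcis_nonzero[OF r] by simp
    ultimately have "1 / (1 - r + \<theta>) \<le> 1 / cmod (1 - rcis r \<theta>)"
      using r \<theta> by (intro divide_left_mono mult_pos_pos) auto
    then show "1 / (1 - r + \<theta>) \<le> ?f \<theta>" by (simp add: powr_minus_divide)
  qed (use I int in \<open>auto simp: integrable_on_def\<close>)
  also have "\<dots> \<le> integral {0..2*pi} ?f"
    using pi_gt3 by (intro integral_subset_le int) auto
  finally show ?thesis .
qed

section \<open>The test function and its growth\<close>

definition disc_power :: "real \<Rightarrow> complex \<Rightarrow> complex" where
  "disc_power a z = exp (- of_real a * Ln (1 - z))"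

text \<open>\<open>1 - z\<close> lies in the right half-plane, away from the branch cut of
  \<open>Ln\<close>, so \<open>disc_power a\<close> is the branch of \<open>(1 - z)^(-a)\<close>
  with value 1 at the origin.\<close>

lemma one_minus_notin_nonpos_Reals:
  assumes "z \<in> unit_disc"
  shows "1 - z \<notin> \<real>\<^sub>\<le>\<^sub>0" "1 - z \<noteq> 0"
proof -
  have "Re z < 1" using assms complex_Re_le_cmod[of z] by simp
  then show "1 - z \<notin> \<real>\<^sub>\<le>\<^sub>0" "1 - z \<noteq> 0" by (auto simp: complex_nonpos_Reals_iff)
qed

lemma holomorphic_disc_power: "disc_power a holomorphic_on unit_disc"
  unfolding disc_power_def using one_minus_notin_nonpos_Reals by (intro holomorphic_intros) auto

lemma cmod_disc_power:
  assumes "z \<in> unit_disc"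
  shows "cmod (disc_power a z) = cmod (1 - z) powr (- a)"
  using one_minus_notin_nonpos_Reals[OF assms] by (simp add: disc_power_def norm_exp_eq_Re powr_def)

lemma cmod_deriv_disc_power:
  assumes a: "0 < a" and z: "z \<in> unit_disc"
  shows "cmod (deriv (disc_power a) z) = a * cmod (1 - z) powr (- (a + 1))"
proof -
  note nz = one_minus_notin_nonpos_Reals[OF z]
  have "((\<lambda>z. 1 - z) has_field_derivative - 1) (at z)" by (auto intro!: derivative_eq_intros)
  from DERIV_chain2[OF has_field_derivative_Ln[OF nz(1)] this]
  have "((\<lambda>z. - of_real a * Ln (1 - z)) has_field_derivative - of_real a * (inverse (1 - z) * - 1)) (at z)"
    by (rule DERIV_cmult)
  from DERIV_chain2[OF DERIV_exp this]
  have "(disc_power a has_field_derivative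
      exp (- of_real a * Ln (1 - z)) * (- of_real a * (inverse (1 - z) * - 1))) (at z)"
    unfolding disc_power_def[abs_def] .
  then have "deriv (disc_power a) z = disc_power a z * (- of_real a * (inverse (1 - z) * - 1))"
    unfolding disc_power_def by (rule DERIV_imp_deriv)
  then have "cmod (deriv (disc_power a) z) = cmod (1 - z) powr (- a) * a * cmod (1 - z) powr (- 1)"
    using a nz(2) by (simp add: norm_mult norm_inverse cmod_disc_power[OF z] powr_minus)
  also have "\<dots> = a * cmod (1 - z) powr (- a + - 1)" unfolding powr_add by simp
  finally show ?thesis by simp
qed

text \<open>With \<open>a = 1 / q'\<close> the q'-th power of \<open>|f|\<close> is exactly
  \<open>|1 - z|^(-1)\<close>, whose circle integrals diverge like a logarithm, while the p-th power
  of the gradient is a multiple of \<open>|1 - z|^(-\<beta>)\<close>. The condition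
  \<open>\<beta> = (1 / q' + 1) * p < 1\<close> is equivalent to
  \<open>q' > p / (1 - p)\<close>.\<close>

lemma harmonic_quasiregular_index_sharp:
  fixes K K' p q' :: real
  assumes K: "1 \<le> K" "0 \<le> K'" and p: "0 < p" "p < 1" and q': "p / (1 - p) < q'"
  shows "\<exists>f. harmonic_quasiregular K K' f \<and> Im (f 0) = 0 \<and>
           (\<lambda>z. complex_of_real (grad_norm (\<lambda>w. Re (f w)) z)) \<in> Hg p \<and> f \<notin> Hg q'"
proof -
  have "0 < p / (1 - p)" using p by simp
  then have q0: "0 < q'" using q' by linarith
  define a where "a = 1 / q'"
  have a: "0 < a" "a * q' = 1" using q0 by (auto simp: a_def)
  define \<beta> where "\<beta> = (a + 1) * p"
  have \<beta>: "0 < \<beta>" "\<beta> < 1"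
  proof -
    show "0 < \<beta>" using a p by (simp add: \<beta>_def)
    have "p < q' * (1 - p)" using q' p by (simp add: field_simps)
    then have "a * p < a * (q' * (1 - p))" using a(1) by (rule mult_strict_left_mono)
    also have "\<dots> = 1 - p" using a(2) by (simp add: mult.assoc[symmetric])
    finally show "\<beta> < 1" by (simp add: \<beta>_def algebra_simps)
  qed
  define f where "f = disc_power a"
  have hol: "f holomorphic_on unit_disc" unfolding f_def by (rule holomorphic_disc_power)
  have cf: "continuous_on unit_disc f" using hol by (rule holomorphic_on_imp_continuous_on)
  have "f 0 = 1" by (simp add: f_def disc_power_def)
  define G where "G z = complex_of_real (grad_norm (\<lambda>w. Re (f w)) z)" for z
  have cG: "continuous_on unit_disc G"
    unfolding G_def by (intro continuous_on_of_real continuous_on_grad_norm_Re holomorphic_C1_on hol) auto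
  have nG: "cmod (G z) = a * cmod (1 - z) powr (- (a + 1))" if "z \<in> unit_disc" for z
  proof -
    have "cmod (G z) = cmod (deriv f z)"
      using grad_norm_Re_holomorphic[OF hol that] by (simp add: G_def)
    then show ?thesis unfolding f_def by (simp only: cmod_deriv_disc_power[OF a(1) that])
  qed
  obtain B where B: "\<And>r. 0 \<le> r \<Longrightarrow> r < 1 \<Longrightarrow> integral {0..2*pi} (\<lambda>\<theta>. cmod (1 - rcis r \<theta>) powr (- \<beta>)) \<le> B"
    by (rule integral_cmod_one_minus_rcis_powr_bounded[OF \<beta>]) (rule that)
  have "integral {0..2*pi} (\<lambda>\<theta>. cmod (G (rcis r \<theta>)) powr p) \<le> a powr p * B" if r: "0 \<le> r" "r < 1" for r
  proof -
    have "cmod (G (rcis r \<theta>)) powr p = a powr p * cmod (1 - rcis r \<theta>) powr (- \<beta>)" for \<theta>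
    proof -
      have z: "rcis r \<theta> \<in> unit_disc" using r by simp
      have "- (a + 1) * p = - \<beta>" by (simp add: \<beta>_def algebra_simps)
      then show ?thesis using a(1) unfolding nG[OF z] by (simp only: powr_mult powr_powr)
    qed
    then show ?thesis using B[OF r] by (simp add: mult_left_mono)
  qed
  then have GH: "G \<in> Hg p" unfolding Hg_continuous_iff[OF cG p(1)] by blast
  have "f \<notin> Hg q'"
  proof
    assume "f \<in> Hg q'"
    then obtain B where B: "\<And>r. 0 \<le> r \<Longrightarrow> r < 1 \<Longrightarrow> integral {0..2*pi} (\<lambda>\<theta>. cmod (f (rcis r \<theta>)) powr q') \<le> B"
      unfolding Hg_continuous_iff[OF cf q0] by blast
    have le: "- ln (1 - r) \<le> B" if r: "0 \<le> r" "r < 1" for r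
    proof -
      have "cmod (f (rcis r \<theta>)) powr q' = cmod (1 - rcis r \<theta>) powr (- 1)" for \<theta>
        using r a(2) by (simp add: f_def cmod_disc_power powr_powr)
      then show ?thesis
        using integral_inverse_cmod_one_minus_rcis_ge[OF r] B[OF r] by simp
    qed
    \<comment> \<open>Chosen so that \<open>- ln (1 - r) = |B| + 1\<close>, which exceeds
      \<open>B\<close>.\<close>
    define r where "r = 1 - exp (- (\<bar>B\<bar> + 1))"
    have "0 \<le> r" "r < 1" by (auto simp: r_def)
    from le[OF this] show False by (simp add: r_def)
  qed
  moreover have "harmonic_quasiregular K K' f" by (rule holomorphic_harmonic_quasiregular[OF hol K])
  ultimately show ?thesis using GH \<open>f 0 = 1\<close> unfolding G_def by (intro exI[of _ f]) simp
qed

theorem theorem2p6: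
  fixes K K' p :: real
  assumes "K \<ge> 1" and "K' \<ge> 0" and "0 < p" and "p < 1"
  shows "(\<forall>f. harmonic_quasiregular K K' f \<and> Im (f 0) = 0 \<and>
              (\<lambda>z. complex_of_real (grad_norm (\<lambda>w. Re (f w)) z)) \<in> Hg p
           \<longrightarrow> (\<lambda>z. complex_of_real (Im (f z))) \<in> h_space (p / (1 - p)) \<and>
               f \<in> h_space (p / (1 - p)))
       \<and> (\<forall>q'>p / (1 - p). \<exists>f. harmonic_quasiregular K K' f \<and> Im (f 0) = 0 \<and>
              (\<lambda>z. complex_of_real (grad_norm (\<lambda>w. Re (f w)) z)) \<in> Hg p \<and>
              \<not> ((\<lambda>z. complex_of_real (Im (f z))) \<in> h_space q' \<and> f \<in> h_space q'))"
proof (intro conjI allI impI)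
  have q: "0 < p / (1 - p)" using assms by simp
  fix f
  assume "harmonic_quasiregular K K' f \<and> Im (f 0) = 0 \<and>
    (\<lambda>z. complex_of_real (grad_norm (\<lambda>w. Re (f w)) z)) \<in> Hg p"
  then have f: "harmonic_quasiregular K K' f"
    "(\<lambda>z. complex_of_real (grad_norm (\<lambda>w. Re (f w)) z)) \<in> Hg p" by blast+
  have h: "harmonic_on unit_disc f" using f(1) by (simp add: harmonic_quasiregular_def)
  have H: "f \<in> Hg (p / (1 - p))" by (rule harmonic_quasiregular_Hg[OF assms f])
  show "f \<in> h_space (p / (1 - p))" using H h by (simp add: h_space_def)
  show "(\<lambda>z. complex_of_real (Im (f z))) \<in> h_space (p / (1 - p))" by (rule h_space_Im[OF q H h])
next
  fix q' assume "p / (1 - p) < q'"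
  \<comment> \<open>The conjunction fails through \<open>f\<close> itself, which already misses
    \<open>Hg q'\<close>.\<close>
  from harmonic_quasiregular_index_sharp[OF assms this]
  show "\<exists>f. harmonic_quasiregular K K' f \<and> Im (f 0) = 0 \<and>
              (\<lambda>z. complex_of_real (grad_norm (\<lambda>w. Re (f w)) z)) \<in> Hg p \<and>
              \<not> ((\<lambda>z. complex_of_real (Im (f z))) \<in> h_space q' \<and> f \<in> h_space q')"
    unfolding h_space_def by blast
qed

end
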